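(* Fix an integer $k\geq 2$. If $t=t(n)=\omega(n^{2-1/k})$, then there exists $b=n^{2k-1+o(1)}/t^{k-1}$ for which there is a successful $(t,b)$-strategy for the $k$-th power of a Hamilton cycle.
   Context: Budget-constrained random graph process: let $M=\binom{n}{2}$. The edges of $K_n$ on vertex set $[n]$ are put in a uniformly random order $e_1,e_2,\ldots,e_M$. Builder is presented $e_1,\ldots,e_t$ one by one (with $t\leq M$) and, as each edge is presented and without knowledge of future edges, must irrevocably decide (possibly using additional randomness) whether to purchase it; she may purchase at most $b$ edges in total. A $(t,b)$-strategy is a rule for these decisions; $B_t$ denotes the graph of purchased edges after time $t$. A strategy is successful for a property $\mathcal{P}$ if $B_t$ satisfies $\mathcal{P}$ with probability tending to $1$ as $n\to\infty$. The $k$-th power of a graph $G$ is obtained from $G$ by joining every pair of vertices at distance at most $k$ in $G$; the property considered is that $B_t$ contains the $k$-th power of a cycle through all $n$ vertices. *)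

theory Defs
  imports
    "HOL-Probability.Probability"
    "HOL-Combinatorics.Multiset_Permutations"
    "HOL-Library.Landau_Symbols"
    "HOL-Library.Extended_Nat"
begin

section \<open>Graphs as edge sets\<close>

text \<open>A graph on the vertex set \<open>{1..n}\<close> is represented by its set of edges, each edge being a
  two-element set of vertices.\<close>

type_synonym edge = "nat set"

definition complete_edges :: "nat \<Rightarrow> edge set" where
  "complete_edges n = {e. e \<subseteq> {1..n} \<and> card e = 2}"

definition adj :: "edge set \<Rightarrow> (nat \<times> nat) set" where
  "adj G = {(u, v). u \<noteq> v \<and> {u, v} \<in> G}"

text \<open>The infimum ranges over the lengths of walks from \<open>u\<close> to \<open>v\<close>; it is \<open>\<infinity>\<close> if there are none.\<close>

definition graph_dist :: "edge set \<Rightarrow> nat \<Rightarrow> nat \<Rightarrow> enat" where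
  "graph_dist G u v = (INF i \<in> {i. (u, v) \<in> adj G ^^ i}. enat i)"

definition graph_power :: "nat \<Rightarrow> edge set \<Rightarrow> edge set" where
  "graph_power k G = {{u, v} | u v. u \<noteq> v \<and> graph_dist G u v \<le> enat k}"

definition hamilton_cycle :: "nat \<Rightarrow> edge set \<Rightarrow> bool" where
  "hamilton_cycle n C \<longleftrightarrow> n \<ge> 3 \<and>
     (\<exists>vs \<in> permutations_of_set {1..n}. C = {{vs ! i, vs ! (Suc i mod n)} | i. i < n})"

definition contains_hamilton_cycle_power :: "nat \<Rightarrow> nat \<Rightarrow> edge set \<Rightarrow> bool" where
  "contains_hamilton_cycle_power k n G \<longleftrightarrow> (\<exists>C. hamilton_cycle n C \<and> graph_power k C \<subseteq> G)"

section \<open>The budget-constrained random graph process\<close>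

text \<open>A history lists the edges presented so far, in order of presentation, each with a flag telling
  whether it was purchased. Given the history and the edge now presented, Builder draws her decision
  from a distribution on \<^typ>\<open>bool\<close>; this distribution is her additional randomness.\<close>

type_synonym history = "(edge \<times> bool) list"
type_synonym strategy = "history \<Rightarrow> edge \<Rightarrow> bool pmf"

primrec play :: "strategy \<Rightarrow> history \<Rightarrow> edge list \<Rightarrow> history pmf" where
  "play S h [] = return_pmf h"
| "play S h (e # es) = bind_pmf (S h e) (\<lambda>d. play S (h @ [(e, d)]) es)"

definition purchased :: "history \<Rightarrow> edge set" where
  "purchased h = {e. (e, True) \<in> set h}"

text \<open>The distribution of the graph \<open>B\<^sub>t\<close> of purchased edges.\<close>

definition builder_graph :: "nat \<Rightarrow> nat \<Rightarrow> strategy \<Rightarrow> edge set pmf" where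
  "builder_graph n t S =
     bind_pmf (pmf_of_set (permutations_of_set (complete_edges n)))
       (\<lambda>es. map_pmf purchased (play S [] (take t es)))"

text \<open>The budget is a hard constraint: it is respected in every outcome of positive probability.\<close>

definition tb_strategy :: "nat \<Rightarrow> nat \<Rightarrow> nat \<Rightarrow> strategy \<Rightarrow> bool" where
  "tb_strategy n t b S \<longleftrightarrow> (\<forall>B \<in> set_pmf (builder_graph n t S). card B \<le> b)"

definition successful_strategy ::
  "(nat \<Rightarrow> nat) \<Rightarrow> (nat \<Rightarrow> nat) \<Rightarrow> (nat \<Rightarrow> edge set \<Rightarrow> bool) \<Rightarrow> (nat \<Rightarrow> strategy) \<Rightarrow> bool" where
  "successful_strategy t b P S \<longleftrightarrow>
     (\<forall>n. tb_strategy n (t n) (b n) (S n)) \<and>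
     (\<lambda>n. measure_pmf.prob (builder_graph n (t n) (S n)) {B. P n B}) \<longlonglongrightarrow> 1"

end

theory Submission
  imports Defs "HOL-Real_Asymp.Real_Asymp"
begin

text \<open>
  Write \<open>p\<close> for the density \<open>t / (n choose 2)\<close>. Builder fixes in advance a sparse host graph: the
  vertices are cut into clusters of size about \<open>m = p\<^sup>-\<^sup>k n\<^bsup>o(1)\<^esup>\<close> arranged cyclically, and the host
  graph contains only pairs in the same or in nearby clusters. It has \<open>O(n m)\<close> edges, so buying every
  host edge that is presented costs about \<open>p n m = n\<^bsup>1+o(1)\<^esup> p\<^bsup>-(k-1)\<^esup>\<close>, and by Markov's inequality
  the budget is not exhausted.

  That the purchased graph contains the \<open>k\<close>-th power of a Hamilton cycle is a threshold statement
  for random cluster-preserving copies of the \<open>k\<close>-th power \<open>P\<close> of a cycle, proved with minimum fragments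
  (Kahn--Narayanan--Park, Park--Pham). Split the random edges into rounds. After a round, the fragment of a
  copy \<open>S\<close> is a smallest set \<open>S' - W\<close>, where \<open>W\<close> is the set of edges seen so far and the copy \<open>S'\<close> lies
  in \<open>W \<union> S\<close>. Each round shrinks the fragments of most copies by a factor of about \<open>sqrt m\<close>. This is
  because a connected piece of \<open>P\<close> with \<open>l\<close> edges has at least \<open>l / k + 3 / 2\<close> vertices unless it winds
  around the whole cycle, hence it is expected to appear in a fragment \<open>T\<close> only about
  \<open>card T * m\<^bsup>-1/2\<^esup>\<close> times when weighted by the density \<open>m\<^bsup>-1/k\<^esup>\<close> of its edges.
  Three rounds suffice when \<open>m = n\<close>, so that no logarithm is lost at the threshold, and \<open>O(sqrt (ln n))\<close>
  rounds suffice otherwise, when \<open>m\<close> is large enough to pay for them.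
\<close>

section \<open>Minimum fragments\<close>

text \<open>The first \<open>t\<close> edges of a random order form a uniform \<open>t\<close>-set,
  so every probability becomes a proportion of edge sets of fixed size, and a round is a block of
  \<open>w\<close> fresh edges. The number r of rounds enters the error twice: the failures of the
  rounds add up, and each round has only w = t / r edges. Hence r^2 must be paid for. This shapes
  the parameters, because for \<open>t\<close> barely above n^(2-1/k) the whole vertex set is one
  cluster and there is nothing to pay with: r must be a constant there, and the error must come out
  as O(n^(2-1/k) / t). The gain sqrt m per round comes from the half by which 3 / 2 exceeds 1. A
  connected piece is located by one root. A given vertex of the fragment can be the image of up to 2
  m positions of the root, which uses up one unit of the exponent; the remaining half is the
  gain.\<close>

definition subsets_of_card :: "'a set \<Rightarrow> nat \<Rightarrow> 'a set set" where
  "subsets_of_card X u = {U. U \<subseteq> X \<and> card U = u}"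

lemma finite_subsets_of_card [simp]: "finite X \<Longrightarrow> finite (subsets_of_card X u)"
  by (simp add: subsets_of_card_def)

lemma card_subsets_of_card: "finite X \<Longrightarrow> card (subsets_of_card X u) = card X choose u"
  by (simp add: subsets_of_card_def n_subsets)

text \<open>Consecutive binomials C(M, a) and C(M, a + 1) have ratio (M - a) / (a + 1), which is at
  most N / w for a \<ge> w. This is the price per edge of enlarging a round \<open>W\<close> to
  \<open>W \<union> T'\<close>. Taking for \<open>N\<close> the number of all edges makes the price
  the same in every round.\<close>

lemma binomial_add_le:
  assumes "M \<le> N"
  shows "(M choose (w + j)) * w ^ j \<le> N ^ j * (M choose w)"
proof (induction j)
  case (Suc j)
  have eq: "Suc (w + j) * (M choose Suc (w + j)) = (M - (w + j)) * (M choose (w + j))"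
  proof (cases M)
    case (Suc m)
    then show ?thesis
      using binomial_absorption[of "w + j" M] binomial_absorb_comp[of M "w + j"] by simp
  qed simp
  have "(M choose (w + Suc j)) * w ^ Suc j = (w * (M choose Suc (w + j))) * w ^ j"
    by (simp add: mult_ac)
  also have "\<dots> \<le> (Suc (w + j) * (M choose Suc (w + j))) * w ^ j"
    by (intro mult_right_mono) auto
  also have "\<dots> \<le> N * ((M choose (w + j)) * w ^ j)"
    unfolding eq using assms by (simp only: mult.assoc) (intro mult_right_mono; simp)
  also have "\<dots> \<le> N * (N ^ j * (M choose w))"
    using Suc.IH by (rule mult_left_mono) simp
  finally show ?case by (simp add: mult_ac)
qed simp

text \<open>Double counting of the pairs of a (u + w)-set and a u-subset of it. It expresses that a
  round drawn from the unseen edges turns a uniform u-set into a uniform (u + w)-set.\<close>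

lemma sum_subsets_of_card_split:
  fixes f :: "'a set \<Rightarrow> real"
  assumes "finite X"
  shows "(\<Sum>U\<in>subsets_of_card X u. \<Sum>W\<in>subsets_of_card (X - U) w. f (U \<union> W)) =
         real ((u + w) choose u) * (\<Sum>V\<in>subsets_of_card X (u + w). f V)"
proof -
  have "(\<Sum>U\<in>subsets_of_card X u. \<Sum>W\<in>subsets_of_card (X - U) w. f (U \<union> W)) =
        (\<Sum>(U, W)\<in>(SIGMA U:subsets_of_card X u. subsets_of_card (X - U) w). f (U \<union> W))"
    using assms by (simp add: sum.Sigma)
  also have "\<dots> = (\<Sum>(V, U)\<in>(SIGMA V:subsets_of_card X (u + w). subsets_of_card V u). f V)"
  proof (rule sum.reindex_bij_witness[where j = "\<lambda>(U, W). (U \<union> W, U)" and i = "\<lambda>(V, U). (U, V - U)"],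
      goal_cases)
    case (2 p)
    then show ?case
      using assms by (cases p) (auto simp: subsets_of_card_def intro!: card_Un_disjoint intro: finite_subset)
  next
    case (4 p)
    then show ?case
      using assms by (auto simp: subsets_of_card_def card_Diff_subset finite_subset subset_iff)
  qed (use assms in \<open>auto simp: subsets_of_card_def\<close>)
  also have "\<dots> = (\<Sum>V\<in>subsets_of_card X (u + w). \<Sum>U\<in>subsets_of_card V u. f V)"
    using assms by (subst sum.Sigma) (auto simp: subsets_of_card_def finite_subset)
  also have "\<dots> = (\<Sum>V\<in>subsets_of_card X (u + w). real ((u + w) choose u) * f V)"
    using assms by (intro sum.cong refl)
      (auto simp: card_subsets_of_card finite_subset subsets_of_card_def n_subsets)
  finally show ?thesis by (simp add: sum_distrib_left)
qed

text \<open>An index is bad when its minimum fragment has at least \<open>\<tau>\<close> elements.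
  Quantifying over all candidates \<open>j\<close>, among them \<open>i\<close> itself, avoids
  choosing a fragment.\<close>

definition bad_indices :: "'i set \<Rightarrow> ('i \<Rightarrow> 'e set) \<Rightarrow> real \<Rightarrow> 'e set \<Rightarrow> 'i set" where
  "bad_indices I S \<tau> U = {i \<in> I. \<forall>j\<in>I. S j \<subseteq> U \<union> S i \<longrightarrow> \<tau> \<le> real (card (S j - U))}"

text \<open>Here \<open>W\<close> is a round and \<open>T'\<close> the new fragment of an index \<open>i\<close>. The pair \<open>(W, i)\<close> is recovered from
  \<open>(Z, T', i)\<close> with \<open>Z = W \<union> T'\<close>, and minimality forces \<open>T'\<close> to lie in a fragment \<open>pick Z\<close> that depends
  on \<open>Z\<close> alone; this leaves few choices for \<open>T'\<close>.\<close>

lemma bad_indices_round: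
  fixes S :: "'i \<Rightarrow> 'e set" and \<tau> \<tau>' \<beta> \<eta> :: real and w :: nat
  assumes fin: "finite I" "finite X" and sub: "\<And>i. i \<in> I \<Longrightarrow> S i \<subseteq> X" and U: "U \<subseteq> X"
    and spread: "\<And>i T l. i \<in> I \<Longrightarrow> T \<subseteq> S i \<Longrightarrow> real (card T) < \<tau> \<Longrightarrow>
      (\<Sum>T'\<in>subsets_of_card T l. real (card {\<sigma> \<in> I. T' \<subseteq> S \<sigma>})) \<le> \<beta> ^ l * exp \<tau>' * card I"
    and \<tau>': "\<tau>' \<ge> 1" and w: "w > 0" and \<beta>: "\<beta> \<ge> 0"
    and \<eta>: "\<eta> = \<beta> * card X / w" "exp 1 * \<eta> \<le> 1 / 2"
  shows "(\<Sum>W\<in>subsets_of_card (X - U) w. real (card (bad_indices I S \<tau>' (U \<union> W)))) \<le>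
         real (card (X - U) choose w) * (card (bad_indices I S \<tau> U) + card I * (2 * exp 1 * \<eta>))"
proof -
  define Y where "Y = X - U"
  have finY: "finite Y" using fin by (simp add: Y_def)
  define F where "F = {S j - U | j. j \<in> I \<and> real (card (S j - U)) < \<tau>}"
  define pick where "pick Z = (SOME T. T \<in> F \<and> T \<subseteq> Z)" for Z
  define G where "G W = {i \<in> bad_indices I S \<tau>' (U \<union> W). i \<notin> bad_indices I S \<tau> U}" for W
  define L where "L = {l. \<tau>' \<le> real l \<and> l \<le> card X}"
  have finL: "finite L" by (rule finite_subset[of _ "{..card X}"]) (auto simp: L_def)
  define R where "R = (SIGMA l:L. SIGMA Z:{Z \<in> subsets_of_card Y (w + l). \<exists>T\<in>F. T \<subseteq> Z}.
                        SIGMA T':subsets_of_card (pick Z) l. {\<sigma> \<in> I. T' \<subseteq> S \<sigma>})"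
  have pick: "pick Z \<in> F" "pick Z \<subseteq> Z" if "\<exists>T\<in>F. T \<subseteq> Z" for Z
    using someI_ex[of "\<lambda>T. T \<in> F \<and> T \<subseteq> Z"] that unfolding pick_def by auto
  have finF: "finite T" if "T \<in> F" for T
    using that fin sub unfolding F_def by (auto intro: finite_subset)
  have finR: "finite R"
    unfolding R_def using finL finY fin pick finF
    by (intro finite_SigmaI) (auto intro!: finite_subsets_of_card finF pick)
  have key: "\<exists>T'. T' \<inter> W = {} \<and> (card T', W \<union> T', T', i) \<in> R"
    if W: "W \<in> subsets_of_card Y w" and i: "i \<in> G W" for W i
  proof -
    have iI: "i \<in> I" using i by (auto simp: G_def bad_indices_def)
    obtain j0 where j0: "j0 \<in> I" "S j0 \<subseteq> U \<union> S i" "real (card (S j0 - U)) < \<tau>"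
      using i iI by (force simp: G_def bad_indices_def not_le)
    \<comment> \<open>Only members of \<open>F\<close> compete, because the spread hypothesis speaks
      of sets with fewer than \<open>\<tau>\<close> elements.\<close>
    define C where "C = {T \<in> F. T \<subseteq> W \<union> S i}"
    have "S j0 - U \<in> C" using j0 by (auto simp: C_def F_def)
    then obtain T where T: "T \<in> C" and Tmin: "\<And>T2. T2 \<in> C \<Longrightarrow> card (T - W) \<le> card (T2 - W)"
      using ex_has_least_nat[of "\<lambda>T. T \<in> C" _ "\<lambda>T. card (T - W)"] by blast
    define T' where "T' = T - W"
    obtain j where j: "j \<in> I" "T = S j - U" "real (card (S j - U)) < \<tau>"
      using T by (auto simp: C_def F_def)
    have finT: "finite T" using T finF by (auto simp: C_def)
    have T'i: "T' \<subseteq> S i" using T by (auto simp: T'_def C_def)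
    have T'Y: "T' \<subseteq> Y" using sub[OF j(1)] j(2) by (auto simp: T'_def Y_def)
    have "S j \<subseteq> U \<union> W \<union> S i" using T j by (auto simp: C_def)
    moreover have "S j - (U \<union> W) = T'" using j by (auto simp: T'_def)
    ultimately have big: "\<tau>' \<le> real (card T')"
      using i j(1) by (auto simp: G_def bad_indices_def)
    have finW: "finite W" using W finY by (auto simp: subsets_of_card_def intro: finite_subset)
    have ex: "\<exists>T2\<in>F. T2 \<subseteq> W \<union> T'" using T by (auto simp: C_def T'_def)
    \<comment> \<open>\<open>W \<union> T'\<close> lies in \<open>W \<union> S i\<close>, so the set
      picked inside it competes with \<open>T\<close> and is no smaller outside \<open>W\<close>.
      But outside \<open>W\<close> it has only \<open>T'\<close> to draw from.\<close>
    have "pick (W \<union> T') \<in> C" using pick[OF ex] T'i by (auto simp: C_def)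
    then have "card T' \<le> card (pick (W \<union> T') - W)" using Tmin by (simp add: T'_def)
    moreover have "pick (W \<union> T') - W \<subseteq> T'" using pick(2)[OF ex] by auto
    ultimately have eq: "pick (W \<union> T') - W = T'"
      using finT by (intro card_seteq) (auto simp: T'_def)
    have "card T' \<le> card X"
      using T'Y fin by (intro card_mono) (auto simp: Y_def)
    moreover have "card (W \<union> T') = w + card T'"
      using W finW finT by (subst card_Un_disjoint) (auto simp: subsets_of_card_def T'_def)
    ultimately have "(card T', W \<union> T', T', i) \<in> R"
      using big ex eq W T'Y iI T'i by (auto simp: R_def L_def subsets_of_card_def)
    then show ?thesis by (intro exI[of _ T']) (auto simp: T'_def)
  qed
  have "card (SIGMA W:subsets_of_card Y w. G W) \<le> card R"
  proof -
    have "(SIGMA W:subsets_of_card Y w. G W) \<subseteq> (\<lambda>(l, Z, T', i). (Z - T', i)) ` R"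
    proof safe
      fix W i assume "W \<in> subsets_of_card Y w" "i \<in> G W"
      then obtain T' where "T' \<inter> W = {}" "(card T', W \<union> T', T', i) \<in> R" using key by blast
      moreover from this have "(W, i) = (\<lambda>(l, Z, T', i). (Z - T', i)) (card T', W \<union> T', T', i)" by auto
      ultimately show "(W, i) \<in> (\<lambda>(l, Z, T', i). (Z - T', i)) ` R" by blast
    qed
    then show ?thesis using finR by (meson card_image_le card_mono finite_imageI le_trans)
  qed
  also have "card (SIGMA W:subsets_of_card Y w. G W) = (\<Sum>W\<in>subsets_of_card Y w. card (G W))"
    using finY fin by (intro card_SigmaI) (auto simp: G_def bad_indices_def)
  also have "real (card R) = (\<Sum>l\<in>L. \<Sum>Z\<in>{Z \<in> subsets_of_card Y (w + l). \<exists>T\<in>F. T \<subseteq> Z}.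
      \<Sum>T'\<in>subsets_of_card (pick Z) l. real (card {\<sigma> \<in> I. T' \<subseteq> S \<sigma>}))"
    unfolding R_def using finL finY fin pick finF by (subst card_SigmaI)
      (auto intro!: finite_SigmaI finite_subsets_of_card finF pick sum.cong simp: card_SigmaI)
  finally have "(\<Sum>W\<in>subsets_of_card Y w. real (card (G W))) \<le> \<dots>" by simp
  also have "\<dots> \<le> (\<Sum>l\<in>L. \<Sum>Z\<in>{Z \<in> subsets_of_card Y (w + l). \<exists>T\<in>F. T \<subseteq> Z}. \<beta> ^ l * exp \<tau>' * card I)"
  proof (intro sum_mono)
    fix l Z assume Z: "Z \<in> {Z \<in> subsets_of_card Y (w + l). \<exists>T\<in>F. T \<subseteq> Z}"
    obtain j where "j \<in> I" "pick Z = S j - U" "real (card (S j - U)) < \<tau>"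
      using pick(1)[of Z] Z by (auto simp: F_def)
    then show "(\<Sum>T'\<in>subsets_of_card (pick Z) l. real (card {\<sigma> \<in> I. T' \<subseteq> S \<sigma>})) \<le> \<beta> ^ l * exp \<tau>' * card I"
      using spread[of j "pick Z" l] by auto
  qed
  also have "\<dots> \<le> (\<Sum>l\<in>L. real (card Y choose (w + l)) * (\<beta> ^ l * exp \<tau>' * card I))"
  proof (intro sum_mono)
    fix l
    have "card {Z \<in> subsets_of_card Y (w + l). \<exists>T\<in>F. T \<subseteq> Z} \<le> card Y choose (w + l)"
      using finY by (subst card_subsets_of_card[symmetric]) (auto intro: card_mono)
    then show "(\<Sum>Z\<in>{Z \<in> subsets_of_card Y (w + l). \<exists>T\<in>F. T \<subseteq> Z}. \<beta> ^ l * exp \<tau>' * card I)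
      \<le> real (card Y choose (w + l)) * (\<beta> ^ l * exp \<tau>' * card I)"
      using \<beta> by (simp add: mult_right_mono)
  qed
  also have "\<dots> \<le> (\<Sum>l\<in>L. real (card Y choose w) * card I * (exp 1 * \<eta>) ^ l)"
  proof (intro sum_mono)
    fix l assume l: "l \<in> L"
    have "card Y \<le> card X" using fin by (auto simp: Y_def intro: card_mono)
    then have "real ((card Y choose (w + l)) * w ^ l) \<le> real (card X ^ l * (card Y choose w))"
      using binomial_add_le of_nat_mono by blast
    then have 1: "real (card Y choose (w + l)) \<le> (card X / w) ^ l * (card Y choose w)"
      using w by (simp add: field_simps)
    \<comment> \<open>Newly bad indices have fragments of size \<open>l \<ge> \<tau>'\<close>, so
      the factor \<open>exp \<tau>'\<close> of the spread bound costs only a factor e per element of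
      \<open>T'\<close>.\<close>
    have "exp \<tau>' \<le> exp (real l)" using l by (simp add: L_def)
    also have "\<dots> = exp 1 ^ l" using exp_of_nat_mult[of l "1::real"] by simp
    finally have 2: "exp \<tau>' \<le> exp 1 ^ l" .
    have "real (card Y choose (w + l)) * (\<beta> ^ l * exp \<tau>' * card I) \<le>
      ((card X / w) ^ l * (card Y choose w)) * (\<beta> ^ l * exp 1 ^ l * card I)"
      using 1 2 \<beta> by (intro mult_mono mult_right_mono mult_left_mono) auto
    also have "\<dots> = real (card Y choose w) * card I * (exp 1 * \<eta>) ^ l"
      by (simp add: \<eta> power_mult_distrib power_divide field_simps)
    finally show "real (card Y choose (w + l)) * (\<beta> ^ l * exp \<tau>' * card I) \<le>
      real (card Y choose w) * card I * (exp 1 * \<eta>) ^ l" .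
  qed
  also have "\<dots> = real (card Y choose w) * card I * (\<Sum>l\<in>L. (exp 1 * \<eta>) ^ l)"
    by (simp add: sum_distrib_left)
  also have "\<dots> \<le> real (card Y choose w) * card I * (2 * exp 1 * \<eta>)"
  proof (intro mult_left_mono)
    let ?q = "exp 1 * \<eta>"
    have q: "0 \<le> ?q" "?q \<le> 1 / 2" using \<beta> \<eta> by auto
    \<comment> \<open>There is no term with l = 0 since \<open>\<tau>' \<ge> 1\<close>; this makes
      the geometric series O(\<eta>) instead of O(1).\<close>
    have "L \<subseteq> {1..card X}" using \<tau>' by (auto simp: L_def)
    then have "(\<Sum>l\<in>L. ?q ^ l) \<le> (\<Sum>l\<in>{1..card X}. ?q ^ l)"
      using q by (intro sum_mono2) auto
    also have "\<dots> = ?q * (\<Sum>l<card X. ?q ^ l)"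
      by (simp add: sum_distrib_left sum.atLeast1_atMost_eq power_Suc)
    also have "(\<Sum>l<card X. ?q ^ l) \<le> 2"
    proof -
      have "(\<Sum>l<card X. ?q ^ l) \<le> (\<Sum>l. ?q ^ l)"
        using q by (intro sum_le_suminf summable_geometric) auto
      also have "\<dots> = 1 / (1 - ?q)" using q by (subst suminf_geometric) auto
      also have "\<dots> \<le> 2" using q by (simp add: field_simps)
      finally show ?thesis .
    qed
    then have "?q * (\<Sum>l<card X. ?q ^ l) \<le> ?q * 2" using q by (intro mult_left_mono) auto
    finally show "(\<Sum>l\<in>L. ?q ^ l) \<le> 2 * exp 1 * \<eta>" by simp
  qed auto
  finally have new: "(\<Sum>W\<in>subsets_of_card Y w. real (card (G W))) \<le> 
    real (card Y choose w) * card I * (2 * exp 1 * \<eta>)" .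
  have "(\<Sum>W\<in>subsets_of_card Y w. real (card (bad_indices I S \<tau>' (U \<union> W)))) \<le>
    (\<Sum>W\<in>subsets_of_card Y w. real (card (bad_indices I S \<tau> U)) + real (card (G W)))"
  proof (intro sum_mono)
    fix W
    have "card (bad_indices I S \<tau>' (U \<union> W)) \<le> card (bad_indices I S \<tau> U \<union> G W)"
      using fin by (intro card_mono) (auto simp: G_def bad_indices_def)
    also have "\<dots> \<le> card (bad_indices I S \<tau> U) + card (G W)" by (rule card_Un_le)
    finally show "real (card (bad_indices I S \<tau>' (U \<union> W))) \<le>
      real (card (bad_indices I S \<tau> U)) + real (card (G W))" by simp
  qed
  also have "\<dots> \<le> real (card Y choose w) * (card (bad_indices I S \<tau> U) + card I * (2 * exp 1 * \<eta>))"
    using new finY by (simp add: sum.distrib card_subsets_of_card algebra_simps)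
  finally show ?thesis by (simp add: Y_def)
qed


text \<open>Nothing is bad at the start, since \<open>\<tau> 0\<close> exceeds the size of every
  set. On average over its choice, each round makes at most a proportion 2 e \<eta> of the indices
  newly bad, and these proportions add up.\<close>

lemma bad_indices_iterate:
  fixes S :: "'i \<Rightarrow> 'e set" and \<tau> :: "nat \<Rightarrow> real" and \<beta> \<eta> :: real and w :: nat
  assumes fin: "finite I" "finite X" and sub: "\<And>i. i \<in> I \<Longrightarrow> S i \<subseteq> X"
    and spread: "\<And>n i T l. i \<in> I \<Longrightarrow> T \<subseteq> S i \<Longrightarrow> real (card T) < \<tau> n \<Longrightarrow>
      (\<Sum>T'\<in>subsets_of_card T l. real (card {\<sigma> \<in> I. T' \<subseteq> S \<sigma>})) \<le> \<beta> ^ l * exp (\<tau> (Suc n)) * card I"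
    and \<tau>: "\<And>n. \<tau> (Suc n) \<ge> 1" "\<And>i. i \<in> I \<Longrightarrow> card (S i) < \<tau> 0" and w: "w > 0" and \<beta>: "\<beta> \<ge> 0"
    and \<eta>: "\<eta> = \<beta> * card X / w" "exp 1 * \<eta> \<le> 1 / 2"
    and r: "r * w \<le> card X"
  shows "(\<Sum>U\<in>subsets_of_card X (r * w). real (card (bad_indices I S (\<tau> r) U))) \<le>
         real (card X choose (r * w)) * (card I * (r * (2 * exp 1 * \<eta>)))"
  using r
proof (induction r)
  case 0
  have "bad_indices I S (\<tau> 0) {} = {}"
    using \<tau>(2) by (force simp: bad_indices_def not_le)
  moreover have "subsets_of_card X 0 = {{}}"
    using fin by (auto simp: subsets_of_card_def dest: finite_subset)
  ultimately show ?case by simp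
next
  case (Suc r)
  define f where "f U = real (card (bad_indices I S (\<tau> (Suc r)) U))" for U
  define \<epsilon> where "\<epsilon> = card I * (2 * exp 1 * \<eta>)"
  let ?u = "r * w"
  have u: "?u + w \<le> card X" using Suc.prems by simp
  have "real ((?u + w) choose ?u) * (\<Sum>V\<in>subsets_of_card X (?u + w). f V) =
        (\<Sum>U\<in>subsets_of_card X ?u. \<Sum>W\<in>subsets_of_card (X - U) w. f (U \<union> W))"
    using fin by (simp add: sum_subsets_of_card_split)
  also have "\<dots> \<le> (\<Sum>U\<in>subsets_of_card X ?u.
      real ((card X - ?u) choose w) * (card (bad_indices I S (\<tau> r) U) + \<epsilon>))"
  proof (intro sum_mono)
    fix U assume U: "U \<in> subsets_of_card X ?u"
    then have "card (X - U) = card X - ?u"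
      using fin by (auto simp: subsets_of_card_def card_Diff_subset finite_subset)
    then show "(\<Sum>W\<in>subsets_of_card (X - U) w. f (U \<union> W)) \<le>
        real ((card X - ?u) choose w) * (card (bad_indices I S (\<tau> r) U) + \<epsilon>)"
      using bad_indices_round[where U = U and I = I and S = S and \<tau> = "\<tau> r" and \<tau>' = "\<tau> (Suc r)",
          OF fin sub _ spread \<tau>(1) w \<beta> \<eta>] U
      by (simp add: f_def \<epsilon>_def subsets_of_card_def)
  qed
  also have "\<dots> = real ((card X - ?u) choose w) *
      ((\<Sum>U\<in>subsets_of_card X ?u. real (card (bad_indices I S (\<tau> r) U))) + real (card X choose ?u) * \<epsilon>)"
    using fin by (simp add: sum_distrib_left[symmetric] sum.distrib card_subsets_of_card)
  also have "\<dots> \<le> real ((card X - ?u) choose w) *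
      (real (card X choose ?u) * (card I * (r * (2 * exp 1 * \<eta>))) + real (card X choose ?u) * \<epsilon>)"
    using Suc.IH u by (intro mult_left_mono add_right_mono) auto
  also have "\<dots> = real ((card X choose ?u) * ((card X - ?u) choose w)) * (Suc r * \<epsilon>)"
    by (simp add: \<epsilon>_def algebra_simps)
  \<comment> \<open>Choosing \<open>U\<close> and then \<open>W\<close> yields each union as often
    as it has u-subsets; that factor cancels on both sides.\<close>
  also have "(card X choose ?u) * ((card X - ?u) choose w) = (card X choose (?u + w)) * ((?u + w) choose ?u)"
    using choose_mult[of ?u "?u + w" "card X"] u by simp
  also have "real \<dots> * (Suc r * \<epsilon>) =
      real ((?u + w) choose ?u) * (real (card X choose (?u + w)) * (Suc r * \<epsilon>))"
    by (simp add: mult_ac)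
  finally have "(\<Sum>V\<in>subsets_of_card X (?u + w). f V) \<le> real (card X choose (?u + w)) * (Suc r * \<epsilon>)"
    by (rule mult_left_le_imp_le) (simp add: zero_less_binomial)
  then show ?case by (simp add: f_def \<epsilon>_def algebra_simps)
qed

text \<open>If \<open>U\<close> contains no \<open>S i\<close>, all fragments are nonempty and
  hence, as \<open>\<tau> r \<le> 1\<close>, all indices are bad at once. So each such
  \<open>U\<close> contributes the full \<open>card I\<close> to the sum over bad indices.\<close>

lemma card_uncovered_le:
  fixes S :: "'i \<Rightarrow> 'e set" and \<tau> :: "nat \<Rightarrow> real" and \<beta> \<eta> :: real and w :: nat
  assumes fin: "finite I" "finite X" and I: "I \<noteq> {}" and sub: "\<And>i. i \<in> I \<Longrightarrow> S i \<subseteq> X"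
    and spread: "\<And>n i T l. i \<in> I \<Longrightarrow> T \<subseteq> S i \<Longrightarrow> real (card T) < \<tau> n \<Longrightarrow>
      (\<Sum>T'\<in>subsets_of_card T l. real (card {\<sigma> \<in> I. T' \<subseteq> S \<sigma>})) \<le> \<beta> ^ l * exp (\<tau> (Suc n)) * card I"
    and \<tau>: "\<And>n. \<tau> (Suc n) \<ge> 1" "\<And>i. i \<in> I \<Longrightarrow> card (S i) < \<tau> 0" "\<tau> r \<le> 1" and w: "w > 0" and \<beta>: "\<beta> \<ge> 0"
    and \<eta>: "\<eta> = \<beta> * card X / w" "exp 1 * \<eta> \<le> 1 / 2"
    and r: "r * w \<le> card X"
  shows "card {U \<in> subsets_of_card X (r * w). \<not> (\<exists>i\<in>I. S i \<subseteq> U)} \<le>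
         real (card X choose (r * w)) * (r * (2 * exp 1 * \<eta>))"
proof -
  define B where "B = {U \<in> subsets_of_card X (r * w). \<not> (\<exists>i\<in>I. S i \<subseteq> U)}"
  have cI: "card I > 0" using fin I by (simp add: card_gt_0_iff)
  have "real (card I) * card B = (\<Sum>U\<in>B. real (card I))" by simp
  also have "\<dots> = (\<Sum>U\<in>B. real (card (bad_indices I S (\<tau> r) U)))"
  proof (intro sum.cong refl)
    fix U assume U: "U \<in> B"
    have "bad_indices I S (\<tau> r) U = I"
    proof -
      have "\<tau> r \<le> real (card (S j - U))" if "j \<in> I" for j
      proof -
        have "S j - U \<noteq> {}" using U that by (auto simp: B_def)
        moreover have "finite (S j - U)" using fin sub[OF that] by (auto intro: finite_subset)
        ultimately have "1 \<le> card (S j - U)" by (simp add: Suc_leI card_gt_0_iff)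
        then show ?thesis using \<tau>(3) by linarith
      qed
      then show ?thesis by (auto simp: bad_indices_def)
    qed
    then show "real (card I) = real (card (bad_indices I S (\<tau> r) U))" by simp
  qed
  also have "\<dots> \<le> (\<Sum>U\<in>subsets_of_card X (r * w). real (card (bad_indices I S (\<tau> r) U)))"
    using fin by (intro sum_mono2) (auto simp: B_def)
  also have "\<dots> \<le> real (card X choose (r * w)) * (card I * (r * (2 * exp 1 * \<eta>)))"
    by (rule bad_indices_iterate[OF fin sub spread \<tau>(1,2) w \<beta> \<eta> r])
  also have "\<dots> = real (card I) * (real (card X choose (r * w)) * (r * (2 * exp 1 * \<eta>)))"
    by simp
  finally show ?thesis using cI by (simp add: B_def)
qed

section \<open>Connected edge sets\<close>

text \<open>Connectivity is phrased by cuts, since all that is needed is an edge that leaves a given set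
  of vertices.\<close>

definition connected_edges :: "'a set set \<Rightarrow> bool" where
  "connected_edges D \<longleftrightarrow> D \<noteq> {} \<and>
     (\<forall>A. A \<subseteq> D \<longrightarrow> A \<noteq> {} \<longrightarrow> A \<noteq> D \<longrightarrow> (\<exists>e\<in>A. \<exists>f\<in>D - A. e \<inter> f \<noteq> {}))"

text \<open>Strong induction along cuts. The components are disjoint even as vertex sets, which is
  what lets the costs of placing them be multiplied.\<close>

lemma connected_edges_decomposition:
  assumes "finite J"
  shows "\<exists>\<D>. \<Union>\<D> = J \<and> (\<forall>D\<in>\<D>. connected_edges D) \<and>
     (\<forall>D\<in>\<D>. \<forall>D'\<in>\<D>. D \<noteq> D' \<longrightarrow> \<Union>D \<inter> \<Union>D' = {})"
  using assms
proof (induction "card J" arbitrary: J rule: less_induct)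
  case less
  have "J = {} \<or> connected_edges J \<or>
      (\<exists>A. A \<subseteq> J \<and> A \<noteq> {} \<and> A \<noteq> J \<and> \<not> (\<exists>e\<in>A. \<exists>f\<in>J - A. e \<inter> f \<noteq> {}))"
    unfolding connected_edges_def by (rule disjE[OF excluded_middle[of "\<forall>A. A \<subseteq> J \<longrightarrow> A \<noteq> {} \<longrightarrow> A \<noteq> J \<longrightarrow> (\<exists>e\<in>A. \<exists>f\<in>J - A. e \<inter> f \<noteq> {})"]]) simp_all
  then consider "J = {}" | "connected_edges J" |
    A where "A \<subseteq> J" "A \<noteq> {}" "A \<noteq> J" "\<forall>e\<in>A. \<forall>f\<in>J - A. e \<inter> f = {}"
    by metis
  then show ?case
  proof cases
    case 1
    then show ?thesis by (intro exI[of _ "{}"]) auto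
  next
    case 2
    then show ?thesis by (intro exI[of _ "{J}"]) auto
  next
    case (3 A)
    have less: "card A < card J" "card (J - A) < card J"
      using 3 less.prems by (auto intro!: psubset_card_mono)
    have fin: "finite A" "finite (J - A)" using less.prems 3(1) finite_subset by auto
    obtain \<A> where A: "\<Union>\<A> = A" "\<forall>D\<in>\<A>. connected_edges D"
      "\<forall>D\<in>\<A>. \<forall>D'\<in>\<A>. D \<noteq> D' \<longrightarrow> \<Union>D \<inter> \<Union>D' = {}"
      using less.hyps[OF less(1) fin(1)] by metis
    obtain \<B> where B: "\<Union>\<B> = J - A" "\<forall>D\<in>\<B>. connected_edges D"
      "\<forall>D\<in>\<B>. \<forall>D'\<in>\<B>. D \<noteq> D' \<longrightarrow> \<Union>D \<inter> \<Union>D' = {}"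
      using less.hyps[OF less(2) fin(2)] by metis
    have AB: "\<Union>D \<inter> \<Union>D' = {}" if "D \<in> \<A>" "D' \<in> \<B>" for D D'
    proof -
      have "D \<subseteq> A" "D' \<subseteq> J - A" using A(1) B(1) that by auto
      then show ?thesis using 3(4) by blast
    qed
    show ?thesis
    proof (intro exI[of _ "\<A> \<union> \<B>"] conjI ballI impI)
      show "\<Union>(\<A> \<union> \<B>) = J" using A(1) B(1) 3(1) by auto
      show "connected_edges D" if "D \<in> \<A> \<union> \<B>" for D using that A(2) B(2) by auto
      show "\<Union>D \<inter> \<Union>D' = {}" if "D \<in> \<A> \<union> \<B>" "D' \<in> \<A> \<union> \<B>" "D \<noteq> D'" for D D'
        using that A(3) B(3) AB[of D D'] AB[of D' D] by (metis Int_commute Un_iff)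
    qed
  qed
qed

text \<open>Cut \<open>D\<close> into the edges that meet \<open>U\<close> and the others. A vertex
  shared across this cut lies outside \<open>U\<close>; if all edges meet \<open>U\<close>, any edge
  at a vertex outside \<open>U\<close> will do.\<close>

lemma connected_edges_crossing:
  assumes "connected_edges D" "U \<subseteq> \<Union>D" "U \<noteq> {}" "U \<noteq> \<Union>D"
  obtains e where "e \<in> D" "e \<inter> U \<noteq> {}" "\<not> e \<subseteq> U"
proof -
  define A where "A = {e \<in> D. e \<inter> U \<noteq> {}}"
  have A: "A \<subseteq> D" "A \<noteq> {}" using assms(2,3) by (auto simp: A_def)
  show ?thesis
  proof (cases "A = D")
    case True
    obtain x e where "x \<in> e" "e \<in> D" "x \<notin> U" using assms(2,4) by blast
    then show ?thesis using True that[of e] by (auto simp: A_def)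
  next
    case False
    then obtain e f where ef: "e \<in> A" "f \<in> D - A" "e \<inter> f \<noteq> {}"
      using assms(1) A unfolding connected_edges_def by meson
    then obtain z where "z \<in> e" "z \<in> f" by blast
    then show ?thesis using ef that[of e] by (auto simp: A_def)
  qed
qed

section \<open>Placements of an edge set in a graph of bounded degree\<close>

definition neighbours :: "'a set set \<Rightarrow> 'a \<Rightarrow> 'a set" where
  "neighbours T x = {y. {x, y} \<in> T}"

text \<open>Placements of \<open>J\<close> in the graph \<open>T\<close>, with \<open>R\<close>
  listing the admissible images of each vertex. They may identify vertices, as only upper bounds on
  their number matter, and are extensional so that this number is meaningful.\<close>

definition edge_maps :: "'a set set \<Rightarrow> 'a set \<Rightarrow> ('a \<Rightarrow> 'b set) \<Rightarrow> 'b set set \<Rightarrow> ('a \<Rightarrow> 'b) set" where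
  "edge_maps J V R T = {g \<in> V \<rightarrow>\<^sub>E UNIV. (\<forall>j\<in>V. g j \<in> R j) \<and> (\<forall>e\<in>J. g ` e \<in> T)}"

text \<open>Explore \<open>D\<close> from the root \<open>a\<close>. Its image is an admissible
  vertex of \<open>T\<close>; afterwards connectivity always supplies an edge from an explored
  vertex to a new one, whose image is one of at most \<open>\<Delta>\<close> neighbours.\<close>

lemma card_edge_maps_connected:
  assumes conn: "connected_edges D" and D: "finite D" "\<And>e. e \<in> D \<Longrightarrow> card e = 2" and a: "a \<in> \<Union>D"
    and T: "finite T" "\<And>e. e \<in> T \<Longrightarrow> finite e" "\<And>x. card (neighbours T x) \<le> \<Delta>" and \<Delta>: "\<Delta> \<ge> 1"
  shows "finite (edge_maps D (\<Union>D) R T) \<and> 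
    card (edge_maps D (\<Union>D) R T) \<le> card (R a \<inter> \<Union>T) * \<Delta> ^ card (\<Union>D)"
proof -
  define rs :: "'a set \<Rightarrow> ('a \<Rightarrow> 'b) \<Rightarrow> 'a \<Rightarrow> 'b" where "rs U g = restrict g U" for U g
  let ?M = "edge_maps D (\<Union>D) R T"
  have finV: "finite (\<Union>D)" using D by (intro finite_Union) (auto intro: card_ge_0_finite)
  have fin_nb: "finite (neighbours T x)" for x
    by (rule finite_subset[of _ "\<Union>T"]) (use T in \<open>auto simp: neighbours_def\<close>)
  \<comment> \<open>\<open>U\<close> is the explored set, and the restrictions of the placements to
    \<open>U\<close> are what is counted.\<close>
  have step: "\<exists>U \<subseteq> \<Union>D. a \<in> U \<and> card U = Suc i \<and> finite (rs U ` ?M) \<and>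
      card (rs U ` ?M) \<le> card (R a \<inter> \<Union>T) * \<Delta> ^ i" if "i < card (\<Union>D)" for i
    using that
  proof (induction i)
    case 0
    have "rs {a} ` ?M \<subseteq> (\<lambda>x. restrict (\<lambda>_. x) {a}) ` (R a \<inter> \<Union>T)"
    proof safe
      fix g assume g: "g \<in> ?M"
      obtain e where "e \<in> D" "a \<in> e" using a by blast
      then have "g a \<in> \<Union>T" "g a \<in> R a" using g by (auto simp: edge_maps_def)
      moreover have "rs {a} g = restrict (\<lambda>_. g a) {a}" by (auto simp: rs_def)
      ultimately show "rs {a} g \<in> (\<lambda>x. restrict (\<lambda>_. x) {a}) ` (R a \<inter> \<Union>T)" by blast
    qed
    moreover have "finite (R a \<inter> \<Union>T)" using T by auto
    ultimately have "finite (rs {a} ` ?M)"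
      "card (rs {a} ` ?M) \<le> card (R a \<inter> \<Union>T)"
      by (meson finite_imageI finite_subset, meson card_image_le card_mono finite_imageI le_trans)
    then show ?case using a by (intro exI[of _ "{a}"] conjI) simp_all
  next
    case (Suc i)
    from Suc.IH[OF Suc_lessD[OF Suc.prems]] obtain U where U: "U \<subseteq> \<Union>D" "a \<in> U" "card U = Suc i" "finite (rs U ` ?M)"
      "card (rs U ` ?M) \<le> card (R a \<inter> \<Union>T) * \<Delta> ^ i" by blast
    have "U \<noteq> \<Union>D" using U(3) Suc.prems by auto
    then obtain e where e: "e \<in> D" "e \<inter> U \<noteq> {}" "\<not> e \<subseteq> U"
      using connected_edges_crossing[OF conn U(1)] U(2) by auto
    then obtain x y where xy: "x \<in> e" "x \<in> U" "y \<in> e" "y \<notin> U" by auto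
    then have exy: "e = {x, y}" using D(2)[OF e(1)] by (auto simp: card_2_iff)
    let ?A = "rs U ` ?M"
    have sub: "rs (insert y U) ` ?M \<subseteq>
      (\<lambda>(h, z). restrict (h(y := z)) (insert y U)) ` (SIGMA h:?A. neighbours T (h x))"
    proof safe
      fix g assume g: "g \<in> ?M"
      have "g ` e \<in> T" using g e(1) by (auto simp: edge_maps_def)
      then have "g y \<in> neighbours T (rs U g x)" using xy exy by (simp add: neighbours_def rs_def)
      moreover have "rs (insert y U) g = restrict ((rs U g)(y := g y)) (insert y U)"
        by (auto simp: rs_def restrict_def fun_eq_iff)
      ultimately show "rs (insert y U) g \<in>
        (\<lambda>(h, z). restrict (h(y := z)) (insert y U)) ` (SIGMA h:?A. neighbours T (h x))"
        using g by (intro image_eqI[of _ _ "(rs U g, g y)"]) auto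
    qed
    have fs: "finite (SIGMA h:?A. neighbours T (h x))" using U(4) fin_nb by auto
    have "card (rs (insert y U) ` ?M) \<le> card (SIGMA h:?A. neighbours T (h x))"
      using sub fs by (meson card_image_le card_mono finite_imageI le_trans)
    also have "\<dots> = (\<Sum>h\<in>?A. card (neighbours T (h x)))" using U(4) fin_nb by (intro card_SigmaI) auto
    also have "\<dots> \<le> (\<Sum>h\<in>?A. \<Delta>)" by (intro sum_mono T)
    also have "\<dots> \<le> card (R a \<inter> \<Union>T) * \<Delta> ^ Suc i" using U(5) by (simp add: mult_ac mult_left_mono)
    finally have "card (rs (insert y U) ` ?M) \<le> card (R a \<inter> \<Union>T) * \<Delta> ^ Suc i" .
    moreover have "finite (rs (insert y U) ` ?M)"
      using sub fs by (meson finite_imageI finite_subset)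
    moreover have "y \<in> \<Union>D" using xy(3) e(1) by blast
    moreover have "finite U" using finite_subset[OF U(1) finV] .
    ultimately show ?case using U(1-3) xy(4)
      by (intro exI[of _ "insert y U"] conjI) (simp_all del: Union_iff)
  qed
  have pos: "card (\<Union>D) > 0" using a finV by (auto simp: card_gt_0_iff)
  obtain U where U: "U \<subseteq> \<Union>D" "card U = card (\<Union>D)" "finite (rs U ` ?M)"
      "card (rs U ` ?M) \<le> card (R a \<inter> \<Union>T) * \<Delta> ^ (card (\<Union>D) - 1)"
    using step[of "card (\<Union>D) - 1"] pos by (metis Suc_pred' diff_less zero_less_one)
  have "U = \<Union>D" using U finV by (intro card_seteq) auto
  moreover have "rs (\<Union>D) ` ?M = ?M"
  proof (intro set_eqI iffI)
    fix g assume "g \<in> ?M"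
    moreover from this have "rs (\<Union>D) g = g"
      unfolding edge_maps_def rs_def by (intro PiE_restrict) blast
    ultimately show "g \<in> rs (\<Union>D) ` ?M" by (metis image_eqI)
  next
    fix g assume "g \<in> rs (\<Union>D) ` ?M"
    then obtain g' where "g' \<in> ?M" "g = rs (\<Union>D) g'" by blast
    moreover from this have "rs (\<Union>D) g' = g'"
      unfolding edge_maps_def rs_def by (intro PiE_restrict) blast
    ultimately show "g \<in> ?M" by simp
  qed
  ultimately have "finite ?M" "card ?M \<le> card (R a \<inter> \<Union>T) * \<Delta> ^ (card (\<Union>D) - 1)" using U(3,4) by simp_all
  moreover have "\<Delta> ^ (card (\<Union>D) - 1) \<le> \<Delta> ^ card (\<Union>D)" using \<Delta> by (intro power_increasing) auto
  ultimately show ?thesis using mult_left_mono[of "\<Delta> ^ (card (\<Union>D) - 1)" "\<Delta> ^ card (\<Union>D)" "card (R a \<inter> \<Union>T)"]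
    by linarith
qed

text \<open>Restriction to the members of \<open>\<D>\<close> embeds the placements of the union
  into a product.\<close>

lemma card_edge_maps_disjoint:
  assumes "finite \<D>" and "\<And>D. D \<in> \<D> \<Longrightarrow> finite (edge_maps D (\<Union>D) R T)"
  shows "finite (edge_maps (\<Union>\<D>) (\<Union>(\<Union>\<D>)) R T) \<and>
     card (edge_maps (\<Union>\<D>) (\<Union>(\<Union>\<D>)) R T) \<le> (\<Prod>D\<in>\<D>. card (edge_maps D (\<Union>D) R T))"
proof -
  let ?h = "\<lambda>g. restrict (\<lambda>D. restrict g (\<Union>D)) \<D>"
  let ?M = "edge_maps (\<Union>\<D>) (\<Union>(\<Union>\<D>)) R T" and ?P = "\<Pi>\<^sub>E D\<in>\<D>. edge_maps D (\<Union>D) R T"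
  have "?h ` ?M \<subseteq> ?P"
  proof (rule image_subsetI)
    fix g assume g: "g \<in> ?M"
    have "\<forall>D\<in>\<D>. restrict g (\<Union>D) \<in> edge_maps D (\<Union>D) R T"
    proof
      fix D assume D: "D \<in> \<D>"
      have "restrict g (\<Union>D) ` e = g ` e" if "e \<in> D" for e using that by (intro image_cong) auto
      then show "restrict g (\<Union>D) \<in> edge_maps D (\<Union>D) R T"
        using g D by (auto simp: edge_maps_def)
    qed
    then show "?h g \<in> ?P" by (simp add: restrict_PiE_iff)
  qed
  note sub = this
  have inj: "inj_on ?h ?M"
  proof (rule inj_onI)
    fix g g' assume g: "g \<in> ?M" "g' \<in> ?M" and eq: "?h g = ?h g'"
    show "g = g'"
    proof
      fix x
      show "g x = g' x"
      proof (cases "x \<in> \<Union>(\<Union>\<D>)")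
        case True
        then obtain D where D: "D \<in> \<D>" "x \<in> \<Union>D" by blast
        have "?h g D x = ?h g' D x" by (rule arg_cong[where f = "\<lambda>h. h D x", OF eq])
        then show ?thesis using D by simp
      next
        case False
        then show ?thesis using g by (auto simp: edge_maps_def PiE_def extensional_def)
      qed
    qed
  qed
  have P: "finite ?P" using assms by (intro finite_PiE) auto
  have "card ?P = (\<Prod>D\<in>\<D>. card (edge_maps D (\<Union>D) R T))" using assms(1) by (rule card_PiE)
  then show ?thesis
    using card_inj_on_le[OF inj sub P] inj_on_finite[OF inj sub P] by metis
qed

section \<open>Powers of cycles\<close>

definition cycle_power :: "nat \<Rightarrow> nat \<Rightarrow> nat set set" where
  "cycle_power n k = {{i, (i + d) mod n} | i d. i < n \<and> 1 \<le> d \<and> d \<le> k}"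

text \<open>The ball of radius \<open>r\<close> around \<open>a\<close> on a cycle of length
  \<open>n\<close>; integer offsets serve both directions without truncated subtraction.\<close>

definition window :: "nat \<Rightarrow> nat \<Rightarrow> nat \<Rightarrow> nat set" where
  "window n r a = (\<lambda>d. nat ((int a + d) mod int n)) ` {- int r..int r}"

lemma card_window: "finite (window n r a)" "card (window n r a) \<le> 2 * r + 1"
proof -
  show "finite (window n r a)" by (simp add: window_def)
  have "card (window n r a) \<le> card {- int r..int r}"
    unfolding window_def by (rule card_image_le) simp
  then show "card (window n r a) \<le> 2 * r + 1" by simp
qed

lemma self_in_window: "a < n \<Longrightarrow> a \<in> window n r a"
  unfolding window_def by (rule image_eqI[of _ _ 0]) simp_all

lemma window_trans:
  assumes "n > 0" "x \<in> window n r a" "y \<in> window n s x"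
  shows "y \<in> window n (r + s) a"
proof -
  obtain d where d: "d \<in> {- int r..int r}" "x = nat ((int a + d) mod int n)"
    using assms(2) by (auto simp: window_def)
  obtain d' where d': "d' \<in> {- int s..int s}" "y = nat ((int x + d') mod int n)"
    using assms(3) by (auto simp: window_def)
  have "int x = (int a + d) mod int n" using d assms(1) by simp
  then have "y = nat ((int a + (d + d')) mod int n)" using d' by (simp add: mod_simps add.assoc)
  then show ?thesis using d d' unfolding window_def by (intro image_eqI[of _ _ "d + d'"]) simp_all
qed

lemma window_mono: "r \<le> s \<Longrightarrow> window n r a \<subseteq> window n s a"
  by (auto simp: window_def)

lemma window_shift: "d \<le> r \<Longrightarrow> (x + d) mod n \<in> window n r x"
  unfolding window_def by (rule image_eqI[of _ _ "int d"]) (simp_all flip: of_nat_add zmod_int)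

lemma window_sym:
  assumes "y < n" "x \<in> window n r y" shows "y \<in> window n r x"
proof -
  obtain d where d: "d \<in> {- int r..int r}" "x = nat ((int y + d) mod int n)"
    using assms(2) by (auto simp: window_def)
  have "int x = (int y + d) mod int n" using d assms(1) by simp
  then have "(int x + - d) mod int n = int y" using assms(1) by (simp add: mod_simps)
  then show ?thesis using d unfolding window_def by (intro image_eqI[of _ _ "- d"]) simp_all
qed

lemma mod_add_cancel_nat:
  fixes a b d n :: nat
  assumes "(a + d) mod n = (b + d) mod n"
  shows "a mod n = b mod n"
proof -
  have "(int a + int d) mod int n = (int b + int d) mod int n"
    using assms by (metis of_nat_add zmod_int)
  then have "int a mod int n = int b mod int n" by (simp add: mod_eq_dvd_iff)
  then show ?thesis by (metis of_nat_eq_iff zmod_int)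
qed

lemma finite_cycle_power [simp]: "finite (cycle_power n k)"
proof -
  have "cycle_power n k \<subseteq> (\<lambda>(i, d). {i, (i + d) mod n}) ` ({..<n} \<times> {1..k})"
    by (auto simp: cycle_power_def)
  then show ?thesis by (rule finite_subset) auto
qed

context
  fixes n k :: nat
  assumes nk: "n > 2 * k" and k: "k \<ge> 1"
begin

lemma cycle_power_edge:
  assumes "e \<in> cycle_power n k" shows "e \<subseteq> {..<n}" "card e = 2"
proof -
  obtain i d where e: "e = {i, (i + d) mod n}" "i < n" "1 \<le> d" "d \<le> k"
    using assms by (auto simp: cycle_power_def)
  show "e \<subseteq> {..<n}" using e nk by auto
  have "(i + d) mod n \<noteq> i"
  proof
    assume "(i + d) mod n = i"
    then have "(d + i) mod n = (0 + i) mod n" using e by (simp add: add.commute)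
    then have "d mod n = 0" using mod_add_cancel_nat[of d i n 0] by simp
    then show False using e nk by simp
  qed
  then show "card e = 2" using e by auto
qed

lemma cycle_power_window:
  assumes "e \<in> cycle_power n k" "x \<in> e" "y \<in> e" shows "y \<in> window n k x"
proof -
  obtain i d where e: "e = {i, (i + d) mod n}" "i < n" "1 \<le> d" "d \<le> k"
    using assms by (auto simp: cycle_power_def)
  have "(i + d) mod n \<in> window n k i" using e by (intro window_shift)
  moreover from window_sym[OF e(2) this] have "i \<in> window n k ((i + d) mod n)" .
  moreover have "i \<in> window n k i" "(i + d) mod n \<in> window n k ((i + d) mod n)"
    using e nk by (auto intro!: self_in_window)
  ultimately show ?thesis using assms(2,3) unfolding e(1) by (elim insertE emptyE) simp_all
qed

text \<open>Charge each edge to the endpoint from which it steps forwards; every vertex of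
  \<open>W\<close> is charged at most \<open>k\<close> times.\<close>

lemma card_cycle_power_inside:
  assumes "finite W" shows "card {e \<in> cycle_power n k. e \<subseteq> W} \<le> k * card W"
proof -
  have "{e \<in> cycle_power n k. e \<subseteq> W} \<subseteq> (\<lambda>(i, d). {i, (i + d) mod n}) ` (W \<times> {1..k})"
    by (auto simp: cycle_power_def)
  then have "card {e \<in> cycle_power n k. e \<subseteq> W} \<le> card (W \<times> {1..k})"
    using assms by (meson card_image_le card_mono finite_SigmaI finite_atLeastAtMost finite_imageI le_trans)
  then show ?thesis by (simp add: card_cartesian_product mult.commute)
qed

lemma card_cycle_power: "card (cycle_power n k) \<le> k * n"
proof -
  have "{e \<in> cycle_power n k. e \<subseteq> {..<n}} = cycle_power n k" using cycle_power_edge by auto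
  then show ?thesis using card_cycle_power_inside[of "{..<n}"] by simp
qed

lemma card_Union_edges:
  assumes "D \<subseteq> cycle_power n k"
  shows "finite D" "finite (\<Union>D)" "card (\<Union>D) \<le> 2 * card D"
proof -
  show fin: "finite D" by (rule finite_subset[OF assms finite_cycle_power])
  show "finite (\<Union>D)"
    using assms cycle_power_edge by (intro finite_subset[of "\<Union>D" "{..<n}"]) auto
  have "card (\<Union>D) \<le> (\<Sum>e\<in>D. card e)"  by (rule card_Union_le_sum_card)
  also have "\<dots> = (\<Sum>e\<in>D. 2)" using assms cycle_power_edge by (intro sum.cong) auto
  finally show "card (\<Union>D) \<le> 2 * card D" by (simp add: mult.commute)
qed

text \<open>Each widening of the window by \<open>k\<close> catches a new vertex of \<open>D\<close>
  until all are inside, and there are at most \<open>2 * card D\<close> of them.\<close>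

lemma connected_in_window:
  assumes D: "D \<subseteq> cycle_power n k" "connected_edges D" and a: "a \<in> \<Union>D"
  shows "\<Union>D \<subseteq> window n (2 * k * card D) a"
proof -
  note fin = card_Union_edges[OF D(1)]
  have an: "a < n" using a D(1) cycle_power_edge by blast
  have step: "\<Union>D \<subseteq> window n (k * i) a \<or> card (\<Union>D \<inter> window n (k * i) a) \<ge> i + 1" for i
  proof (induction i)
    case 0
    have "card (\<Union>D \<inter> window n (k * 0) a) > 0"
      using a an fin self_in_window by (subst card_gt_0_iff) auto
    then show ?case by simp
  next
    case (Suc i)
    let ?U = "\<Union>D \<inter> window n (k * i) a"
    show ?case
    proof (cases "\<Union>D \<subseteq> window n (k * i) a")
      case True
      then show ?thesis using window_mono[of "k * i" "k * Suc i" n a] by auto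
    next
      case False
      have "?U \<noteq> {}" "?U \<subseteq> \<Union>D" "?U \<noteq> \<Union>D" using a an self_in_window False by auto
      then obtain e where e: "e \<in> D" "e \<inter> ?U \<noteq> {}" "\<not> e \<subseteq> ?U"
        using connected_edges_crossing[OF D(2)] by metis
      then obtain x y where xy: "x \<in> e" "x \<in> ?U" "y \<in> e" "y \<notin> ?U" by auto
      have "y \<in> window n k x" using cycle_power_window xy e D by blast
      then have "y \<in> window n (k * i + k) a" using xy an by (intro window_trans[of n x]) auto
      then have "insert y ?U \<subseteq> \<Union>D \<inter> window n (k * Suc i) a"
        using window_mono[of "k * i" "k * Suc i" n a] e xy by (auto simp: add.commute)
      then have "card (insert y ?U) \<le> card (\<Union>D \<inter> window n (k * Suc i) a)"
        using fin by (intro card_mono) auto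
      moreover have "card (insert y ?U) = Suc (card ?U)" using fin xy by (subst card_insert_disjoint) auto
      ultimately show ?thesis using Suc False by auto
    qed
  qed
  have "card (\<Union>D \<inter> window n (k * card (\<Union>D)) a) \<le> card (\<Union>D)" using fin by (intro card_mono) auto
  then have "\<Union>D \<subseteq> window n (k * card (\<Union>D)) a" using step[of "card (\<Union>D)"] by auto
  also have "\<dots> \<subseteq> window n (2 * k * card D) a" using fin(3) by (intro window_mono) simp
  finally show ?thesis .
qed

text \<open>Any bound exponential in \<open>l\<close> will do, so connectivity serves only to
  confine \<open>D\<close> to a window, where all edge sets are counted. The window holds at most k
  (4 k l + 1) \<le> 5 k^2 l edges.\<close>

lemma card_connected_through:
  assumes l: "l \<ge> 1"
  shows "card {D. D \<subseteq> cycle_power n k \<and> connected_edges D \<and> a \<in> \<Union>D \<and> card D = l} \<le> 2 ^ (5 * k\<^sup>2 * l)"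
proof -
  let ?W = "window n (2 * k * l) a"
  let ?E = "{e \<in> cycle_power n k. e \<subseteq> ?W}"
  have "{D. D \<subseteq> cycle_power n k \<and> connected_edges D \<and> a \<in> \<Union>D \<and> card D = l} \<subseteq> Pow ?E"
    using connected_in_window by blast
  then have "card {D. D \<subseteq> cycle_power n k \<and> connected_edges D \<and> a \<in> \<Union>D \<and> card D = l} \<le> 2 ^ card ?E"
    using card_mono[of "Pow ?E"] by (simp add: card_Pow)
  also have "\<dots> \<le> 2 ^ (5 * k\<^sup>2 * l)"
  proof (rule power_increasing)
    have "card ?E \<le> k * card ?W" using card_window by (intro card_cycle_power_inside)
    also have "\<dots> \<le> k * (2 * (2 * k * l) + 1)" using card_window(2)[of n "2 * k * l" a] by (intro mult_left_mono) simp_all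
    also have "\<dots> \<le> 5 * k\<^sup>2 * l"
    proof -
      have "k * 1 \<le> k * (k * l)" using k l by (intro mult_left_mono) auto
      then show ?thesis by (simp add: power2_eq_square algebra_simps)
    qed
    finally show "card ?E \<le> 5 * k\<^sup>2 * l" .
  qed simp
  finally show ?thesis .
qed

text \<open>If some vertex of \<open>D\<close> has no predecessor at distance at most \<open>k\<close> in \<open>D\<close>, then \<open>D\<close> does not wind
  around the cycle: its first vertex closes no edge and its second vertex at most one.\<close>

lemma card_edges_nonwinding:
  assumes D: "D \<subseteq> cycle_power n k" "D \<noteq> {}"
    and r: "r \<in> \<Union>D" "\<And>s d. s \<in> \<Union>D \<Longrightarrow> 1 \<le> d \<Longrightarrow> d \<le> k \<Longrightarrow> r \<noteq> (s + d) mod n"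
  shows "card D + 2 * k \<le> k * card (\<Union>D) + 1"
proof -
  note fin = card_Union_edges[OF D(1)]
  have V: "\<Union>D \<subseteq> {..<n}" using D(1) cycle_power_edge by blast
  then have rn: "r < n" using r by auto
  obtain x where x: "x \<in> \<Union>D" "x \<noteq> r"
  proof -
    obtain e where "e \<in> D" "r \<in> e" using r by auto
    moreover from this have "card e = 2" using D cycle_power_edge by blast
    ultimately show ?thesis using that by (metis UnionI card_2_iff insertCI)
  qed
  have "(r + (x + n - r)) mod n = x" using x V rn by auto
  moreover have "x + n - r \<ge> 1" using rn by simp
  ultimately have ex: "\<exists>\<delta>. \<delta> \<ge> 1 \<and> (r + \<delta>) mod n \<in> \<Union>D - {r}" using x by (intro exI[of _ "x + n - r"]) auto
  \<comment> \<open>Going forwards from \<open>r\<close>, the second vertex \<open>r'\<close> of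
    \<open>D\<close> is met after \<delta> steps.\<close>
  define \<delta> where "\<delta> = (LEAST \<delta>. \<delta> \<ge> 1 \<and> (r + \<delta>) mod n \<in> \<Union>D - {r})"
  have \<delta>: "\<delta> \<ge> 1" "(r + \<delta>) mod n \<in> \<Union>D - {r}"
    using LeastI_ex[OF ex] unfolding \<delta>_def by auto
  have least: "\<not> (\<delta>' \<ge> 1 \<and> (r + \<delta>') mod n \<in> \<Union>D - {r})" if "\<delta>' < \<delta>" for \<delta>'
    using not_less_Least that unfolding \<delta>_def by blast
  define r' where "r' = (r + \<delta>) mod n"
  have r': "r' \<in> \<Union>D" "r' \<noteq> r" using \<delta> by (auto simp: r'_def)
  \<comment> \<open>An edge is coded by its forward endpoint \<open>u\<close> and its step
    \<open>d\<close>. By assumption \<open>u\<close> is never \<open>r\<close>. If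
    \<open>u = r'\<close>, a shorter step than \<delta> would start at a vertex of \<open>D\<close>
    between \<open>r\<close> and \<open>r'\<close>, and a longer one at a forbidden predecessor of
    \<open>r\<close>.\<close>
  define Q where "Q = insert (r', \<delta>) ((\<Union>D - {r, r'}) \<times> {1..k})"
  have "D \<subseteq> (\<lambda>(u, d). {u, (u + n - d) mod n}) ` Q"
  proof
    fix e assume e: "e \<in> D"
    then obtain s d where sd: "e = {s, (s + d) mod n}" "s < n" "1 \<le> d" "d \<le> k"
      using D(1) by (auto simp: cycle_power_def)
    define u where "u = (s + d) mod n"
    have u: "u \<in> \<Union>D" "s \<in> \<Union>D" using e sd by (auto simp: u_def)
    have "(u + n - d) mod n = ((s + d) mod n + (n - d)) mod n"
      using sd nk by (simp add: u_def)
    also have "\<dots> = (s + d + (n - d)) mod n" by (rule mod_add_left_eq)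
    also have "\<dots> = s" using sd nk by simp
    finally have e': "e = {u, (u + n - d) mod n}" using sd by (auto simp: u_def)
    have "u \<noteq> r" using r(2)[of s d] u sd by (auto simp: u_def)
    moreover have "d = \<delta>" if "u = r'"
    proof (rule ccontr)
      assume "d \<noteq> \<delta>"
      then consider "d < \<delta>" | "\<delta> < d" by linarith
      then show False
      proof cases
        case 1
        have "((r + (\<delta> - d)) + d) mod n = (s + d) mod n" using that 1 by (simp add: u_def r'_def)
        from mod_add_cancel_nat[OF this] have s: "(r + (\<delta> - d)) mod n = s" using sd by simp
        have "s \<noteq> r" 
        proof
          assume "s = r"
          then have "((\<delta> - d) + r) mod n = (0 + r) mod n" using s rn by (simp add: add.commute)
          then have "n dvd (\<delta> - d)" using mod_add_cancel_nat[of "\<delta> - d" r n 0] by (simp add: mod_eq_0_iff_dvd)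
          then obtain q where q: "\<delta> - d = n * q" by (auto elim: dvdE)
          have "q > 0" using 1 q by (cases q) auto
          \<comment> \<open>The start can be \<open>r\<close> itself only after a full turn, and
            then \<delta> - n would already lead to \<open>r'\<close>.\<close>
          then have "\<delta> - d \<ge> n" using q by simp
          then have "\<delta> - n \<ge> 1" "\<delta> - n < \<delta>" using sd rn by auto
          moreover have "r + \<delta> = r + (\<delta> - n) + n" using \<open>\<delta> - d \<ge> n\<close> by linarith
          then have "(r + (\<delta> - n)) mod n = r'" unfolding r'_def by (simp only: mod_add_self2)
          ultimately show False using least[of "\<delta> - n"] r' by auto
        qed
        then show False using least[of "\<delta> - d"] 1 s u sd by auto
      next
        case 2
        have "((s + (d - \<delta>)) + \<delta>) mod n = (r + \<delta>) mod n" using that 2 by (simp add: u_def r'_def)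
        from mod_add_cancel_nat[OF this] have "(s + (d - \<delta>)) mod n = r" using rn by simp
        moreover have "1 \<le> d - \<delta>" "d - \<delta> \<le> k" using 2 sd by linarith+
        ultimately show False using r(2)[OF u(2)] by metis
      qed
    qed
    ultimately have "(u, d) \<in> Q" using u(1) sd(3,4) by (cases "u = r'") (simp_all add: Q_def del: Union_iff)
    then show "e \<in> (\<lambda>(u, d). {u, (u + n - d) mod n}) ` Q" using e' by force
  qed
  moreover have finQ: "finite Q" using fin(2) by (simp add: Q_def)
  ultimately have "card D \<le> card Q" by (meson card_image_le card_mono finite_imageI le_trans)
  also have "\<dots> \<le> Suc (card ((\<Union>D - {r, r'}) \<times> {1..k}))"
    unfolding Q_def by (rule card_insert_le_m1) simp_all
  also have "card ((\<Union>D - {r, r'}) \<times> {1..k}) = (card (\<Union>D) - 2) * k"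
    using r(1) r' fin(2) by (simp add: card_cartesian_product card_Diff_subset numeral_2_eq_2 del: Union_iff)
  finally have 1: "card D \<le> Suc ((card (\<Union>D) - 2) * k)" by simp
  have "card {r, r'} \<le> card (\<Union>D)" using fin(2) r(1) r'(1) by (intro card_mono) simp_all
  then have "card (\<Union>D) \<ge> 2" using r' by simp
  then obtain v where "card (\<Union>D) = 2 + v" using le_Suc_ex by blast
  then show ?thesis using 1 by (simp add: algebra_simps)
qed

text \<open>The gaps of \<open>V\<close> are shorter than \<open>k\<close>, so \<open>V\<close>
  shifted by 0, ..., k - 1 covers the cycle. For an uncovered \<open>j\<close>, the first vertex of
  \<open>V\<close> after \<open>j\<close> would have a predecessor either still closer after
  \<open>j\<close>, against the choice, or fewer than \<open>k\<close> steps behind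
  \<open>j\<close>, which covers \<open>j\<close>.\<close>

lemma cycle_covered:
  assumes V: "V \<subseteq> {..<n}" "V \<noteq> {}"
    and pred: "\<And>r. r \<in> V \<Longrightarrow> \<exists>s\<in>V. \<exists>d. 1 \<le> d \<and> d \<le> k \<and> r = (s + d) mod n"
  shows "n \<le> k * card V"
proof -
  have "{..<n} \<subseteq> (\<lambda>(s, d). (s + d) mod n) ` (V \<times> {..<k})"
  proof
    fix j assume j: "j \<in> {..<n}"
    show "j \<in> (\<lambda>(s, d). (s + d) mod n) ` (V \<times> {..<k})"
    proof (rule ccontr)
      assume neg: "j \<notin> (\<lambda>(s, d). (s + d) mod n) ` (V \<times> {..<k})"
      have no: "j \<noteq> (s + d) mod n" if "s \<in> V" "d < k" for s d
        using neg that by force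
      obtain x where x: "x \<in> V" using V by auto
      have "(j + (x + n - j)) mod n = x" using x V j by auto
      then have ex: "\<exists>i. (j + i) mod n \<in> V" using x by metis
      define i where "i = (LEAST i. (j + i) mod n \<in> V)"
      have i: "(j + i) mod n \<in> V" using LeastI_ex[OF ex] unfolding i_def .
      have least: "(j + i') mod n \<notin> V" if "i' < i" for i'
        using not_less_Least that unfolding i_def by blast
      obtain s d where sd: "s \<in> V" "1 \<le> d" "d \<le> k" "(j + i) mod n = (s + d) mod n"
        using pred[OF i] by auto
      have "i \<noteq> 0"
      proof
        assume "i = 0"
        then have "j \<in> V" using i j by simp
        then show False using no[of j 0] k j by simp
      qed
      show False
      proof (cases "d \<le> i")
        case True
        then have "((j + (i - d)) + d) mod n = (s + d) mod n" using sd by simp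
        moreover have "s < n" using V sd by auto
        ultimately have "(j + (i - d)) mod n = s" using mod_add_cancel_nat by (metis mod_less)
        then show False using least[of "i - d"] sd True by simp
      next
        case False
        then have "((s + (d - i)) + i) mod n = (j + i) mod n" using sd by simp
        from mod_add_cancel_nat[OF this] have "(s + (d - i)) mod n = j" using j by simp
        moreover have "d - i < k" using sd False \<open>i \<noteq> 0\<close> by linarith
        ultimately show False using no[of s "d - i"] sd by simp
      qed
    qed
  qed
  moreover have "finite V" using V finite_subset by auto
  ultimately have "card {..<n} \<le> card (V \<times> {..<k})"
    by (meson card_image_le card_mono finite_SigmaI finite_imageI finite_lessThan le_trans)
  then show ?thesis by (simp add: card_cartesian_product mult.commute)
qed

text \<open>Apart from a winding \<open>D\<close>, whose number of edges is linear in \<open>n\<close>, the exponent \<open>3 / 2\<close> is what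
  \<^term>\<open>card D + 2 * k \<le> k * card (\<Union>D) + 1\<close> leaves for \<open>k = 2\<close>.\<close>

lemma cycle_power_density:
  assumes k2: "k \<ge> 2" and D: "D \<subseteq> cycle_power n k" "D \<noteq> {}" and m: "1 \<le> m" "m \<le> n"
  shows "real m powr (card D / k + 3 / 2) \<le> real m ^ card (\<Union>D) * (16 * real k ^ 2) ^ card D"
proof (cases "\<exists>r\<in>\<Union>D. \<forall>s\<in>\<Union>D. \<forall>d. 1 \<le> d \<longrightarrow> d \<le> k \<longrightarrow> r \<noteq> (s + d) mod n")
  case True
  then obtain r where r: "r \<in> \<Union>D" "\<And>s d. s \<in> \<Union>D \<Longrightarrow> 1 \<le> d \<Longrightarrow> d \<le> k \<Longrightarrow> r \<noteq> (s + d) mod n"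
    by auto
  have "real (card D + 2 * k) \<le> real (k * card (\<Union>D) + 1)"
    using card_edges_nonwinding[OF D r] by (simp only: of_nat_le_iff)
  then have "card D / k + 3 / 2 \<le> card (\<Union>D)"
    using k2 by (simp add: field_simps)
  then have "real m powr (card D / k + 3 / 2) \<le> real m powr card (\<Union>D)"
    using m by (intro powr_mono) auto
  also have "\<dots> = real m ^ card (\<Union>D) * 1" using m by (simp add: powr_realpow)
  also have "\<dots> \<le> real m ^ card (\<Union>D) * (16 * real k ^ 2) ^ card D"
    using k2 by (intro mult_left_mono one_le_power) (auto intro: order_trans[of _ 16] simp: power2_eq_square mult_ge1_I)
  finally show ?thesis .
next
  case False
  note fin = card_Union_edges[OF D(1)]
  let ?l = "card D" and ?v = "card (\<Union>D)"
  have V: "\<Union>D \<subseteq> {..<n}" using D(1) cycle_power_edge by blast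
  moreover have "\<Union>D \<noteq> {}" using D cycle_power_edge(2) by fastforce
  ultimately have nv: "n \<le> k * ?v" using False by (intro cycle_covered) auto
  have "{e \<in> cycle_power n k. e \<subseteq> \<Union>D} \<supseteq> D" using D by auto
  then have "?l \<le> k * ?v"
    using card_cycle_power_inside[OF fin(2)] card_mono[of "{e \<in> cycle_power n k. e \<subseteq> \<Union>D}" D] by fastforce
  then have "real ?l \<le> real k * real ?v" by (simp only: of_nat_mult[symmetric] of_nat_le_iff)
  then have "real ?l / k \<le> ?v" using k by (simp add: field_simps)
  then have "real m powr (?l / k + 3 / 2) \<le> real m powr (?v + 2)"
    using m by (intro powr_mono) auto
  also have "\<dots> = real m ^ ?v * real m ^ 2" 
    using m by (simp add: powr_add powr_realpow)
  also have "\<dots> \<le> real m ^ ?v * (16 * real k ^ 2) ^ ?l"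
  proof (intro mult_left_mono)
    have "k * ?v \<le> k * (2 * ?l)" using fin(3) by (rule mult_left_mono) simp
    \<comment> \<open>A winding \<open>D\<close> has at least n / k vertices and therefore at least
      n / (2 k) edges. So the missing factor m^2 is at most (2 k l)^2, which a constant to the power
      l absorbs.\<close>
    then have "m \<le> 2 * k * ?l" using m nv by linarith
    then have "real m \<le> real (2 * k * ?l)" by (simp only: of_nat_le_iff)
    also have "\<dots> \<le> 2 * real k * 2 ^ ?l"
    proof -
      have "real ?l \<le> 2 ^ ?l" using less_exp[of ?l] by (simp add: of_nat_less_numeral_power_cancel_iff less_imp_le)
      then show ?thesis using mult_left_mono[of "real ?l" "2 ^ ?l" "2 * real k"] by simp
    qed
    finally have "real m ^ 2 \<le> (2 * real k * 2 ^ ?l) ^ 2" by (intro power_mono) auto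
    also have "\<dots> = 4 * real k ^ 2 * 4 ^ ?l"
      using power_mult[of "2 :: real" 2 ?l] power_mult[of "2 :: real" ?l 2] by (simp add: power_mult_distrib mult.commute)
    also have "\<dots> \<le> (4 * real k ^ 2) ^ ?l * 4 ^ ?l"
    proof (intro mult_right_mono)
      have "?l \<ge> 1" using D fin by (simp add: Suc_leI card_gt_0_iff)
      moreover have "1 \<le> real k ^ 2" using k by (intro one_le_power) simp
      then have "1 \<le> 4 * real k ^ 2" by linarith
      ultimately show "4 * real k ^ 2 \<le> (4 * real k ^ 2) ^ ?l" using power_increasing[of 1 ?l "4 * real k ^ 2"] by simp
    qed simp
    also have "\<dots> = (16 * real k ^ 2) ^ ?l" by (subst power_mult_distrib[symmetric]) (simp add: mult.commute)
    finally show "real m ^ 2 \<le> (16 * real k ^ 2) ^ ?l" .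
  qed simp
  finally show ?thesis .
qed

end

section \<open>Colour-preserving bijections\<close>

text \<open>Peel off the leading factor and use (1 + 1 / M)^u \<le> e for u \<le> M. The bound has
  to reach up to \<open>v = M\<close>, because a piece of the cycle power may occupy entire
  clusters.\<close>

lemma falling_factorial_ge:
  "v \<le> M \<Longrightarrow> real M ^ v \<le> exp 1 ^ v * (\<Prod>a<v. real (M - a))"
proof (induction M arbitrary: v)
  case (Suc M)
  show ?case
  proof (cases v)
    case v: (Suc u)
    have u: "u \<le> M" using Suc.prems v by simp
    have "real (Suc M) ^ u \<le> exp 1 * real M ^ u"
    proof (cases "M = 0")
      case False
      have "1 + 1 / real M \<le> exp (1 / real M)" by (rule exp_ge_add_one_self)
      then have "(1 + 1 / real M) ^ u \<le> exp (1 / real M) ^ u" by (intro power_mono) auto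
      also have "\<dots> = exp (real u / real M)" using exp_of_nat_mult[of u "1 / real M"] by simp
      also have "\<dots> \<le> exp 1" using u False by (simp add: field_simps)
      finally have "(1 + 1 / real M) ^ u * real M ^ u \<le> exp 1 * real M ^ u" by (intro mult_right_mono) auto
      moreover have "(1 + 1 / real M) ^ u * real M ^ u = real (Suc M) ^ u"
        using False by (simp add: power_mult_distrib[symmetric] field_simps)
      ultimately show ?thesis by simp
    qed (use u in simp)
    also have "\<dots> \<le> exp 1 * (exp 1 ^ u * (\<Prod>a<u. real (M - a)))"
      using Suc.IH[OF u] by (intro mult_left_mono) auto
    finally have "real (Suc M) * real (Suc M) ^ u \<le> real (Suc M) * (exp 1 * (exp 1 ^ u * (\<Prod>a<u. real (M - a))))"
      by (rule mult_left_mono) simp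
    also have "\<dots> = exp 1 ^ v * (\<Prod>a<v. real (Suc M - a))"
      unfolding v by (subst prod.lessThan_Suc_shift) (simp add: mult_ac)
    finally show ?thesis by (simp add: v)
  qed simp
qed simp

locale coloured_sets =
  fixes A :: "'a set" and B :: "'b set" and c :: "'a \<Rightarrow> 'c" and c' :: "'b \<Rightarrow> 'c" and m :: real
  assumes fin: "finite A" "finite B"
    and class_card: "\<And>i. i \<in> c ` A \<Longrightarrow> card {x \<in> A. c x = i} \<le> card {y \<in> B. c' y = i}"
    and class_large: "\<And>i. i \<in> c ` A \<Longrightarrow> m \<le> card {y \<in> B. c' y = i}"
    and m_pos: "m > 0"
begin

definition colour_bijections :: "('a \<Rightarrow> 'b) set" where
  "colour_bijections = {\<sigma> \<in> A \<rightarrow>\<^sub>E B. bij_betw \<sigma> A B \<and> (\<forall>x\<in>A. c' (\<sigma> x) = c x)}"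

lemma finite_colour_bijections: "finite colour_bijections"
  by (rule finite_subset[of _ "A \<rightarrow>\<^sub>E B"]) (use fin in \<open>auto simp: colour_bijections_def intro!: finite_PiE\<close>)

definition agreeing :: "'a set \<Rightarrow> ('a \<Rightarrow> 'b) \<Rightarrow> ('a \<Rightarrow> 'b) set" where
  "agreeing V g = {\<sigma> \<in> colour_bijections. \<forall>x\<in>V. \<sigma> x = g x}"

lemma finite_agreeing: "finite (agreeing V g)"
  using finite_colour_bijections by (simp add: agreeing_def)

text \<open>Composing with the transposition of \<open>g j\<close> and \<open>u\<close> preserves
  colours and leaves the values on \<open>V\<close> alone. By symmetry all free images of
  \<open>j\<close> are therefore equally frequent.\<close>

lemma agreeing_swap:
  assumes V: "V \<subseteq> A" and j: "j \<in> A - V"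
    and gj: "g j \<in> B" "c' (g j) = c j" "g j \<notin> g ` V" and u: "u \<in> B" "c' u = c j" "u \<notin> g ` V"
  shows "card (agreeing (insert j V) g) \<le> card (agreeing (insert j V) (g(j := u)))"
proof (rule card_inj_on_le)
  let ?t = "Transposition.transpose (g j) u"
  let ?f = "\<lambda>\<sigma>. restrict (?t \<circ> \<sigma>) A"
  show "inj_on ?f (agreeing (insert j V) g)"
  proof (rule inj_onI)
    fix \<sigma> \<sigma>' assume s: "\<sigma> \<in> agreeing (insert j V) g" "\<sigma>' \<in> agreeing (insert j V) g" and eq: "?f \<sigma> = ?f \<sigma>'"
    show "\<sigma> = \<sigma>'"
    proof (rule PiE_ext[of _ A "\<lambda>_. B"])
      fix x assume "x \<in> A"
      then have "?t (\<sigma> x) = ?t (\<sigma>' x)" using fun_cong[OF eq, of x] by simp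
      then show "\<sigma> x = \<sigma>' x" by (metis transpose_involutory)
    qed (use s in \<open>auto simp: agreeing_def colour_bijections_def\<close>)
  qed
  show "?f ` agreeing (insert j V) g \<subseteq> agreeing (insert j V) (g(j := u))"
  proof (rule image_subsetI)
    fix \<sigma> assume s: "\<sigma> \<in> agreeing (insert j V) g"
    have bij: "bij_betw \<sigma> A B" and cl: "\<And>x. x \<in> A \<Longrightarrow> c' (\<sigma> x) = c x"
      and ag: "\<And>x. x \<in> insert j V \<Longrightarrow> \<sigma> x = g x"
      using s by (auto simp: agreeing_def colour_bijections_def)
    have "bij_betw ?t B B"
      using gj u by (intro bij_betw_byWitness[where f' = ?t]) (auto simp: Transposition.transpose_def)
    then have "bij_betw (?t \<circ> \<sigma>) A B" using bij bij_betw_trans by blast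
    then have b: "bij_betw (?f \<sigma>) A B" by (subst bij_betw_cong[of A _ "?t \<circ> \<sigma>"]) auto
    then have maps: "?f \<sigma> \<in> A \<rightarrow>\<^sub>E B" by (auto simp: bij_betw_def)
    have col: "c' (?f \<sigma> x) = c x" if "x \<in> A" for x
      using cl[OF that] gj u that by (auto simp: Transposition.transpose_def)
    have agr: "?f \<sigma> x = (g(j := u)) x" if "x \<in> insert j V" for x
    proof (cases "x = j")
      case False
      then have "g x \<in> g ` V" using that by simp
      then have "g x \<noteq> g j" "g x \<noteq> u" using gj(3) u(3) by metis+
      then show ?thesis using False ag[OF that] that V by auto
    qed (use ag j in auto)
    show "?f \<sigma> \<in> agreeing (insert j V) (g(j := u))"
      unfolding agreeing_def colour_bijections_def by (intro CollectI conjI ballI maps b col agr)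
  qed
qed (rule finite_agreeing)

text \<open>The bijections that agree with \<open>g\<close> on \<open>V\<close> are split by the
  image of \<open>j\<close>, and equally many take each free value. Only members of \<open>V\<close>
  of the colour of \<open>j\<close> block values in its class.\<close>

lemma card_agreeing_insert:
  assumes V: "V \<subseteq> A" and j: "j \<in> A - V"
  shows "card (agreeing (insert j V) g) * (card {y \<in> B. c' y = c j} - card {x \<in> V. c x = c j})
    \<le> card (agreeing V g)"
proof (cases "agreeing (insert j V) g = {}")
  case False
  \<comment> \<open>The witness shows that \<open>g\<close> is injective and respects colours on
    \<open>insert j V\<close>; without a witness the left-hand side is 0.\<close>
  then obtain \<sigma> where \<sigma>: "\<sigma> \<in> agreeing (insert j V) g" by auto
  have ag: "\<And>x. x \<in> insert j V \<Longrightarrow> g x = \<sigma> x"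
    and bij: "bij_betw \<sigma> A B" and cl: "\<And>x. x \<in> A \<Longrightarrow> c' (\<sigma> x) = c x"
    using \<sigma> by (auto simp: agreeing_def colour_bijections_def)
  define F where "F = {y \<in> B. c' y = c j} - g ` V"
  have finV: "finite V" using V fin finite_subset by auto
  have gV: "g ` V = \<sigma> ` V" using ag by (intro image_cong) auto
  have "\<sigma> j \<notin> \<sigma> ` V"
    using bij j V inj_on_image_mem_iff[of \<sigma> A j V] by (auto simp: bij_betw_def)
  moreover have "\<sigma> j \<in> B" using bij j by (auto simp: bij_betw_def)
  ultimately have "g j \<in> F"
    using ag[of j] cl[of j] j by (simp add: F_def gV)
  have "card (\<Union>u\<in>F. agreeing (insert j V) (g(j := u))) \<le> card (agreeing V g)"
    using finite_agreeing j by (intro card_mono) (auto simp: agreeing_def)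
  moreover have "card (\<Union>u\<in>F. agreeing (insert j V) (g(j := u))) = (\<Sum>u\<in>F. card (agreeing (insert j V) (g(j := u))))"
    using fin finite_agreeing
    by (intro card_UN_disjoint ballI impI finite_agreeing) (auto simp: F_def agreeing_def)
  moreover have "card F * card (agreeing (insert j V) g) \<le> (\<Sum>u\<in>F. card (agreeing (insert j V) (g(j := u))))"
    using \<open>g j \<in> F\<close> sum_mono[of F "\<lambda>_. card (agreeing (insert j V) g)"] agreeing_swap[OF V j]
    by (simp add: F_def)
  moreover have "card {y \<in> B. c' y = c j} - card {x \<in> V. c x = c j} \<le> card F"
  proof -
    have "F = {y \<in> B. c' y = c j} - g ` {x \<in> V. c x = c j}"
    proof -
      have "g x \<in> g ` {x \<in> V. c x = c j}" if "x \<in> V" "c' (g x) = c j" for x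
      proof (rule imageI)
        have "g x = \<sigma> x" "x \<in> A" using ag[of x] that V by auto
        then show "x \<in> {x \<in> V. c x = c j}" using cl[of x] that by simp
      qed
      then show ?thesis by (auto simp: F_def)
    qed
    moreover have "card (g ` {x \<in> V. c x = c j}) \<le> card {x \<in> V. c x = c j}"
      using finV by (intro card_image_le) auto
    ultimately show ?thesis using diff_card_le_card_Diff[of "g ` {x \<in> V. c x = c j}" "{y \<in> B. c' y = c j}"] finV
      by (simp add: le_diff_conv le_trans)
  qed
  then have "(card {y \<in> B. c' y = c j} - card {x \<in> V. c x = c j}) * card (agreeing (insert j V) g) \<le>
      card F * card (agreeing (insert j V) g)"
    by (rule mult_right_mono) simp
  ultimately show ?thesis by (subst mult.commute) linarith
qed simp

lemma card_agreeing_prod_le: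
  assumes "finite V" "V \<subseteq> A"
  shows "card (agreeing V g) * (\<Prod>i\<in>c ` A. \<Prod>a<card {x \<in> V. c x = i}. card {y \<in> B. c' y = i} - a)
    \<le> card colour_bijections"
  using assms
proof (induction V)
  case empty
  then show ?case by (simp add: agreeing_def)
next
  case (insert j V)
  let ?M = "\<lambda>i. card {y \<in> B. c' y = i}" and ?v = "\<lambda>V i. card {x \<in> V. c x = i}"
  let ?F = "\<lambda>V i. \<Prod>a<?v V i. ?M i - a"
  have j: "j \<in> A - V" "V \<subseteq> A" using insert by auto
  have same: "?v (insert j V) i = ?v V i" if "i \<noteq> c j" for i
  proof -
    have "{x \<in> insert j V. c x = i} = {x \<in> V. c x = i}" using that by auto
    then show ?thesis by simp
  qed
  have "{x \<in> insert j V. c x = c j} = insert j {x \<in> V. c x = c j}" by auto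
  then have new: "?v (insert j V) (c j) = Suc (?v V (c j))" using insert by simp
  have cj: "c j \<in> c ` A" using j by auto
  have "(\<Prod>i\<in>c ` A. ?F (insert j V) i) = ?F (insert j V) (c j) * (\<Prod>i\<in>c ` A - {c j}. ?F (insert j V) i)"
    using fin cj by (intro prod.remove) auto
  also have "(\<Prod>i\<in>c ` A - {c j}. ?F (insert j V) i) = (\<Prod>i\<in>c ` A - {c j}. ?F V i)"
  proof (rule prod.cong[OF refl])
    fix i assume "i \<in> c ` A - {c j}"
    then have "?v (insert j V) i = ?v V i" by (intro same) blast
    then show "?F (insert j V) i = ?F V i" by (simp only:)
  qed
  also have "?F (insert j V) (c j) = (?M (c j) - ?v V (c j)) * ?F V (c j)"
    unfolding new by (simp add: mult.commute)
  also have "\<dots> * (\<Prod>i\<in>c ` A - {c j}. ?F V i) = (?M (c j) - ?v V (c j)) * (\<Prod>i\<in>c ` A. ?F V i)"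
    using fin cj by (subst prod.remove[of "c ` A" "c j" "?F V"]) (auto simp: mult_ac)
  finally have "card (agreeing (insert j V) g) * (\<Prod>i\<in>c ` A. ?F (insert j V) i) =
      (card (agreeing (insert j V) g) * (?M (c j) - ?v V (c j))) * (\<Prod>i\<in>c ` A. ?F V i)"
    by (simp only: mult.assoc)
  also have "\<dots> \<le> card (agreeing V g) * (\<Prod>i\<in>c ` A. ?F V i)"
    using card_agreeing_insert[OF j(2,1)] by (rule mult_right_mono) simp
  also have "\<dots> \<le> card colour_bijections" using insert by simp
  finally show ?case .
qed

text \<open>Each prescribed value costs a factor e / m: colour by colour the loss is a falling
  factorial of a class size that is at least \<open>m\<close>.\<close>

lemma card_agreeing_le:
  assumes V: "V \<subseteq> A"
  shows "real (card (agreeing V g)) \<le> card colour_bijections * (exp 1 / m) ^ card V"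
proof -
  let ?M = "\<lambda>i. card {y \<in> B. c' y = i}" and ?v = "\<lambda>i. card {x \<in> V. c x = i}"
  have finV: "finite V" using V fin finite_subset by auto
  have "(m / exp 1) ^ card V = (m / exp 1) ^ (\<Sum>i\<in>c ` A. ?v i)"
  proof -
    have "card V = (\<Sum>i\<in>c ` A. ?v i)"
      using V fin finV sum.group[of V "c ` A" c "\<lambda>_. 1 :: nat", OF finV _ image_mono[OF V]] by simp
    then show ?thesis by simp
  qed
  also have "\<dots> = (\<Prod>i\<in>c ` A. (m / exp 1) ^ ?v i)" by (simp add: power_sum)
  also have "\<dots> \<le> (\<Prod>i\<in>c ` A. \<Prod>a<?v i. real (?M i - a))"
  proof (intro prod_mono conjI)
    fix i assume i: "i \<in> c ` A"
    show "0 \<le> (m / exp 1) ^ ?v i" using m_pos by simp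
    have "?v i \<le> card {x \<in> A. c x = i}" using V fin by (intro card_mono) auto
    then have "?v i \<le> ?M i" using class_card[OF i] by simp
    then have "real (?M i) ^ ?v i \<le> exp 1 ^ ?v i * (\<Prod>a<?v i. real (?M i - a))"
      by (rule falling_factorial_ge)
    moreover have "m ^ ?v i \<le> real (?M i) ^ ?v i" using class_large[OF i] m_pos by (intro power_mono) auto
    ultimately show "(m / exp 1) ^ ?v i \<le> (\<Prod>a<?v i. real (?M i - a))"
      by (simp add: power_divide field_simps)
  qed
  finally have "real (card (agreeing V g)) * (m / exp 1) ^ card V \<le>
    real (card (agreeing V g) * (\<Prod>i\<in>c ` A. \<Prod>a<?v i. ?M i - a))"
    by (simp add: mult_left_mono of_nat_prod)
  also have "\<dots> \<le> card colour_bijections"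
    using card_agreeing_prod_le[OF finV V] by (simp only: of_nat_le_iff)
  finally have "real (card (agreeing V g)) * (m / exp 1) ^ card V * (exp 1 / m) ^ card V \<le>
    card colour_bijections * (exp 1 / m) ^ card V" using m_pos by (intro mult_right_mono) auto
  moreover have "(m / exp 1) ^ card V * (exp 1 / m) ^ card V = 1"
    using m_pos by (simp add: power_mult_distrib[symmetric])
  ultimately show ?thesis by (simp add: mult.assoc)
qed

text \<open>Union bound over the restriction of the bijection to the vertices of \<open>J\<close>,
  which is a placement of \<open>J\<close> in \<open>T\<close>.\<close>

lemma card_mapping_into_le:
  assumes J: "\<Union>J \<subseteq> A" and fM: "finite (edge_maps J (\<Union>J) (\<lambda>x. {y. c' y = c x}) T)"
  shows "real (card {\<sigma> \<in> colour_bijections. \<forall>e\<in>J. \<sigma> ` e \<in> T}) \<le>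
    card colour_bijections * ((exp 1 / m) ^ card (\<Union>J) * card (edge_maps J (\<Union>J) (\<lambda>x. {y. c' y = c x}) T))"
proof -
  let ?M = "edge_maps J (\<Union>J) (\<lambda>x. {y. c' y = c x}) T"
  let ?S = "{\<sigma> \<in> colour_bijections. \<forall>e\<in>J. \<sigma> ` e \<in> T}"
  have "?S \<subseteq> (\<Union>g\<in>?M. agreeing (\<Union>J) g)"
  proof
    fix \<sigma> assume \<sigma>: "\<sigma> \<in> ?S"
    have "restrict \<sigma> (\<Union>J) ` e = \<sigma> ` e" if "e \<in> J" for e using that by (intro image_cong) auto
    then have "restrict \<sigma> (\<Union>J) \<in> ?M" 
      using \<sigma> J by (auto simp: edge_maps_def colour_bijections_def)
    moreover have "\<sigma> \<in> agreeing (\<Union>J) (restrict \<sigma> (\<Union>J))" using \<sigma> by (auto simp: agreeing_def)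
    ultimately show "\<sigma> \<in> (\<Union>g\<in>?M. agreeing (\<Union>J) g)" by blast
  qed
  then have "card ?S \<le> card (\<Union>g\<in>?M. agreeing (\<Union>J) g)"
    using fM finite_agreeing by (intro card_mono) auto
  also have "\<dots> \<le> (\<Sum>g\<in>?M. card (agreeing (\<Union>J) g))" using fM by (rule card_UN_le)
  finally have "real (card ?S) \<le> (\<Sum>g\<in>?M. real (card (agreeing (\<Union>J) g)))"
    by (simp flip: of_nat_sum)
  also have "\<dots> \<le> (\<Sum>g\<in>?M. card colour_bijections * (exp 1 / m) ^ card (\<Union>J))"
    using J by (intro sum_mono card_agreeing_le)
  finally show ?thesis by (simp add: mult_ac)
qed

end

section \<open>Copies within clusters\<close>

text \<open>Expand the product of the terms 1 + w D. It reduces a sum over arbitrary edge sets to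
  one over connected edge sets.\<close>

lemma sum_Pow_prod_le_exp:
  fixes w :: "'a \<Rightarrow> real"
  assumes "finite C" "\<And>D. D \<in> C \<Longrightarrow> w D \<ge> 0"
  shows "(\<Sum>\<D>\<in>Pow C. \<Prod>D\<in>\<D>. w D) \<le> exp (\<Sum>D\<in>C. w D)"
proof -
  have "(\<Sum>\<D>\<in>Pow C. \<Prod>D\<in>\<D>. w D) = (\<Prod>D\<in>C. w D + 1)"
    using prod_add[OF assms(1), of w "\<lambda>_. 1"] by simp
  also have "\<dots> \<le> (\<Prod>D\<in>C. exp (w D))"
  proof (intro prod_mono conjI)
    fix D assume "D \<in> C"
    then show "0 \<le> w D + 1" using assms(2)[of D] by linarith
    show "w D + 1 \<le> exp (w D)" using exp_ge_add_one_self[of "w D"] by linarith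
  qed
  also have "\<dots> = exp (\<Sum>D\<in>C. w D)" using assms(1) by (simp add: exp_sum)
  finally show ?thesis .
qed

locale cluster_cycle =
  fixes n k m :: nat
  assumes k2: "k \<ge> 2" and nk: "n > 2 * k" and m: "1 \<le> m" "m \<le> n"
begin

lemma k1: "k \<ge> 1" using k2 by simp

lemmas cyc = cycle_power_edge[OF nk k1] card_Union_edges[OF nk k1]

text \<open>The last cluster takes up the remainder of \<open>n\<close> modulo \<open>m\<close>.\<close>

definition cluster :: "nat \<Rightarrow> nat" where
  "cluster j = min (j div m) (n div m - 1)"

lemma cluster_interval:
  assumes "j < n" shows "cluster j * m \<le> j" "j < cluster j * m + 2 * m"
proof -
  have "cluster j * m \<le> (j div m) * m" by (intro mult_right_mono) (auto simp: cluster_def)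
  then show "cluster j * m \<le> j" using div_times_less_eq_dividend[of j m] by linarith
  show "j < cluster j * m + 2 * m"
  proof (cases "j div m \<le> n div m - 1")
    case True
    then have "cluster j = j div m" by (simp add: cluster_def)
    moreover have "j < (j div m) * m + m" using m dividend_less_div_times[of m j] by simp
    ultimately show ?thesis by simp
  next
    case False
    then have "cluster j = n div m - 1" by (simp add: cluster_def)
    moreover have "n div m \<ge> 1" using m by (simp add: div_greater_zero_iff Suc_leI)
    then obtain q where "n div m = Suc q" by (cases "n div m") auto
    moreover have "n < (n div m) * m + m" using m dividend_less_div_times[of m n] by simp
    ultimately show ?thesis using assms by simp
  qed
qed

lemma card_cluster_le: "card {j \<in> {..<n}. cluster j = i} \<le> 2 * m"
proof -
  have "{j \<in> {..<n}. cluster j = i} \<subseteq> {i * m..<i * m + 2 * m}"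
    using cluster_interval by auto
  then have "card {j \<in> {..<n}. cluster j = i} \<le> card {i * m..<i * m + 2 * m}"
    by (intro card_mono) auto
  then show ?thesis by simp
qed

lemma card_cluster_ge:
  assumes "j < n" shows "m \<le> card {x \<in> {..<n}. cluster x = cluster j}"
proof -
  let ?i = "cluster j"
  have "n div m \<ge> 1" using m by (simp add: div_greater_zero_iff Suc_leI)
  then have i: "?i < n div m" by (simp add: cluster_def min_less_iff_disj)
  have "{?i * m..<?i * m + m} \<subseteq> {x \<in> {..<n}. cluster x = ?i}"
  proof
    fix x assume x: "x \<in> {?i * m..<?i * m + m}"
    have "Suc ?i * m \<le> (n div m) * m" using i by (intro mult_right_mono) auto
    moreover have "Suc ?i * m = ?i * m + m" by simp
    moreover have "(n div m) * m \<le> n" by simp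
    moreover have "x < ?i * m + m" using x by simp
    ultimately have "x < n" by linarith
    moreover have "x div m = ?i" using x m by (intro div_nat_eqI) (auto simp: mult.commute)
    then have "cluster x = ?i" using i by (simp add: cluster_def)
    ultimately show "x \<in> {x \<in> {..<n}. cluster x = ?i}" by simp
  qed
  then have "card {?i * m..<?i * m + m} \<le> card {x \<in> {..<n}. cluster x = ?i}"
    by (intro card_mono) auto
  then show ?thesis by simp
qed

lemma card_vertex_cluster:
  "card {y \<in> {1..n}. cluster (y - 1) = i} = card {j \<in> {..<n}. cluster j = i}"
proof -
  have "bij_betw Suc {j \<in> {..<n}. cluster j = i} {y \<in> {1..n}. cluster (y - 1) = i}"
    by (rule bij_betw_byWitness[where f' = "\<lambda>y. y - 1"]) auto
  from bij_betw_same_card[OF this] show ?thesis by (rule sym)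
qed

sublocale coloured_sets "{..<n}" "{1..n}" cluster "\<lambda>y. cluster (y - 1)" "real m"
proof
  show "real m \<le> real (card {y \<in> {1..n}. cluster (y - 1) = i})" if "i \<in> cluster ` {..<n}" for i
    unfolding card_vertex_cluster using that card_cluster_ge by auto
  show "card {x \<in> {..<n}. cluster x = i} \<le> card {y \<in> {1..n}. cluster (y - 1) = i}" for i
    unfolding card_vertex_cluster ..
qed (use m in simp_all)

section \<open>Weighted placements of pieces of a copy in a fragment\<close>

abbreviation P where "P \<equiv> cycle_power n k"
abbreviation \<Delta> where "\<Delta> \<equiv> 2 * k + 1"
abbreviation R :: "nat \<Rightarrow> nat set" where "R \<equiv> \<lambda>x. {y. cluster (y - 1) = cluster x}"

text \<open>Costs per edge of a connected piece. A vertex costs e \<Delta> and an edge brings at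
  most two vertices; 16 k^2 is the loss in the density estimate. \<open>C\<close> adds the number of
  connected pieces through a point. Both depend on \<open>k\<close> alone.\<close>

definition K :: real where "K = (exp 1 * real \<Delta>)\<^sup>2 * (16 * real k ^ 2)"
definition C :: real where "C = 2 ^ (5 * k\<^sup>2) * K"

lemma K_pos: "K > 0" and C_pos: "C > 0"
  using k2 by (simp_all add: K_def C_def)

definition conn :: "nat set set set" where
  "conn = {D. D \<subseteq> P \<and> connected_edges D}"

lemma finite_conn: "finite conn"
  by (rule finite_subset[of _ "Pow P"]) (auto simp: conn_def)

context
  fixes T :: "nat set set" and x :: real
  assumes T: "finite T" "\<And>e. e \<in> T \<Longrightarrow> e \<subseteq> {1..n} \<and> card e = 2" "\<And>v. card (neighbours T v) \<le> \<Delta>"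
    and x: "x > 0"
begin

abbreviation maps :: "nat set set \<Rightarrow> (nat \<Rightarrow> nat) set" where
  "maps J \<equiv> edge_maps J (\<Union>J) R T"

text \<open>Bounds \<open>x ^ card J\<close> times the probability that a random copy puts all of
  \<open>J\<close> into \<open>T\<close>, since a given placement is followed with probability at
  most (e / m)^v. Later \<open>x\<close> is the reciprocal of the edge density
  \<open>\<beta>\<close>.\<close>

definition weight :: "nat set set \<Rightarrow> real" where
  "weight J = x ^ card J * (exp 1 / m) ^ card (\<Union>J) * card (maps J)"

lemma weight_nonneg: "weight J \<ge> 0"
  using x by (simp add: weight_def)

lemma T_finite_edges: "e \<in> T \<Longrightarrow> finite e"
  using T(2) finite_subset by blast

lemma maps_conn:
  assumes "D \<in> conn" "a \<in> \<Union>D"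
  shows "finite (maps D)" "card (maps D) \<le> card (R a \<inter> \<Union>T) * \<Delta> ^ card (\<Union>D)"
proof -
  have D: "D \<subseteq> P" "connected_edges D" using assms by (auto simp: conn_def)
  then have e: "\<And>e. e \<in> D \<Longrightarrow> card e = 2" using cyc by blast
  show "finite (maps D)" "card (maps D) \<le> card (R a \<inter> \<Union>T) * \<Delta> ^ card (\<Union>D)"
    using card_edge_maps_connected[OF D(2) _ e assms(2) T(1) T_finite_edges T(3), of R] cyc(3)[OF D(1)]
    by auto
qed

lemma conn_nonempty: "D \<in> conn \<Longrightarrow> \<exists>a. a \<in> \<Union>D"
proof -
  assume "D \<in> conn"
  then obtain e where "e \<in> D" "e \<in> P" by (auto simp: conn_def connected_edges_def)
  then show ?thesis using cyc(2)[of e] by (metis UnionI card.empty equals0I zero_neq_numeral)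
qed

text \<open>Over vertex-disjoint components the numbers of edges and vertices add up while
  placements at most multiply, so \<open>weight\<close> is submultiplicative.\<close>

lemma decomposition:
  assumes J: "J \<subseteq> P"
  shows "\<exists>\<D> \<subseteq> conn. \<Union>\<D> = J \<and> weight J \<le> (\<Prod>D\<in>\<D>. weight D) \<and> finite (maps J)"
proof -
  have finJ: "finite J" using J cyc by auto
  obtain \<D> where \<D>: "\<Union>\<D> = J" "\<forall>D\<in>\<D>. connected_edges D"
    "\<forall>D\<in>\<D>. \<forall>D'\<in>\<D>. D \<noteq> D' \<longrightarrow> \<Union>D \<inter> \<Union>D' = {}"
    using connected_edges_decomposition[OF finJ] by metis
  have sub: "\<D> \<subseteq> conn" using \<D> J by (auto simp: conn_def)
  have fin\<D>: "finite \<D>" using sub finite_conn finite_subset by auto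
  have finD: "finite D" "finite (\<Union>D)" if "D \<in> \<D>" for D
    using cyc(3,4)[of D] sub that by (auto simp: conn_def)
  have "D \<inter> D' = {}" if "D \<in> \<D>" "D' \<in> \<D>" "D \<noteq> D'" for D D'
  proof (rule ccontr)
    assume "D \<inter> D' \<noteq> {}"
    then obtain e where e: "e \<in> D" "e \<in> D'" by auto
    then have "card e = 2" using that sub cyc(2) by (auto simp: conn_def)
    then obtain v where "v \<in> e" by (metis card.empty equals0I zero_neq_numeral)
    then have "v \<in> \<Union>D \<inter> \<Union>D'" using e by auto
    then show False using \<D>(3) that by blast
  qed
  then have "card (\<Union>D\<in>\<D>. D) = (\<Sum>D\<in>\<D>. card D)"
    using fin\<D> finD by (intro card_UN_disjoint) auto
  then have cJ: "card J = (\<Sum>D\<in>\<D>. card D)" using \<D>(1) by simp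
  have "card (\<Union>D\<in>\<D>. \<Union>D) = (\<Sum>D\<in>\<D>. card (\<Union>D))"
    using fin\<D> finD \<D>(3) by (intro card_UN_disjoint ballI) blast+
  moreover have "(\<Union>D\<in>\<D>. \<Union>D) = \<Union>J" using \<D>(1) by blast
  ultimately have vJ: "card (\<Union>J) = (\<Sum>D\<in>\<D>. card (\<Union>D))" by simp
  have "finite (maps D)" if "D \<in> \<D>" for D
    using that sub conn_nonempty maps_conn(1) by blast
  then have mJ: "finite (maps J)" "card (maps J) \<le> (\<Prod>D\<in>\<D>. card (maps D))"
    using card_edge_maps_disjoint[OF fin\<D>, of R T] \<D>(1) by auto
  have "real (card (maps J)) \<le> real (\<Prod>D\<in>\<D>. card (maps D))" using mJ(2) by (simp only: of_nat_le_iff)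
  then have "weight J \<le> x ^ card J * (exp 1 / m) ^ card (\<Union>J) * real (\<Prod>D\<in>\<D>. card (maps D))"
    unfolding weight_def using x by (intro mult_left_mono) auto
  also have "\<dots> = (\<Prod>D\<in>\<D>. weight D)"
    unfolding weight_def cJ vJ by (simp add: power_sum prod.distrib)
  finally show ?thesis using \<D>(1) sub mJ(1) by blast
qed

lemma sum_weight_le_exp: "(\<Sum>J\<in>Pow P. weight J) \<le> exp (\<Sum>D\<in>conn. weight D)"
proof -
  have "\<forall>J\<in>Pow P. \<exists>\<D> \<subseteq> conn. \<Union>\<D> = J \<and> weight J \<le> (\<Prod>D\<in>\<D>. weight D)"
    using decomposition by blast
  then obtain f where f: "\<And>J. J \<in> Pow P \<Longrightarrow> f J \<subseteq> conn \<and> \<Union>(f J) = J \<and> weight J \<le> (\<Prod>D\<in>f J. weight D)"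
    by metis
  \<comment> \<open>\<open>J\<close> is recovered from its chosen decomposition as the
    union.\<close>
  have "inj_on f (Pow P)" using f by (metis inj_onI)
  have "(\<Sum>J\<in>Pow P. weight J) \<le> (\<Sum>J\<in>Pow P. \<Prod>D\<in>f J. weight D)"
    using f by (intro sum_mono) blast
  also have "\<dots> = (\<Sum>\<D>\<in>f ` Pow P. \<Prod>D\<in>\<D>. weight D)"
    using \<open>inj_on f (Pow P)\<close> by (simp add: sum.reindex)
  also have "\<dots> \<le> (\<Sum>\<D>\<in>Pow conn. \<Prod>D\<in>\<D>. weight D)"
    using f finite_conn weight_nonneg by (intro sum_mono2) (auto intro: prod_nonneg)
  also have "\<dots> \<le> exp (\<Sum>D\<in>conn. weight D)"
    using finite_conn weight_nonneg by (intro sum_Pow_prod_le_exp)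
  finally show ?thesis .
qed

text \<open>The rooted count of placements combined with the density estimate in the form m^(-v)
  \<le> (16 k^2)^l m^(-l/k-3/2); as v \<le> 2 l, all other factors per vertex become factors per
  edge.\<close>

lemma weight_conn_le:
  assumes D: "D \<in> conn" and a: "a \<in> \<Union>D"
  shows "weight D \<le> card (R a \<inter> \<Union>T) / m powr (3 / 2) * (K * (x / m powr (1 / k))) ^ card D"
proof -
  let ?l = "card D" and ?v = "card (\<Union>D)" and ?t = "real (card (R a \<inter> \<Union>T))"
  have DP: "D \<subseteq> P" "D \<noteq> {}" using D by (auto simp: conn_def connected_edges_def)
  have v: "?v \<le> 2 * ?l" using cyc(5)[OF DP(1)] .
  have mp: "real m > 0" using m by simp
  have "card (maps D) \<le> ?t * real \<Delta> ^ ?v"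
    using maps_conn(2)[OF D a] by (simp only: of_nat_mult[symmetric] of_nat_power[symmetric] of_nat_le_iff)
  then have "weight D \<le> x ^ ?l * (exp 1 / m) ^ ?v * (?t * real \<Delta> ^ ?v)"
    unfolding weight_def using x by (intro mult_left_mono) auto
  also have "\<dots> = ?t * x ^ ?l * (exp 1 * real \<Delta>) ^ ?v / real m ^ ?v"
    by (simp add: power_mult_distrib power_divide)
  also have "\<dots> \<le> ?t * x ^ ?l * (exp 1 * real \<Delta>) ^ (2 * ?l) / real m ^ ?v"
  proof -
    have "1 * 1 \<le> exp 1 * real \<Delta>" by (intro mult_mono) auto
    then have "(exp 1 * real \<Delta>) ^ ?v \<le> (exp 1 * real \<Delta>) ^ (2 * ?l)"
      using v by (intro power_increasing) auto
    then show ?thesis using x by (intro divide_right_mono mult_left_mono) auto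
  qed
  also have "\<dots> \<le> ?t * x ^ ?l * (exp 1 * real \<Delta>) ^ (2 * ?l) * ((16 * real k ^ 2) ^ ?l / m powr (?l / k + 3 / 2))"
  proof -
    have "real m powr (?l / k + 3 / 2) \<le> real m ^ ?v * (16 * real k ^ 2) ^ ?l"
      using cycle_power_density[OF nk k1 k2 DP m] .
    then have "1 / real m ^ ?v \<le> (16 * real k ^ 2) ^ ?l / m powr (?l / k + 3 / 2)"
      using mp by (simp add: field_simps)
    then have "?t * x ^ ?l * (exp 1 * real \<Delta>) ^ (2 * ?l) * (1 / real m ^ ?v) \<le> 
       ?t * x ^ ?l * (exp 1 * real \<Delta>) ^ (2 * ?l) * ((16 * real k ^ 2) ^ ?l / m powr (?l / k + 3 / 2))"
      using x by (intro mult_left_mono) auto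
    then show ?thesis by simp
  qed
  also have "\<dots> = ?t / m powr (3 / 2) * (K * (x / m powr (1 / k))) ^ ?l"
  proof -
    have "m powr (?l / k + 3 / 2) = (m powr (1 / k)) ^ ?l * m powr (3 / 2)"
      using mp by (simp add: powr_add powr_powr flip: powr_realpow)
    moreover have "(exp 1 * real \<Delta>) ^ (2 * ?l) = ((exp 1 * real \<Delta>)\<^sup>2) ^ ?l" by (simp only: power_mult)
    ultimately show ?thesis by (simp only: K_def power_mult_distrib power_divide) (simp add: field_simps)
  qed
  finally show ?thesis .
qed

text \<open>\<open>T\<close> has at most \<open>2 * card T\<close> vertices, and each of them shares
  its cluster with at most \<open>2 * m\<close> positions \<open>a\<close>.\<close>

lemma sum_card_R: "(\<Sum>a<n. card (R a \<inter> \<Union>T)) \<le> 4 * m * card T"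
proof -
  have finU: "finite (\<Union>T)" using T(1) T_finite_edges by auto
  have UT: "\<Union>T \<subseteq> {1..n}" using T(2) by auto
  have "(\<Sum>a<n. card (R a \<inter> \<Union>T)) = card (SIGMA a:{..<n}. R a \<inter> \<Union>T)"
    using finU by (subst card_SigmaI) auto
  also have "\<dots> \<le> card (SIGMA y:\<Union>T. {a \<in> {..<n}. cluster a = cluster (y - 1)})"
    by (rule card_inj_on_le[of "\<lambda>(a, y). (y, a)"]) (use finU in \<open>auto simp: inj_on_def\<close>)
  also have "\<dots> = (\<Sum>y\<in>\<Union>T. card {a \<in> {..<n}. cluster a = cluster (y - 1)})"
    using finU by (subst card_SigmaI) auto
  also have "\<dots> \<le> (\<Sum>y\<in>\<Union>T. 2 * m)" by (intro sum_mono card_cluster_le)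
  also have "\<dots> = card (\<Union>T) * (2 * m)" by simp
  also have "card (\<Union>T) \<le> (\<Sum>e\<in>T. card e)" by (rule card_Union_le_sum_card)
  also have "(\<Sum>e\<in>T. card e) = 2 * card T" using T(2) by simp
  finally show ?thesis by (simp add: mult_ac)
qed

text \<open>Charge \<open>D\<close> to every position it contains; the overcount is harmless. Sizes
  contribute a geometric series in \<open>C * y\<close>, and roots contribute
  \<open>4 * m * card T\<close>, of which division by \<open>m powr (3 / 2)\<close> leaves
  \<open>card T / sqrt m\<close>.\<close>

lemma sum_weight_conn_le:
  assumes y: "C * (x / m powr (1 / k)) \<le> 1 / 2"
  shows "(\<Sum>D\<in>conn. weight D) \<le> 8 * C * (x / m powr (1 / k)) * (card T / sqrt m)"
proof -
  define y where "y = x / m powr (1 / k)"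
  have mp: "real m > 0" using m by simp
  have y0: "y > 0" using x mp by (simp add: y_def)
  let ?b = "\<lambda>a l. card (R a \<inter> \<Union>T) / m powr (3 / 2) * (K * y) ^ l"
  let ?N = "card P"
  have bpos: "?b a l \<ge> 0" for a l using y0 K_pos by simp
  have "(\<Sum>D\<in>conn. weight D) \<le> (\<Sum>D\<in>conn. \<Sum>a | a < n \<and> a \<in> \<Union>D. ?b a (card D))"
  proof (intro sum_mono)
    fix D assume D: "D \<in> conn"
    from conn_nonempty[OF this] obtain a where a: "a \<in> \<Union>D" ..
    then have "a < n" using D cyc(1) by (auto simp: conn_def)
    have "weight D \<le> ?b a (card D)" using weight_conn_le[OF D a] by (simp add: y_def)
    also have "\<dots> \<le> (\<Sum>a | a < n \<and> a \<in> \<Union>D. ?b a (card D))"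
      using a \<open>a < n\<close> bpos by (intro member_le_sum) auto
    finally show "weight D \<le> (\<Sum>a | a < n \<and> a \<in> \<Union>D. ?b a (card D))" .
  qed
  also have "\<dots> = (\<Sum>a<n. \<Sum>D | D \<in> conn \<and> a \<in> \<Union>D. ?b a (card D))"
    using sum.swap_restrict[OF finite_conn finite_lessThan[of n], where R = "\<lambda>D a. a \<in> \<Union>D" and g = "\<lambda>D a. ?b a (card D)"]
    by simp
  also have "\<dots> \<le> (\<Sum>a<n. card (R a \<inter> \<Union>T) / m powr (3 / 2) * (2 * (C * y)))"
  proof (intro sum_mono)
    fix a
    have "(\<Sum>D | D \<in> conn \<and> a \<in> \<Union>D. ?b a (card D)) =
      (\<Sum>l\<in>{1..?N}. \<Sum>D\<in>{D. (D \<in> conn \<and> a \<in> \<Union>D) \<and> card D = l}. ?b a (card D))"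
    proof -
      have "card D \<in> {1..?N}" if "D \<in> conn" for D
      proof -
        have "D \<subseteq> P" "D \<noteq> {}" using that by (auto simp: conn_def connected_edges_def)
        then show ?thesis using card_mono[of P D] cyc(3)[of D] by (simp add: Suc_leI card_gt_0_iff)
      qed
      then have "card ` {D. D \<in> conn \<and> a \<in> \<Union>D} \<subseteq> {1..?N}" by auto
      then show ?thesis
        using sum.group[of "{D. D \<in> conn \<and> a \<in> \<Union>D}" "{1..?N}" card "\<lambda>D. ?b a (card D)"] finite_conn
        by simp
    qed
    also have "\<dots> = (\<Sum>l\<in>{1..?N}. real (card {D. (D \<in> conn \<and> a \<in> \<Union>D) \<and> card D = l}) * ?b a l)"
      by (intro sum.cong refl) simp
    also have "\<dots> \<le> (\<Sum>l\<in>{1..?N}. (2 ^ (5 * k\<^sup>2)) ^ l * ?b a l)"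
    proof (intro sum_mono mult_right_mono bpos)
      fix l assume "l \<in> {1..?N}"
      then have "card {D. D \<subseteq> P \<and> connected_edges D \<and> a \<in> \<Union>D \<and> card D = l} \<le> 2 ^ (5 * k\<^sup>2 * l)"
        using card_connected_through[OF nk k1, of l a] by simp
      moreover have "{D. (D \<in> conn \<and> a \<in> \<Union>D) \<and> card D = l} = {D. D \<subseteq> P \<and> connected_edges D \<and> a \<in> \<Union>D \<and> card D = l}"
        by (auto simp: conn_def)
      ultimately have "card {D. (D \<in> conn \<and> a \<in> \<Union>D) \<and> card D = l} \<le> 2 ^ (5 * k\<^sup>2 * l)" by simp
      then have "real (card {D. (D \<in> conn \<and> a \<in> \<Union>D) \<and> card D = l}) \<le> real (2 ^ (5 * k\<^sup>2 * l))"
        by (simp only: of_nat_le_iff)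
      then show "real (card {D. (D \<in> conn \<and> a \<in> \<Union>D) \<and> card D = l}) \<le> (2 ^ (5 * k\<^sup>2)) ^ l"
        by (simp add: power_mult)
    qed
    also have "\<dots> = card (R a \<inter> \<Union>T) / m powr (3 / 2) * (\<Sum>l\<in>{1..?N}. (C * y) ^ l)"
      by (simp add: sum_distrib_left C_def power_mult_distrib mult_ac)
    also have "\<dots> \<le> card (R a \<inter> \<Union>T) / m powr (3 / 2) * (2 * (C * y))"
    proof (intro mult_left_mono)
      let ?q = "C * y"
      have q: "0 \<le> ?q" "?q \<le> 1 / 2" using y y0 C_pos by simp (use y in \<open>simp add: y_def\<close>)
      have "(\<Sum>l\<in>{1..?N}. ?q ^ l) = ?q * (\<Sum>l<?N. ?q ^ l)"
        by (simp add: sum_distrib_left sum.atLeast1_atMost_eq power_Suc)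
      also have "(\<Sum>l<?N. ?q ^ l) \<le> 2"
      proof -
        have "(\<Sum>l<?N. ?q ^ l) \<le> (\<Sum>l. ?q ^ l)"
          using q by (intro sum_le_suminf summable_geometric) auto
        also have "\<dots> = 1 / (1 - ?q)" using q by (subst suminf_geometric) auto
        also have "\<dots> \<le> 2" using q by (simp add: field_simps)
        finally show ?thesis .
      qed
      then have "?q * (\<Sum>l<?N. ?q ^ l) \<le> ?q * 2" using q by (intro mult_left_mono) auto
      finally show "(\<Sum>l\<in>{1..?N}. ?q ^ l) \<le> 2 * ?q" by simp
    qed auto
    finally show "(\<Sum>D | D \<in> conn \<and> a \<in> \<Union>D. ?b a (card D)) \<le> card (R a \<inter> \<Union>T) / m powr (3 / 2) * (2 * (C * y))" .
  qed
  also have "\<dots> = real (\<Sum>a<n. card (R a \<inter> \<Union>T)) * (2 * (C * y) / m powr (3 / 2))"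
    by (simp add: sum_distrib_right sum_divide_distrib)
  also have "\<dots> \<le> real (4 * m * card T) * (2 * (C * y) / m powr (3 / 2))"
  proof (rule mult_right_mono)
    show "real (\<Sum>a<n. card (R a \<inter> \<Union>T)) \<le> real (4 * m * card T)"
      using sum_card_R by (simp only: of_nat_le_iff)
  qed (use y0 C_pos in simp)
  also have "\<dots> = 8 * C * y * (card T / sqrt m)"
  proof -
    have "m powr (3 / 2) = m powr 1 * m powr (1 / 2)" using powr_add[of m 1 "1 / 2"] by simp
    also have "\<dots> = m * sqrt m" using mp by (simp add: powr_half_sqrt)
    finally show ?thesis using mp by simp
  qed
  finally show ?thesis by (simp add: y_def)
qed

text \<open>The normalisation of \<open>x\<close> turns the exponent into exactly
  \<open>card T / sqrt m\<close>; it also puts the ratio of the geometric series at 1 / 8.\<close>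

lemma sum_mapping_into_le:
  assumes y: "8 * C * (x / m powr (1 / k)) = 1"
  shows "(\<Sum>J\<in>Pow P. x ^ card J * card {\<sigma> \<in> colour_bijections. \<forall>e\<in>J. \<sigma> ` e \<in> T}) \<le>
    card colour_bijections * exp (card T / sqrt m)"
proof -
  have "(\<Sum>J\<in>Pow P. x ^ card J * card {\<sigma> \<in> colour_bijections. \<forall>e\<in>J. \<sigma> ` e \<in> T}) \<le>
    (\<Sum>J\<in>Pow P. card colour_bijections * weight J)"
  proof (intro sum_mono)
    fix J assume J: "J \<in> Pow P"
    have "\<Union>J \<subseteq> {..<n}" using J cyc(1) by blast
    moreover have "finite (maps J)" using decomposition J by blast
    ultimately have "real (card {\<sigma> \<in> colour_bijections. \<forall>e\<in>J. \<sigma> ` e \<in> T}) \<le>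
      card colour_bijections * ((exp 1 / m) ^ card (\<Union>J) * card (maps J))"
      by (rule card_mapping_into_le)
    then have "x ^ card J * card {\<sigma> \<in> colour_bijections. \<forall>e\<in>J. \<sigma> ` e \<in> T} \<le>
      x ^ card J * (card colour_bijections * ((exp 1 / m) ^ card (\<Union>J) * card (maps J)))"
      using x by (intro mult_left_mono) auto
    then show "x ^ card J * card {\<sigma> \<in> colour_bijections. \<forall>e\<in>J. \<sigma> ` e \<in> T} \<le> card colour_bijections * weight J"
      by (simp add: weight_def mult_ac)
  qed
  also have "\<dots> \<le> card colour_bijections * exp (\<Sum>D\<in>conn. weight D)"
    using sum_weight_le_exp by (simp add: sum_distrib_left[symmetric] mult_left_mono)
  also have "\<dots> \<le> card colour_bijections * exp (card T / sqrt m)"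
  proof -
    have "(\<Sum>D\<in>conn. weight D) \<le> 8 * C * (x / m powr (1 / k)) * (card T / sqrt m)"
      using y by (intro sum_weight_conn_le) simp
    then have "(\<Sum>D\<in>conn. weight D) \<le> card T / sqrt m" by (simp only: y mult_1)
    then show ?thesis by (intro mult_left_mono) auto
  qed
  finally show ?thesis .
qed

end

end

section \<open>Spread of the random cluster-preserving copies\<close>

context cluster_cycle
begin

lemma colour_bijectionsD:
  assumes "\<sigma> \<in> colour_bijections"
  shows "bij_betw \<sigma> {..<n} {1..n}" "x < n \<Longrightarrow> cluster (\<sigma> x - 1) = cluster x"
  using assms unfolding colour_bijections_def by blast+

definition copy :: "(nat \<Rightarrow> nat) \<Rightarrow> nat set set" where
  "copy \<sigma> = (`) \<sigma> ` P"

lemma copy_edge: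
  assumes "\<sigma> \<in> colour_bijections" "e \<in> copy \<sigma>"
  shows "e \<subseteq> {1..n} \<and> card e = 2"
proof -
  obtain f where f: "f \<in> P" "e = \<sigma> ` f" using assms(2) by (auto simp: copy_def)
  have bij: "bij_betw \<sigma> {..<n} {1..n}" by (rule colour_bijectionsD[OF assms(1)])
  have sub: "f \<subseteq> {..<n}" "card f = 2" using cyc f by auto
  have "inj_on \<sigma> f" using bij sub by (auto simp: bij_betw_def intro: inj_on_subset)
  then have "card e = 2" using f sub by (simp add: card_image)
  moreover have "e \<subseteq> {1..n}" using bij sub f by (auto simp: bij_betw_def)
  ultimately show ?thesis by simp
qed

lemma copy_subset_complete: "\<sigma> \<in> colour_bijections \<Longrightarrow> copy \<sigma> \<subseteq> complete_edges n"
  using copy_edge by (auto simp: complete_edges_def)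

lemma finite_copy: "finite (copy \<sigma>)"
  by (simp add: copy_def)

lemma card_copy_le: "card (copy \<sigma>) \<le> k * n"
  using card_image_le[of P "(`) \<sigma>"] card_cycle_power[OF nk k1] by (simp add: copy_def)

lemma card_neighbours_copy:
  assumes \<sigma>: "\<sigma> \<in> colour_bijections" and T: "T \<subseteq> copy \<sigma>"
  shows "card (neighbours T v) \<le> \<Delta>"
proof -
  have bij: "bij_betw \<sigma> {..<n} {1..n}" by (rule colour_bijectionsD[OF \<sigma>])
  \<comment> \<open>For \<open>v\<close> outside {1..n} this is an unspecified value, but then
    \<open>v\<close> has no neighbours. The degree is bounded by \<Delta> = 2 k + 1 because the
    window also contains its centre.\<close>
  let ?a = "the_inv_into {..<n} \<sigma> v"
  have "neighbours T v \<subseteq> \<sigma> ` window n k ?a"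
  proof
    fix y assume "y \<in> neighbours T v"
    then have "{v, y} \<in> copy \<sigma>" using T by (auto simp: neighbours_def)
    then obtain f where f: "f \<in> P" "{v, y} = \<sigma> ` f" by (auto simp: copy_def)
    then obtain a b where ab: "a \<in> f" "b \<in> f" "v = \<sigma> a" "y = \<sigma> b" by (metis imageE insertCI)
    then have "a < n" using f cyc(1) by blast
    then have "?a = a" using bij ab by (auto simp: bij_betw_def the_inv_into_f_f)
    then show "y \<in> \<sigma> ` window n k ?a" using cycle_power_window[OF nk k1 f(1) ab(1,2)] ab by simp
  qed
  then have "card (neighbours T v) \<le> card (window n k ?a)"
    using card_window(1)[of n k ?a] by (meson card_image_le card_mono finite_imageI le_trans)
  then show ?thesis using card_window(2)[of n k ?a] by simp
qed

text \<open>The threshold density m^(-1/k) up to a constant; 8 C is what the normalisation of x = 1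
  / \<beta> requires.\<close>

definition \<beta> :: real where "\<beta> = 8 * C / m powr (1 / k)"

lemma \<beta>_pos: "\<beta> > 0"
  using C_pos m by (simp add: \<beta>_def)

text \<open>Pull \<open>T'\<close> back along the copy: a pair of \<open>T'\<close> and a copy
  containing it becomes an l-subset \<open>J\<close> of \<open>P\<close> and a bijection that maps
  \<open>J\<close> into \<open>T\<close>. Weighted by \<open>x ^ l\<close>, these form part of the
  sum over all \<open>J\<close>.\<close>

lemma copy_spread:
  assumes \<sigma>: "\<sigma> \<in> colour_bijections" and T: "T \<subseteq> copy \<sigma>" and \<tau>: "card T / sqrt m \<le> \<tau>"
  shows "(\<Sum>T'\<in>subsets_of_card T l. real (card {\<rho> \<in> colour_bijections. T' \<subseteq> copy \<rho>}))
    \<le> \<beta> ^ l * exp \<tau> * card colour_bijections"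
proof -
  define x where "x = 1 / \<beta>"
  have x: "x > 0" using \<beta>_pos by (simp add: x_def)
  have y: "8 * C * (x / m powr (1 / k)) = 1" using C_pos m by (simp add: x_def \<beta>_def)
  have finT: "finite T" using T finite_copy finite_subset by blast
  let ?N = "\<lambda>J. {\<rho> \<in> colour_bijections. \<forall>e\<in>J. \<rho> ` e \<in> T}"
  have "card (SIGMA T':subsets_of_card T l. {\<rho> \<in> colour_bijections. T' \<subseteq> copy \<rho>}) \<le>
    card (SIGMA J:{J \<in> Pow P. card J = l}. ?N J)"
  proof (rule card_inj_on_le)
    let ?f = "\<lambda>(T', \<rho>). ({e \<in> P. \<rho> ` e \<in> T'}, \<rho>)"
    have img: "(`) \<rho> ` {e \<in> P. \<rho> ` e \<in> T'} = T'" if "T' \<subseteq> copy \<rho>" for T' and \<rho> :: "nat \<Rightarrow> nat"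
      using that by (auto simp: copy_def)
    show "inj_on ?f (SIGMA T':subsets_of_card T l. {\<rho> \<in> colour_bijections. T' \<subseteq> copy \<rho>})"
    proof (rule inj_onI)
      fix p q
      assume pq: "p \<in> (SIGMA T':subsets_of_card T l. {\<rho> \<in> colour_bijections. T' \<subseteq> copy \<rho>})"
        "q \<in> (SIGMA T':subsets_of_card T l. {\<rho> \<in> colour_bijections. T' \<subseteq> copy \<rho>})" and eq: "?f p = ?f q"
      obtain T1 \<rho>1 where p: "p = (T1, \<rho>1)" "T1 \<subseteq> copy \<rho>1" using pq(1) by blast
      obtain T2 \<rho>2 where q: "q = (T2, \<rho>2)" "T2 \<subseteq> copy \<rho>2" using pq(2) by blast
      have conj: "{e \<in> P. \<rho>1 ` e \<in> T1} = {e \<in> P. \<rho>2 ` e \<in> T2} \<and> \<rho>1 = \<rho>2" 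
        using eq unfolding p(1) q(1) prod.case prod.inject .
      note eqs = conjunct1[OF conj] conjunct2[OF conj]
      have "T1 = (`) \<rho>1 ` {e \<in> P. \<rho>1 ` e \<in> T1}" by (rule img[OF p(2), symmetric])
      also have "\<dots> = T2" unfolding eqs(1) unfolding eqs(2) by (rule img[OF q(2)])
      finally show "p = q" using p q eqs(2) by simp
    qed
    show "?f ` (SIGMA T':subsets_of_card T l. {\<rho> \<in> colour_bijections. T' \<subseteq> copy \<rho>}) \<subseteq>
      (SIGMA J:{J \<in> Pow P. card J = l}. ?N J)"
    proof (rule image_subsetI)
      fix p assume "p \<in> (SIGMA T':subsets_of_card T l. {\<rho> \<in> colour_bijections. T' \<subseteq> copy \<rho>})"
      then obtain T' \<rho> where p: "p = (T', \<rho>)" and T': "T' \<in> subsets_of_card T l" "T' \<subseteq> copy \<rho>"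
        and \<rho>: "\<rho> \<in> colour_bijections" by auto
      have bij: "bij_betw \<rho> {..<n} {1..n}" by (rule colour_bijectionsD[OF \<rho>])
      have "\<Union>{e \<in> P. \<rho> ` e \<in> T'} \<subseteq> {..<n}" using cyc(1) by blast
      then have "inj_on \<rho> (\<Union>{e \<in> P. \<rho> ` e \<in> T'})" using bij by (auto simp: bij_betw_def intro: inj_on_subset)
      then have "card {e \<in> P. \<rho> ` e \<in> T'} = card T'"
        using card_image[OF inj_on_image, of \<rho> "{e \<in> P. \<rho> ` e \<in> T'}"] img[OF T'(2)] by simp
      then show "?f p \<in> (SIGMA J:{J \<in> Pow P. card J = l}. ?N J)"
        using T' \<rho> p by (auto simp: subsets_of_card_def)
    qed
    show "finite (SIGMA J:{J \<in> Pow P. card J = l}. ?N J)"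
      using finite_colour_bijections by (intro finite_SigmaI) auto
  qed
  also have "card (SIGMA T':subsets_of_card T l. {\<rho> \<in> colour_bijections. T' \<subseteq> copy \<rho>}) =
      (\<Sum>T'\<in>subsets_of_card T l. card {\<rho> \<in> colour_bijections. T' \<subseteq> copy \<rho>})"
    using finT finite_colour_bijections by (intro card_SigmaI) simp_all
  also have "card (SIGMA J:{J \<in> Pow P. card J = l}. ?N J) = (\<Sum>J\<in>{J \<in> Pow P. card J = l}. card (?N J))"
    using finite_colour_bijections by (intro card_SigmaI) simp_all
  finally have "(\<Sum>T'\<in>subsets_of_card T l. real (card {\<rho> \<in> colour_bijections. T' \<subseteq> copy \<rho>})) \<le>
    (\<Sum>J\<in>{J \<in> Pow P. card J = l}. real (card (?N J)))"
    by (simp flip: of_nat_sum)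
  also have "\<dots> = \<beta> ^ l * (\<Sum>J\<in>{J \<in> Pow P. card J = l}. x ^ card J * card (?N J))"
  proof -
    have "\<beta> ^ l * x ^ l = 1" using \<beta>_pos by (simp add: x_def power_divide)
    then show ?thesis by (simp add: sum_distrib_left mult.assoc[symmetric])
  qed
  also have "(\<Sum>J\<in>{J \<in> Pow P. card J = l}. x ^ card J * card (?N J)) \<le> (\<Sum>J\<in>Pow P. x ^ card J * card (?N J))"
    using x by (intro sum_mono2) auto
  also have "\<dots> \<le> card colour_bijections * exp (card T / sqrt m)"
    by (rule sum_mapping_into_le[OF finT copy_edge[OF \<sigma> subsetD[OF T]] card_neighbours_copy[OF \<sigma> T] x y])
  also have "\<dots> \<le> card colour_bijections * exp \<tau>" using \<tau> by (intro mult_left_mono) auto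
  finally show ?thesis using \<beta>_pos by (simp add: mult_ac)
qed

lemma colour_bijections_nonempty: "colour_bijections \<noteq> {}"
proof -
  let ?s = "restrict Suc {..<n}"
  have "bij_betw Suc {..<n} {1..n}" by (rule bij_betw_byWitness[where f' = "\<lambda>y. y - 1"]) auto
  then have "bij_betw ?s {..<n} {1..n}" by (subst bij_betw_cong[of _ _ Suc]) auto
  then have "?s \<in> colour_bijections" unfolding colour_bijections_def by auto
  then show ?thesis by blast
qed

lemma card_no_copy_le:
  assumes r: "r * w \<le> card (complete_edges n)" "real (k * n + 1) \<le> sqrt m ^ r" and w: "w > 0"
    and \<eta>: "\<eta> = \<beta> * card (complete_edges n) / w" "exp 1 * \<eta> \<le> 1 / 2"
  shows "card {U \<in> subsets_of_card (complete_edges n) (r * w). \<not> (\<exists>\<sigma>\<in>colour_bijections. copy \<sigma> \<subseteq> U)} \<le>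
    real (card (complete_edges n) choose (r * w)) * (r * (2 * exp 1 * \<eta>))"
proof -
  \<comment> \<open>The summand 1 makes the bound on the size of a copy strict. The maximum keeps
    the thresholds at least 1 and preserves the decay by \<open>sqrt m\<close> per round.\<close>
  define \<tau> where "\<tau> i = max 1 (real (k * n + 1) / sqrt m ^ i)" for i
  have m1: "sqrt m \<ge> 1" using m by simp
  have \<tau>_step: "\<tau> i / sqrt m \<le> \<tau> (Suc i)" for i
  proof -
    have "max 1 z / sqrt m \<le> max 1 (z / sqrt m)" for z
    proof (cases "z \<ge> 1")
      case False
      then have "max 1 z / sqrt m \<le> 1" using m1 by (simp add: max_def)
      then show ?thesis by simp
    qed (simp add: max_def)
    from this[of "real (k * n + 1) / sqrt m ^ i"] show ?thesis by (simp add: \<tau>_def mult.commute)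
  qed
  have finX: "finite (complete_edges n)"
    by (rule finite_subset[of _ "Pow {1..n}"]) (auto simp: complete_edges_def)
  have spread: "(\<Sum>T'\<in>subsets_of_card T l. real (card {\<sigma> \<in> colour_bijections. T' \<subseteq> copy \<sigma>})) \<le>
      \<beta> ^ l * exp (\<tau> (Suc i)) * card colour_bijections"
    if "\<sigma> \<in> colour_bijections" "T \<subseteq> copy \<sigma>" "real (card T) < \<tau> i" for i \<sigma> T l
  proof (rule copy_spread[OF that(1,2)])
    have "card T / sqrt m \<le> \<tau> i / sqrt m" using that(3) m1 by (intro divide_right_mono) auto
    then show "card T / sqrt m \<le> \<tau> (Suc i)" using \<tau>_step[of i] by linarith
  qed
  show ?thesis
  proof (rule card_uncovered_le[where \<tau> = \<tau> and \<beta> = \<beta>])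
    show "real (card (copy \<sigma>)) < \<tau> 0" for \<sigma>
    proof -
      have "real (card (copy \<sigma>)) \<le> real (k * n)" using card_copy_le[of \<sigma>] by (simp only: of_nat_le_iff)
      then show ?thesis by (simp add: \<tau>_def)
    qed
    show "\<tau> r \<le> 1" using r(2) m1 by (simp add: \<tau>_def)
  qed (use finite_colour_bijections finX colour_bijections_nonempty copy_subset_complete spread \<beta>_pos w \<eta> r
       in \<open>auto simp: \<tau>_def\<close>)
qed

section \<open>The host graph\<close>

lemma window_of_close:
  assumes "i < n" "j < n" "i \<le> j + s" "j \<le> i + s" shows "j \<in> window n s i"
  unfolding window_def
  by (rule image_eqI[of _ _ "int j - int i"]) (use assms in auto)

text \<open>The radius is 2 m + k + 2 m: from a vertex to its position in the copy, along an edge of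
  the cycle power, and back to a vertex, clusters being shorter than 2 m. Offset 0 also puts
  singletons into the host; they are never presented.\<close>

definition host :: "nat set set" where
  "host = (\<Union>u\<in>{..<n}. (\<lambda>v. {Suc u, Suc v}) ` window n (4 * m + k) u)"

lemma finite_host: "finite host"
  using card_window by (auto simp: host_def)

lemma card_host_le: "card host \<le> n * ((2 * k + 9) * m)"
proof -
  have "card host \<le> (\<Sum>u<n. card ((\<lambda>v. {Suc u, Suc v}) ` window n (4 * m + k) u))"
    unfolding host_def by (rule card_UN_le) simp
  also have "\<dots> \<le> (\<Sum>u<n. (2 * k + 9) * m)"
  proof (rule sum_mono)
    fix u
    have "card ((\<lambda>v. {Suc u, Suc v}) ` window n (4 * m + k) u) \<le> 2 * (4 * m + k) + 1"
      using card_window[of n "4 * m + k" u] by (meson card_image_le le_trans)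
    also have "\<dots> \<le> (2 * k + 9) * m"
    proof -
      have "(2 * k + 1) * 1 \<le> (2 * k + 1) * m" using m by (intro mult_left_mono) auto
      then show ?thesis by (simp add: algebra_simps)
    qed
    finally show "card ((\<lambda>v. {Suc u, Suc v}) ` window n (4 * m + k) u) \<le> (2 * k + 9) * m" .
  qed
  finally show ?thesis by simp
qed

lemma copy_subset_host:
  assumes \<sigma>: "\<sigma> \<in> colour_bijections" shows "copy \<sigma> \<subseteq> host"
proof
  fix e assume "e \<in> copy \<sigma>"
  then obtain f where f: "f \<in> P" "e = \<sigma> ` f" by (auto simp: copy_def)
  then obtain i j where ij: "f = {i, j}" using cyc(2)[OF f(1)] by (auto simp: card_2_iff)
  then have lt: "i < n" "j < n" using cyc(1)[OF f(1)] by auto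
  have pos: "\<sigma> x \<in> {1..n}" "cluster (\<sigma> x - 1) = cluster x" if "x < n" for x
    using colour_bijectionsD[OF \<sigma>] that by (auto simp: bij_betw_def)
  have w: "\<sigma> x - 1 < n \<and> \<sigma> x - 1 \<in> window n (2 * m) x \<and> x \<in> window n (2 * m) (\<sigma> x - 1)" if "x < n" for x
  proof -
    have lt: "\<sigma> x - 1 < n" using pos[OF that] by auto
    have "\<sigma> x - 1 \<in> window n (2 * m) x"
      using cluster_interval[OF lt] cluster_interval[OF that] pos(2)[OF that] that lt
      by (intro window_of_close) auto
    then show ?thesis using window_sym[OF that] lt by simp
  qed
  have n0: "n > 0" using lt by simp
  have "j \<in> window n k i" using cycle_power_window[OF nk k1 f(1)] ij by simp
  then have "\<sigma> j - 1 \<in> window n (2 * m + k + 2 * m) (\<sigma> i - 1)"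
    using window_trans[OF n0] w[OF lt(1)] w[OF lt(2)] by blast
  then have mem: "\<sigma> j - 1 \<in> window n (4 * m + k) (\<sigma> i - 1)" by (simp add: add.commute)
  have eq: "e = {Suc (\<sigma> i - 1), Suc (\<sigma> j - 1)}" using f ij pos(1)[OF lt(1)] pos(1)[OF lt(2)] by auto
  show "e \<in> host"
    unfolding host_def
  proof (rule UN_I)
    show "\<sigma> i - 1 \<in> {..<n}" using w[OF lt(1)] by simp
    show "e \<in> (\<lambda>v. {Suc (\<sigma> i - 1), Suc v}) ` window n (4 * m + k) (\<sigma> i - 1)"
      unfolding eq using mem by (rule imageI)
  qed
qed

text \<open>The order of the vertices in the copy is a Hamilton cycle. A walk of length at most
  \<open>k\<close> on it shifts the position by at most \<open>k\<close> modulo \<open>n\<close>, so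
  its ends form an edge of the copy.\<close>

lemma copy_contains:
  assumes \<sigma>: "\<sigma> \<in> colour_bijections" and U: "copy \<sigma> \<subseteq> U"
  shows "contains_hamilton_cycle_power k n U"
proof -
  have bij: "bij_betw \<sigma> {..<n} {1..n}" by (rule colour_bijectionsD[OF \<sigma>])
  define vs where "vs = map \<sigma> [0..<n]"
  have n0: "n > 0" using nk by simp
  have vs: "vs ! i = \<sigma> i" if "i < n" for i using that by (simp add: vs_def)
  have perm: "vs \<in> permutations_of_set {1..n}"
    using bij by (auto simp: permutations_of_set_def vs_def distinct_map bij_betw_def atLeast0LessThan)
  define Cy where "Cy = {{vs ! i, vs ! (Suc i mod n)} | i. i < n}"
  have ham: "hamilton_cycle n Cy"
    unfolding hamilton_cycle_def Cy_def using perm nk k2 by auto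
  \<comment> \<open>The case \<open>u = v\<close> covers the walk of length 0, which exists also at
    numbers that are not vertices of the cycle.\<close>
  have walk: "u = v \<or> (\<exists>a b d. a < n \<and> b < n \<and> u = \<sigma> a \<and> v = \<sigma> b \<and> \<bar>d\<bar> \<le> int i \<and> int b = (int a + d) mod int n)"
    if "(u, v) \<in> adj Cy ^^ i" for u v i
    using that
  proof (induction i arbitrary: v)
    case (Suc i)
    then obtain z where z: "(u, z) \<in> adj Cy ^^ i" "(z, v) \<in> adj Cy" by auto
    obtain a0 where a0: "a0 < n" "{z, v} = {\<sigma> a0, \<sigma> (Suc a0 mod n)}"
      using z(2) n0 by (auto simp: adj_def Cy_def vs)
    have suc: "int (Suc a0 mod n) = (int a0 + 1) mod int n" by (simp add: zmod_int add.commute)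
    have suc': "int a0 = (int (Suc a0 mod n) + (- 1)) mod int n" using a0(1) by (simp add: suc mod_simps)
    obtain p q d where pq: "p < n" "q < n" "z = \<sigma> p" "v = \<sigma> q" "\<bar>d\<bar> \<le> 1" "int q = (int p + d) mod int n"
    proof (cases "z = \<sigma> a0 \<and> v = \<sigma> (Suc a0 mod n)")
      case True
      then show ?thesis using that[of a0 "Suc a0 mod n" 1] a0(1) suc n0 by simp
    next
      case False
      then have "v = \<sigma> a0 \<and> z = \<sigma> (Suc a0 mod n)" using a0(2) by (auto simp: doubleton_eq_iff)
      then show ?thesis using that[of "Suc a0 mod n" a0 "- 1"] a0(1) suc' n0 by simp
    qed
    from Suc.IH[OF z(1)] show ?case
    proof (elim disjE exE conjE)
      assume "u = z"
      then show ?thesis using pq by (intro disjI2 exI[of _ p] exI[of _ q] exI[of _ d]) auto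
    next
      fix a b d' assume h: "a < n" "b < n" "u = \<sigma> a" "z = \<sigma> b" "\<bar>d'\<bar> \<le> int i" "int b = (int a + d') mod int n"
      have "b = p" using h pq bij by (auto simp: bij_betw_def inj_on_def)
      then have "int q = (int a + (d' + d)) mod int n" using h pq by (simp add: mod_simps add.assoc)
      then show ?thesis using h pq by (intro disjI2 exI[of _ a] exI[of _ q] exI[of _ "d' + d"]) auto
    qed
  qed simp
  have "graph_power k Cy \<subseteq> copy \<sigma>"
  proof
    fix e assume "e \<in> graph_power k Cy"
    then obtain u v where e: "e = {u, v}" "u \<noteq> v" "graph_dist Cy u v \<le> enat k"
      by (auto simp: graph_power_def)
    let ?I = "{i. (u, v) \<in> adj Cy ^^ i}"
    have "enat ` ?I \<noteq> {}"
    proof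
      assume "enat ` ?I = {}"
      then have "graph_dist Cy u v = \<infinity>" by (simp add: graph_dist_def top_enat_def)
      then show False using e(3) by simp
    qed
    \<comment> \<open>A finite distance is attained by a walk, since a nonempty set of
      \<open>enat\<close> has a least element.\<close>
    then have "Inf (enat ` ?I) \<in> enat ` ?I" by (metis Inf_enat_def LeastI_ex equals0I)
    then obtain i where i: "(u, v) \<in> adj Cy ^^ i" "graph_dist Cy u v = enat i"
      by (auto simp: graph_dist_def)
    then have "i \<le> k" using e(3) by simp
    obtain a b d where ab: "a < n" "b < n" "u = \<sigma> a" "v = \<sigma> b" "\<bar>d\<bar> \<le> int k" "int b = (int a + d) mod int n"
    proof -
      obtain a b d where ab: "a < n" "b < n" "u = \<sigma> a" "v = \<sigma> b" "\<bar>d\<bar> \<le> int i" "int b = (int a + d) mod int n"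
        using walk[OF i(1)] e(2) by blast
      moreover have "\<bar>d\<bar> \<le> int k" using ab(5) \<open>i \<le> k\<close> by linarith
      ultimately show ?thesis using that by blast
    qed
    have "d \<noteq> 0"
    proof
      assume "d = 0"
      then have "int b = int a" using ab by simp
      then show False using ab e(2) by simp
    qed
    then consider "d > 0" | "d < 0" by linarith
    then have "{a, b} \<in> P"
    proof cases
      case 1
      then have "int b = int ((a + nat d) mod n)" using ab by (simp add: zmod_int)
      then have "b = (a + nat d) mod n" by (simp only: of_nat_eq_iff)
      then show ?thesis using 1 ab unfolding cycle_power_def by (intro CollectI exI[of _ a] exI[of _ "nat d"]) auto
    next
      case 2
      have "int ((b + nat (- d)) mod n) = (int b + - d) mod int n" using 2 by (simp add: zmod_int)
      also have "\<dots> = int a" using ab by (simp add: mod_simps)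
      finally have "a = (b + nat (- d)) mod n" by (simp only: of_nat_eq_iff)
      then show ?thesis using 2 ab unfolding cycle_power_def
        by (intro CollectI exI[of _ b] exI[of _ "nat (- d)"]) auto
    qed
    then show "e \<in> copy \<sigma>" using e ab unfolding copy_def by (intro image_eqI[of _ _ "{a, b}"]) auto
  qed
  then show ?thesis using ham U unfolding contains_hamilton_cycle_power_def by blast
qed

end

section \<open>The strategy\<close>

text \<open>Every u-set is the set of the first u entries of equally many orders, namely u! (N -
  u)!.\<close>

lemma prob_set_take_permutation:
  assumes fin: "finite X" and u: "u \<le> card X"
  shows "measure_pmf.prob (pmf_of_set (permutations_of_set X)) {es. Q (set (take u es))} =
    card {U \<in> subsets_of_card X u. Q U} / (card X choose u)"
proof -
  define fib where "fib U = {es \<in> permutations_of_set X. set (take u es) = U}" for U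
  have finp: "finite (permutations_of_set X)" using fin by simp
  have ne: "permutations_of_set X \<noteq> {}" using fin by simp
  have card_fib: "card (fib U) = fact u * fact (card X - u)" if U: "U \<in> subsets_of_card X u" for U
  proof -
    have UX: "U \<subseteq> X" "card U = u" "finite U" using U fin by (auto simp: subsets_of_card_def finite_subset)
    have "bij_betw (\<lambda>(as, bs). as @ bs) (permutations_of_set U \<times> permutations_of_set (X - U)) (fib U)"
    proof (rule bij_betw_byWitness[where f' = "\<lambda>es. (take u es, drop u es)"])
      show "\<forall>p\<in>permutations_of_set U \<times> permutations_of_set (X - U).
          (\<lambda>es. (take u es, drop u es)) ((\<lambda>(as, bs). as @ bs) p) = p"
        using UX by (auto simp: length_finite_permutations_of_set)
      show "(\<lambda>(as, bs). as @ bs) ` (permutations_of_set U \<times> permutations_of_set (X - U)) \<subseteq> fib U"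
      proof (rule image_subsetI)
        fix p assume "p \<in> permutations_of_set U \<times> permutations_of_set (X - U)"
        then obtain as bs where p: "p = (as, bs)" "as \<in> permutations_of_set U" "bs \<in> permutations_of_set (X - U)"
          by auto
        have "length as = u" using p(2) UX length_finite_permutations_of_set by metis
        then show "(\<lambda>(as, bs). as @ bs) p \<in> fib U"
          using p UX by (auto simp: fib_def permutations_of_set_def)
      qed
      show "(\<lambda>es. (take u es, drop u es)) ` fib U \<subseteq> permutations_of_set U \<times> permutations_of_set (X - U)"
      proof (rule image_subsetI)
        fix es assume es: "es \<in> fib U"
        then have d: "distinct es" "set es = X" "set (take u es) = U"
          by (auto simp: fib_def permutations_of_set_def)
        have "set (drop u es) = X - U"
          using d set_take_disj_set_drop_if_distinct[OF d(1), of u u] set_append[of "take u es" "drop u es"] by auto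
        then show "(take u es, drop u es) \<in> permutations_of_set U \<times> permutations_of_set (X - U)"
          using d by (simp add: permutations_of_set_def)
      qed
    qed simp
    from bij_betw_same_card[OF this]
    have "card (fib U) = card (permutations_of_set U \<times> permutations_of_set (X - U))" by simp
    also have "\<dots> = fact u * fact (card X - u)"
      using UX fin by (simp add: card_cartesian_product card_Diff_subset)
    finally show ?thesis .
  qed
  have in_sub: "set (take u es) \<in> subsets_of_card X u" if "es \<in> permutations_of_set X" for es
    using that u by (auto simp: subsets_of_card_def permutations_of_set_def distinct_card dest: in_set_takeD)
  let ?G = "{U \<in> subsets_of_card X u. Q U}"
  have "permutations_of_set X \<inter> {es. Q (set (take u es))} = (\<Union>U\<in>?G. fib U)"
    using in_sub by (auto simp: fib_def)
  also have "card \<dots> = (\<Sum>U\<in>?G. card (fib U))"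
    using fin finp by (intro card_UN_disjoint) (auto simp: fib_def)
  also have "\<dots> = card ?G * (fact u * fact (card X - u))"
    using card_fib by simp
  finally have "measure_pmf.prob (pmf_of_set (permutations_of_set X)) {es. Q (set (take u es))} =
    real (card ?G) * (fact u * fact (card X - u)) / fact (card X)"
    using finp ne fin by (simp add: measure_pmf_of_set)
  also have "\<dots> = card ?G / (card X choose u)"
    using u by (simp add: binomial_fact field_simps)
  finally show ?thesis .
qed

text \<open>Markov's inequality: a given element of \<open>X\<close> lies in a proportion t / card X
  of the t-subsets, and elements of \<open>H\<close> outside \<open>X\<close> lie in none.\<close>

lemma card_large_intersection_le:
  assumes fin: "finite X" "finite H" and t: "1 \<le> t" "t \<le> card X"
  shows "real b * card {U \<in> subsets_of_card X t. b < card (H \<inter> U)} \<le>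
    card H * real t / card X * (card X choose t)"
proof -
  let ?G = "{U \<in> subsets_of_card X t. b < card (H \<inter> U)}"
  have finU: "finite U" if "U \<in> subsets_of_card X t" for U
    using that fin by (auto simp: subsets_of_card_def finite_subset)
  have "b * card ?G = (\<Sum>U\<in>?G. b)" by simp
  also have "\<dots> \<le> (\<Sum>U\<in>?G. card (H \<inter> U))" by (intro sum_mono) auto
  also have "\<dots> \<le> (\<Sum>U\<in>subsets_of_card X t. card (H \<inter> U))"
    using fin by (intro sum_mono2) auto
  also have "\<dots> = card (SIGMA U:subsets_of_card X t. H \<inter> U)"
    using fin by (subst card_SigmaI) auto
  also have "\<dots> \<le> card (H \<times> subsets_of_card X t \<inter> {(e, U). e \<in> U})"
    by (rule card_inj_on_le[of "\<lambda>(U, e). (e, U)"]) (use fin in \<open>auto simp: inj_on_def\<close>)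
  also have "H \<times> subsets_of_card X t \<inter> {(e, U). e \<in> U} = (SIGMA e:H. {U \<in> subsets_of_card X t. e \<in> U})"
    by auto
  also have "card \<dots> = (\<Sum>e\<in>H. card {U \<in> subsets_of_card X t. e \<in> U})"
    using fin by (subst card_SigmaI) auto
  also have "\<dots> \<le> (\<Sum>e\<in>H. (card X - 1) choose (t - 1))"
  proof (rule sum_mono)
    fix e
    show "card {U \<in> subsets_of_card X t. e \<in> U} \<le> (card X - 1) choose (t - 1)"
    proof (cases "e \<in> X")
      case True
      have "card {U \<in> subsets_of_card X t. e \<in> U} \<le> card (subsets_of_card (X - {e}) (t - 1))"
      proof (rule card_inj_on_le[of "\<lambda>U. U - {e}"])
        show "inj_on (\<lambda>U. U - {e}) {U \<in> subsets_of_card X t. e \<in> U}"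
          by (rule inj_onI) blast
        show "(\<lambda>U. U - {e}) ` {U \<in> subsets_of_card X t. e \<in> U} \<subseteq> subsets_of_card (X - {e}) (t - 1)"
        proof (rule image_subsetI)
          fix U assume U: "U \<in> {U \<in> subsets_of_card X t. e \<in> U}"
          then have "card (U - {e}) = t - 1" by (simp add: subsets_of_card_def card_Diff_singleton)
          then show "U - {e} \<in> subsets_of_card (X - {e}) (t - 1)"
            using U by (auto simp: subsets_of_card_def)
        qed
      qed (use fin in simp)
      also have "\<dots> = (card X - 1) choose (t - 1)" using True fin by (simp add: card_subsets_of_card)
      finally show ?thesis .
    next
      case False
      then have "{U \<in> subsets_of_card X t. e \<in> U} = {}" by (auto simp: subsets_of_card_def)
      then show ?thesis by (simp only: card.empty)
    qed
  qed
  finally have "b * card ?G \<le> card H * ((card X - 1) choose (t - 1))" by simp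
  then have "real (b * card ?G) \<le> real (card H * ((card X - 1) choose (t - 1)))" by (simp only: of_nat_le_iff)
  also have "\<dots> = card H * real t / card X * (card X choose t)"
  proof -
    have "t * (card X choose t) = card X * ((card X - 1) choose (t - 1))"
      using t times_binomial_minus1_eq[of t "card X"] by simp
    then have "real t * (card X choose t) = card X * ((card X - 1) choose (t - 1))"
      by (metis of_nat_mult)
    then show ?thesis using t by (simp add: field_simps)
  qed
  finally show ?thesis by simp
qed

text \<open>The test on the number of purchases makes the budget hold in every outcome, so an
  overrun can only cost success probability.\<close>

definition greedy_strategy :: "edge set \<Rightarrow> nat \<Rightarrow> strategy" where
  "greedy_strategy H b h e = return_pmf (e \<in> H \<and> card (purchased h) < b)"

lemma play_greedy_Cons:
  "play (greedy_strategy H b) h (e # es) =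
    play (greedy_strategy H b) (h @ [(e, e \<in> H \<and> card (purchased h) < b)]) es"
  by (simp add: greedy_strategy_def[of H b h e] bind_return_pmf)

lemma purchased_append: "purchased (h @ [(e, d)]) = (if d then insert e (purchased h) else purchased h)"
  by (auto simp: purchased_def)

lemma purchased_Nil [simp]: "purchased [] = {}"
  by (simp add: purchased_def)

lemma finite_purchased: "finite (purchased h)"
proof -
  have "purchased h \<subseteq> fst ` set h" by (force simp: purchased_def)
  then show ?thesis by (rule finite_subset) simp
qed

lemma play_greedy_budget:
  assumes "h' \<in> set_pmf (play (greedy_strategy H b) h es)" "card (purchased h) \<le> b"
  shows "card (purchased h') \<le> b"
  using assms
proof (induction es arbitrary: h)
  case (Cons e es)
  let ?d = "e \<in> H \<and> card (purchased h) < b"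
  have "h' \<in> set_pmf (play (greedy_strategy H b) (h @ [(e, ?d)]) es)"
    using Cons.prems(1) by (simp only: play_greedy_Cons)
  moreover have "card (purchased (h @ [(e, ?d)])) \<le> b"
    using Cons.prems(2) by (simp add: purchased_append card_insert_if finite_purchased)
  ultimately show ?case by (rule Cons.IH)
qed simp

lemma play_greedy_purchased:
  assumes "h' \<in> set_pmf (play (greedy_strategy H b) h es)" "card (purchased h \<union> (H \<inter> set es)) \<le> b"
  shows "purchased h' = purchased h \<union> (H \<inter> set es)"
  using assms
proof (induction es arbitrary: h)
  case (Cons e es)
  let ?d = "e \<in> H \<and> card (purchased h) < b"
  have "purchased (h @ [(e, ?d)]) \<union> (H \<inter> set es) = purchased h \<union> (H \<inter> set (e # es))"
  proof (cases "e \<in> H \<and> \<not> card (purchased h) < b")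
    case True
    \<comment> \<open>If a host edge is refused, the purchases have already reached size
      \<open>b\<close>. The right-hand side has at most \<open>b\<close> elements and hence is no
      larger, so the refused edge is among the purchases.\<close>
    have "purchased h = purchased h \<union> (H \<inter> set (e # es))"
      using True Cons.prems(2) finite_purchased by (intro card_seteq) auto
    then have "e \<in> purchased h" using True by auto
    then show ?thesis using True by (auto simp: purchased_append)
  qed (auto simp: purchased_append)
  moreover have "h' \<in> set_pmf (play (greedy_strategy H b) (h @ [(e, ?d)]) es)"
    using Cons.prems(1) by (simp only: play_greedy_Cons)
  ultimately show ?case using Cons.IH[of "h @ [(e, ?d)]"] Cons.prems(2) by simp
qed simp

lemma tb_strategy_greedy: "tb_strategy n t b (greedy_strategy H b)"
  unfolding tb_strategy_def builder_graph_def using play_greedy_budget[of _ H b "[]"] by auto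

section \<open>Success probability of the greedy strategy\<close>

lemma finite_complete_edges: "finite (complete_edges n)"
  by (rule finite_subset[of _ "Pow {1..n}"]) (auto simp: complete_edges_def)

lemma card_complete_edges: "card (complete_edges n) = n choose 2"
  by (simp add: complete_edges_def n_subsets)

text \<open>Couple the order with the purchased graph on one space; the event on orders then implies
  the event on graphs almost surely.\<close>

lemma prob_builder_graph_ge:
  assumes "\<And>es B. es \<in> permutations_of_set (complete_edges n) \<Longrightarrow> G es \<Longrightarrow>
      B \<in> purchased ` set_pmf (play S [] (take t es)) \<Longrightarrow> Q B"
  shows "measure_pmf.prob (pmf_of_set (permutations_of_set (complete_edges n))) {es. G es} \<le>
    measure_pmf.prob (builder_graph n t S) {B. Q B}"
proof -
  let ?p = "pmf_of_set (permutations_of_set (complete_edges n))"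
  let ?f = "\<lambda>es. map_pmf purchased (play S [] (take t es))"
  define J where "J = bind_pmf ?p (\<lambda>es. map_pmf (Pair es) (?f es))"
  have set_p: "set_pmf ?p = permutations_of_set (complete_edges n)"
    using finite_complete_edges by (intro set_pmf_of_set) auto
  have "map_pmf fst J = ?p"
    by (simp add: J_def map_bind_pmf map_pmf_comp map_pmf_const bind_return_pmf')
  moreover have "map_pmf snd J = builder_graph n t S"
    by (simp add: J_def builder_graph_def map_bind_pmf map_pmf_comp)
  moreover have "measure_pmf.prob J (fst -` {es. G es}) \<le> measure_pmf.prob J (snd -` {B. Q B})"
  proof (rule measure_pmf.finite_measure_mono_AE)
    show "AE x in J. x \<in> fst -` {es. G es} \<longrightarrow> x \<in> snd -` {B. Q B}"
      using assms set_p by (auto simp: AE_measure_pmf_iff J_def)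
  qed simp
  ultimately show ?thesis by (metis measure_map_pmf)
qed

context cluster_cycle
begin

text \<open>Two things can go wrong: no copy lies in the first \<open>r * w\<close> edges, or more
  than \<open>b\<close> host edges are presented. Otherwise all presented host edges are bought,
  among them a whole copy.\<close>

lemma prob_greedy_ge:
  fixes r w t b :: nat and \<eta> :: real
  assumes r: "r * w \<le> t" "real (k * n + 1) \<le> sqrt m ^ r" and w: "w > 0" and t: "1 \<le> t" "t \<le> n choose 2"
    and \<eta>: "\<eta> = \<beta> * (n choose 2) / w" "exp 1 * \<eta> \<le> 1 / 2" and b: "b > 0"
  shows "measure_pmf.prob (builder_graph n t (greedy_strategy host b)) {B. contains_hamilton_cycle_power k n B} \<ge>
    1 - r * (2 * exp 1 * \<eta>) - (n * ((2 * k + 9) * m)) * real t / ((n choose 2) * real b)"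
proof -
  let ?X = "complete_edges n" and ?p = "pmf_of_set (permutations_of_set (complete_edges n))"
  let ?G = "\<lambda>es. (\<exists>\<sigma>\<in>colour_bijections. copy \<sigma> \<subseteq> set (take (r * w) es)) \<and> card (host \<inter> set (take t es)) \<le> b"
  let ?A = "{es. \<not> (\<exists>\<sigma>\<in>colour_bijections. copy \<sigma> \<subseteq> set (take (r * w) es))}"
  let ?B = "{es. b < card (host \<inter> set (take t es))}"
  have finX: "finite ?X" by (rule finite_complete_edges)
  have cX: "card ?X = n choose 2" by (rule card_complete_edges)
  have rwX: "r * w \<le> card ?X" using r t cX by simp
  have A: "measure_pmf.prob ?p ?A \<le> r * (2 * exp 1 * \<eta>)"
  proof -
    have "measure_pmf.prob ?p ?A =
      card {U \<in> subsets_of_card ?X (r * w). \<not> (\<exists>\<sigma>\<in>colour_bijections. copy \<sigma> \<subseteq> U)} / (card ?X choose (r * w))"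
      by (rule prob_set_take_permutation[OF finX rwX])
    also have "\<dots> \<le> r * (2 * exp 1 * \<eta>)"
      using card_no_copy_le[OF rwX r(2) w, of \<eta>] \<eta> cX rwX by (simp add: divide_le_eq mult.commute)
    finally show ?thesis .
  qed
  have B: "measure_pmf.prob ?p ?B \<le> (n * ((2 * k + 9) * m)) * real t / ((n choose 2) * real b)"
  proof -
    have tX: "t \<le> card ?X" using t cX by simp
    have "measure_pmf.prob ?p ?B =
      card {U \<in> subsets_of_card ?X t. b < card (host \<inter> U)} / (card ?X choose t)"
      by (rule prob_set_take_permutation[OF finX tX])
    also have "\<dots> = real b * card {U \<in> subsets_of_card ?X t. b < card (host \<inter> U)} /
        (real b * (card ?X choose t))"
      using b by simp
    also have "\<dots> \<le> card host * real t / card ?X * (card ?X choose t) / (real b * (card ?X choose t))"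
      by (intro divide_right_mono card_large_intersection_le[OF finX finite_host t(1) tX]) simp
    also have "\<dots> = card host * real t / ((n choose 2) * real b)"
      using tX cX by simp
    also have "\<dots> \<le> (n * ((2 * k + 9) * m)) * real t / ((n choose 2) * real b)"
      using card_host_le by (intro divide_right_mono mult_right_mono) (auto simp only: of_nat_le_iff, simp_all)
    finally show ?thesis .
  qed
  have "measure_pmf.prob ?p (- {es. ?G es}) \<le> measure_pmf.prob ?p (?A \<union> ?B)"
    by (intro measure_pmf.finite_measure_mono) auto
  also have "\<dots> \<le> measure_pmf.prob ?p ?A + measure_pmf.prob ?p ?B"
    by (rule measure_Un_le) simp_all
  finally have "1 - measure_pmf.prob ?p {es. ?G es} \<le> measure_pmf.prob ?p ?A + measure_pmf.prob ?p ?B"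
    using measure_pmf.prob_compl[of "{es. ?G es}" ?p] by (simp add: Compl_eq_Diff_UNIV)
  moreover have "measure_pmf.prob ?p {es. ?G es} \<le>
    measure_pmf.prob (builder_graph n t (greedy_strategy host b)) {B. contains_hamilton_cycle_power k n B}"
  proof (rule prob_builder_graph_ge)
    fix es B assume G: "?G es" and "B \<in> purchased ` set_pmf (play (greedy_strategy host b) [] (take t es))"
    then obtain h where h: "h \<in> set_pmf (play (greedy_strategy host b) [] (take t es))" "B = purchased h" by auto
    have B: "B = host \<inter> set (take t es)"
      using play_greedy_purchased[OF h(1)] G h(2) by simp
    obtain \<sigma> where \<sigma>: "\<sigma> \<in> colour_bijections" "copy \<sigma> \<subseteq> set (take (r * w) es)" using G by auto
    have "set (take (r * w) es) \<subseteq> set (take t es)" using r(1) by (rule set_take_subset_set_take)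
    then have "copy \<sigma> \<subseteq> B" using \<sigma> copy_subset_host B by auto
    then show "contains_hamilton_cycle_power k n B" using copy_contains \<sigma>(1) by blast
  qed
  ultimately show ?thesis using A B by linarith
qed

end

section \<open>Parameters\<close>

text \<open>Its logarithm is o(ln n), so it does not affect the exponent of the budget, yet each of
  its positive powers beats every power of ln n.\<close>

definition slack :: "nat \<Rightarrow> real" where
  "slack n = exp (sqrt (ln (real n)))"

text \<open>\<open>(n choose 2) / t\<close> is the inverse density 1 / p. The error of a round is
  governed by m^(-1/k) / p, so this choice leaves \<open>slack\<close> to the power -1 / k. At the
  cap \<open>n\<close> there is a single cluster.\<close>

definition cluster_size :: "nat \<Rightarrow> nat \<Rightarrow> nat \<Rightarrow> nat" where
  "cluster_size k n t = min n (nat \<lceil>(real (n choose 2) / t) ^ k * slack n\<rceil>)"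

text \<open>The r-th power of \<open>sqrt m\<close> has to exceed k n + 1. For m = n this holds with
  r = 3 once sqrt n \<ge> k + 1. Otherwise sqrt m \<ge> exp (sqrt (ln n) / 2), and 4 sqrt (ln n)
  rounds multiply this to n^2.\<close>

definition rounds :: "nat \<Rightarrow> nat \<Rightarrow> nat \<Rightarrow> nat" where
  "rounds k n t = (if cluster_size k n t = n then 3 else nat \<lceil>4 * sqrt (ln (real n))\<rceil> + 1)"

text \<open>One factor \<open>slack\<close> comes from the cluster size, the other is the margin for
  Markov's inequality. With n^2 in place of \<open>n choose 2\<close>, multiplication by t^(k-1)
  gives a pure power of n times \<open>slack n ^ 2\<close>.\<close>

definition budget :: "nat \<Rightarrow> nat \<Rightarrow> nat \<Rightarrow> nat" where
  "budget k n t = nat \<lceil>real n * (real n ^ 2 / t) ^ (k - 1) * slack n ^ 2\<rceil>"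

lemma choose_two_le: "real (n choose 2) \<le> real n ^ 2"
proof -
  have "n * (n - 1) div 2 \<le> n * (n - 1)" by (rule div_le_dividend)
  also have "\<dots> \<le> n * n" by (rule mult_left_mono) simp_all
  finally have "n choose 2 \<le> n ^ 2" by (simp add: choose_two power2_eq_square)
  then show ?thesis by (metis of_nat_le_iff of_nat_power)
qed

lemma slack_ge_one: "n \<ge> 1 \<Longrightarrow> slack n \<ge> 1"
  by (simp add: slack_def)

lemma cluster_size_bounds:
  assumes "1 \<le> t" "t \<le> n choose 2" "n \<ge> 1"
  shows "1 \<le> cluster_size k n t" "cluster_size k n t \<le> n"
    "real (cluster_size k n t) \<le> 2 * (real (n choose 2) / t) ^ k * slack n"
    "cluster_size k n t \<noteq> n \<Longrightarrow> (real (n choose 2) / t) ^ k * slack n \<le> cluster_size k n t"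
proof -
  let ?z = "(real (n choose 2) / t) ^ k * slack n"
  have "1 \<le> (real (n choose 2) / t) ^ k" using assms by (intro one_le_power) simp
  then have "1 * 1 \<le> ?z" using slack_ge_one[OF assms(3)] by (intro mult_mono) auto
  then have z: "1 \<le> ?z" by simp
  define N where "N = nat \<lceil>?z\<rceil>"
  have "y \<le> real (nat \<lceil>y\<rceil>)" "1 \<le> y \<Longrightarrow> real (nat \<lceil>y\<rceil>) \<le> y + 1" for y :: real by linarith+
  then have nz: "?z \<le> real N" "real N \<le> ?z + 1" using z by (auto simp only: N_def)
  have cs: "cluster_size k n t = min n N" by (simp add: cluster_size_def N_def)
  have "1 \<le> real N" using nz(1) z by linarith
  then show "1 \<le> cluster_size k n t" using assms by (simp add: cs)
  show "cluster_size k n t \<le> n" by (simp add: cs)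
  have "real (cluster_size k n t) \<le> real N" by (simp add: cs)
  then have "real (cluster_size k n t) \<le> 2 * ?z" using nz z by linarith
  then show "real (cluster_size k n t) \<le> 2 * (real (n choose 2) / t) ^ k * slack n" by (simp only: mult.assoc)
  show "?z \<le> cluster_size k n t" if "cluster_size k n t \<noteq> n"
    using that nz(1) by (simp add: cs min_def split: if_splits)
qed

lemma rounds_enough:
  assumes n: "real n \<ge> (real k + 1) ^ 2" and t: "1 \<le> t" "t \<le> n choose 2"
  shows "real (k * n + 1) \<le> sqrt (cluster_size k n t) ^ rounds k n t"
proof -
  have "1 \<le> (real k + 1) ^ 2" by (intro one_le_power) simp
  then have n1: "n \<ge> 1" using n by linarith
  have kn: "real (k * n + 1) \<le> (real k + 1) * n" using n1 by (simp add: algebra_simps)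
  have sn: "real k + 1 \<le> sqrt n" using n by (intro real_le_rsqrt)
  have kn2: "(real k + 1) * n \<le> sqrt n * n" using sn by (intro mult_right_mono) auto
  note m = cluster_size_bounds[OF t n1, of k]
  show ?thesis
  proof (cases "cluster_size k n t = n")
    case True
    have "sqrt n ^ 3 = sqrt n * n" by (simp add: power3_eq_cube)
    then show ?thesis using True kn kn2 by (simp add: rounds_def)
  next
    case False
    let ?m = "cluster_size k n t" and ?L = "ln (real n)"
    have L: "?L \<ge> 0" using n1 by simp
    have "1 \<le> (real (n choose 2) / t) ^ k" using t by (intro one_le_power) simp
    then have "1 * slack n \<le> (real (n choose 2) / t) ^ k * slack n"
      by (intro mult_right_mono) (simp_all add: slack_def)
    then have g: "slack n \<le> ?m" using m(4)[OF False] by simp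
    have "rounds k n t = nat \<lceil>4 * sqrt ?L\<rceil> + 1" using False by (simp add: rounds_def)
    then have r: "4 * sqrt ?L \<le> real (rounds k n t)" by linarith
    have "real n ^ 2 = exp (2 * ?L)" using n1 by (simp add: exp_double)
    also have "2 * ?L = (4 * sqrt ?L) * (sqrt ?L / 2)" using L by simp
    also have "exp \<dots> \<le> exp (real (rounds k n t) * (sqrt ?L / 2))"
      using r L by (intro exp_le_cancel_iff[THEN iffD2] mult_right_mono) auto
    also have "\<dots> = exp (sqrt ?L / 2) ^ rounds k n t" by (rule exp_of_nat_mult)
    also have "\<dots> \<le> sqrt ?m ^ rounds k n t"
    proof (intro power_mono real_le_rsqrt)
      have "exp (sqrt ?L / 2) ^ 2 = slack n" by (simp add: slack_def exp_double[symmetric])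
      then show "exp (sqrt ?L / 2) ^ 2 \<le> ?m" using g by simp
    qed simp
    finally have "real n ^ 2 \<le> sqrt ?m ^ rounds k n t" .
    moreover have "sqrt n * n \<le> real n ^ 2"
    proof -
      have "sqrt n \<le> n" using n1 by (intro real_le_lsqrt) (auto simp: power2_eq_square)
      then show ?thesis by (simp add: power2_eq_square mult_right_mono)
    qed
    ultimately show ?thesis using kn kn2 by linarith
  qed
qed

text \<open>One summand for each regime, added so that a single limit covers both: 9 is the square
  of three rounds at m = n, and 4 sqrt (ln n) + 2 bounds the number of rounds otherwise.\<close>

definition round_error :: "nat \<Rightarrow> nat \<Rightarrow> real \<Rightarrow> real" where
  "round_error k n t = 9 * (real n powr (2 - 1 / k) / t) + (4 * sqrt (ln n) + 2)\<^sup>2 * exp (- sqrt (ln n) / k)"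

text \<open>One factor \<open>rounds\<close> counts the rounds, the other reflects that a round has
  only a share of the \<open>t\<close> edges. For m < n the k-th root of the cluster size cancels 1
  / p and leaves exp (- sqrt (ln n) / k).\<close>

lemma rounds_error_le:
  assumes n: "n \<ge> 1" and k: "k \<ge> 1" and t: "1 \<le> t" "t \<le> n choose 2"
  shows "real (rounds k n t) ^ 2 * (real (n choose 2) / (t * real (cluster_size k n t) powr (1 / k))) \<le> round_error k n t"
proof (cases "cluster_size k n t = n")
  case True
  have "real (n choose 2) / (t * real n powr (1 / k)) \<le> real n ^ 2 / (t * real n powr (1 / k))"
    by (intro divide_right_mono choose_two_le) simp
  also have "\<dots> = real n powr (2 - 1 / k) / t"
    using n by (simp add: powr_diff)
  finally have "9 * (real (n choose 2) / (t * real n powr (1 / k))) \<le> 9 * (real n powr (2 - 1 / k) / t)" by simp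
  also have "\<dots> \<le> round_error k n t" by (simp add: round_error_def)
  finally show ?thesis using True by (simp add: rounds_def)
next
  case False
  let ?m = "real (cluster_size k n t)" and ?q = "real (n choose 2) / t" and ?L = "ln (real n)"
  note m = cluster_size_bounds[OF t n, of k]
  have q: "?q \<ge> 1" using t by simp
  have L: "?L \<ge> 0" using n by simp
  have "(?q ^ k * slack n) powr (1 / k) \<le> ?m powr (1 / k)"
    using m(4)[OF False] q by (intro powr_mono2) (auto simp: slack_def)
  moreover have "(?q ^ k * slack n) powr (1 / k) = ?q * exp (sqrt ?L / k)"
  proof -
    have "(?q ^ k) powr (1 / k) = (?q powr k) powr (1 / k)" using q by (subst powr_realpow) linarith+
    also have "\<dots> = ?q powr (k * (1 / k))" by (rule powr_powr)
    also have "\<dots> = ?q" using q k by simp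
    finally have "(?q ^ k) powr (1 / k) = ?q" .
    moreover have "slack n powr (1 / k) = exp (sqrt ?L / k)" by (simp add: slack_def powr_def)
    ultimately show ?thesis using q by (subst powr_mult) (simp_all add: slack_def)
  qed
  ultimately have "?q * exp (sqrt ?L / k) \<le> ?m powr (1 / k)" by simp
  then have "?q / ?m powr (1 / k) \<le> ?q / (?q * exp (sqrt ?L / k))"
    using q m(1) by (intro divide_left_mono mult_pos_pos) auto
  also have "\<dots> = exp (- sqrt ?L / k)"
  proof -
    have "?q \<noteq> 0" using q by linarith
    then show ?thesis
      by (subst nonzero_divide_mult_cancel_left) (simp_all add: exp_minus inverse_eq_divide)
  qed
  finally have 1: "real (n choose 2) / (t * ?m powr (1 / k)) \<le> exp (- sqrt ?L / k)" by (simp add: field_simps)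
  have "rounds k n t = nat \<lceil>4 * sqrt ?L\<rceil> + 1" using False by (simp add: rounds_def)
  then have "real (rounds k n t) \<le> 4 * sqrt ?L + 2" using L by (simp add: real_nat_ceiling_ge) linarith
  then have "real (rounds k n t) ^ 2 \<le> (4 * sqrt ?L + 2)\<^sup>2" by (intro power_mono) auto
  then have "real (rounds k n t) ^ 2 * (real (n choose 2) / (t * ?m powr (1 / k))) \<le>
    (4 * sqrt ?L + 2)\<^sup>2 * exp (- sqrt ?L / k)" using 1 by (intro mult_mono) auto
  also have "\<dots> \<le> round_error k n t" by (simp add: round_error_def)
  finally show ?thesis .
qed

lemma budget_bounds:
  fixes y :: real
  assumes k: "k \<ge> 1" and n: "n \<ge> 1" and t: "1 \<le> t" "t \<le> n choose 2"
  defines y: "y \<equiv> real n * (real n ^ 2 / t) ^ (k - 1) * slack n ^ 2"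
  shows "y \<ge> 1" "y \<le> budget k n t" "budget k n t \<le> 2 * y"
proof -
  have "real t \<le> real n ^ 2" using t(2) choose_two_le[of n] by linarith
  then have "1 \<le> (real n ^ 2 / t) ^ (k - 1)" using t by (intro one_le_power) simp
  moreover have "1 \<le> slack n ^ 2" using slack_ge_one[OF n] by (intro one_le_power)
  moreover have "1 \<le> real n" using n by simp
  ultimately have "1 * 1 * 1 \<le> y" unfolding y by (intro mult_mono) auto
  then show y1: "y \<ge> 1" by simp
  show "y \<le> budget k n t" unfolding budget_def y[symmetric] by linarith
  show "budget k n t \<le> 2 * y" unfolding budget_def y[symmetric] using y1 by linarith
qed

text \<open>The expected number of presented host edges carries one factor \<open>slack\<close>, the
  budget two.\<close>

lemma budget_error_le:
  assumes k: "k \<ge> 1" and n: "n \<ge> 1" and t: "1 \<le> t" "t \<le> n choose 2"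
  shows "(n * ((2 * k + 9) * cluster_size k n t)) * real t / ((n choose 2) * real (budget k n t)) \<le>
    2 * (2 * real k + 9) / slack n"
proof -
  let ?N = "real (n choose 2)" and ?g = "slack n" and ?m = "real (cluster_size k n t)" and ?b = "real (budget k n t)"
  have N: "?N \<ge> real t" "real t > 0" using t by auto
  have g: "?g \<ge> 1" using slack_ge_one[OF n] .
  note b = budget_bounds[OF k n t]
  have "(?N / t) ^ (k - 1) \<le> (real n ^ 2 / t) ^ (k - 1)"
    using choose_two_le N by (intro power_mono divide_right_mono) auto
  then have "real n * (?N / t) ^ (k - 1) * ?g ^ 2 \<le> real n * (real n ^ 2 / t) ^ (k - 1) * ?g ^ 2"
    by (intro mult_right_mono mult_left_mono) auto
  then have b2: "real n * (?N / t) ^ (k - 1) * ?g ^ 2 \<le> ?b" using b by linarith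
  have "?m * t / ?N \<le> (2 * (?N / t) ^ k * ?g) * t / ?N"
    using cluster_size_bounds(3)[OF t n, of k] N by (intro divide_right_mono mult_right_mono) auto
  also have "\<dots> = 2 * (?N / t) ^ (k - 1) * ?g"
  proof -
    obtain j where j: "k = Suc j" using k by (cases k) auto
    have cancel: "(2 * (a / c) ^ Suc j * g) * c / a = 2 * (a / c) ^ j * g" if "a > 0" "c > 0" for a c g :: real
      using that by simp
    show ?thesis unfolding j diff_Suc_1 by (rule cancel) (use N in linarith)+
  qed
  finally have "real n * (?m * t / ?N) * ?g \<le> real n * (2 * (?N / t) ^ (k - 1) * ?g) * ?g"
    using g by (intro mult_right_mono mult_left_mono) auto
  also have "\<dots> = 2 * (real n * (?N / t) ^ (k - 1) * ?g ^ 2)" by (simp add: power2_eq_square)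
  also have "\<dots> \<le> 2 * ?b" using b2 by simp
  finally have le: "real n * (?m * t / ?N) * ?g \<le> 2 * ?b" .
  have "A / c \<le> 2 / g" if "A * g \<le> 2 * c" "c > 0" "g > 0" for A c g :: real
    using that by (simp add: field_simps)
  from this[OF le] have "real n * (?m * t / ?N) / ?b \<le> 2 / ?g" using b(1,2) g by linarith
  then have "(2 * real k + 9) * (real n * (?m * t / ?N) / ?b) \<le> (2 * real k + 9) * (2 / ?g)"
    by (intro mult_left_mono) auto
  then show ?thesis by (simp add: mult_ac)
qed

definition builder :: "nat \<Rightarrow> nat \<Rightarrow> nat \<Rightarrow> strategy" where
  "builder k n t = greedy_strategy (cluster_cycle.host n k (cluster_size k n t)) (budget k n t)"

lemma prob_builder_ge:
  assumes k: "k \<ge> 2" and n: "real n \<ge> (real k + 1) ^ 2" and t: "1 \<le> t" "t \<le> n choose 2" "2 * rounds k n t \<le> t"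
    and small: "exp 1 * (16 * cluster_cycle.C k * round_error k n t) \<le> 1 / 2"
  shows "measure_pmf.prob (builder_graph n t (builder k n t)) {B. contains_hamilton_cycle_power k n B} \<ge>
    1 - 2 * exp 1 * (16 * cluster_cycle.C k * round_error k n t) - 2 * (2 * real k + 9) / slack n"
proof -
  define m where "m = cluster_size k n t"
  define r where "r = rounds k n t"
  define w where "w = t div r"
  have "(real k + 1) ^ 2 > 2 * real k" by (simp add: power2_eq_square algebra_simps add_pos_nonneg)
  then have nk: "n > 2 * k" using n by linarith
  then have n1: "n \<ge> 1" by simp
  have r1: "r \<ge> 1" by (simp add: r_def rounds_def)
  \<comment> \<open>Rounding \<open>t / r\<close> down discards fewer than r edges, at most half of
    them because 2 r \<le> t.\<close>
  have wr: "real t \<le> 2 * (real r * real w)"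
  proof -
    have "t < r * w + r" unfolding w_def using r1 dividend_less_times_div[of r t] by linarith
    moreover have "2 * r \<le> t" using t by (simp add: r_def)
    ultimately have "t \<le> 2 * (r * w)" by linarith
    then have "real t \<le> real (2 * (r * w))" by (simp only: of_nat_le_iff)
    then show ?thesis by simp
  qed
  then have w: "w > 0" using t by (cases "w = 0") auto
  interpret cluster_cycle n k m
    using k nk cluster_size_bounds[OF t(1,2) n1, of k] by unfold_locales (auto simp: m_def)
  define \<eta> where "\<eta> = \<beta> * (n choose 2) / w"
  have \<eta>0: "\<eta> \<ge> 0" using \<beta>_pos by (simp add: \<eta>_def)
  have "1 / real w \<le> 2 * real r / t" using wr w t by (simp add: field_simps)
  then have "(r * (8 * C / m powr (1 / k) * (n choose 2))) * (1 / w) \<le>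
    (r * (8 * C / m powr (1 / k) * (n choose 2))) * (2 * real r / t)"
    using C_pos by (intro mult_left_mono) auto
  also have "\<dots> = 16 * C * (real r ^ 2 * (real (n choose 2) / (t * real m powr (1 / k))))"
    by (simp add: power2_eq_square mult_ac)
  also have "\<dots> \<le> 16 * C * round_error k n t"
    using rounds_error_le[OF n1 k1 t(1,2)] C_pos by (intro mult_left_mono) (simp_all add: r_def m_def)
  finally have r\<eta>: "r * \<eta> \<le> 16 * C * round_error k n t" by (simp add: \<eta>_def \<beta>_def)
  have "1 * \<eta> \<le> r * \<eta>" using r1 \<eta>0 by (intro mult_right_mono) auto
  then have "\<eta> \<le> 16 * C * round_error k n t" using r\<eta> by simp
  then have "exp 1 * \<eta> \<le> exp 1 * (16 * C * round_error k n t)" by (intro mult_left_mono) auto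
  then have \<eta>2: "exp 1 * \<eta> \<le> 1 / 2" using small by (rule order_trans)
  have b: "budget k n t > 0" using budget_bounds(1,2)[OF k1 n1 t(1,2)] by (cases "budget k n t") auto
  have "r * w \<le> t" by (simp add: w_def)
  moreover have "real (k * n + 1) \<le> sqrt m ^ r" using rounds_enough[OF n t(1,2)] by (simp add: m_def r_def)
  ultimately have "measure_pmf.prob (builder_graph n t (builder k n t)) {B. contains_hamilton_cycle_power k n B} \<ge>
    1 - r * (2 * exp 1 * \<eta>) - (n * ((2 * k + 9) * m)) * real t / ((n choose 2) * real (budget k n t))"
    using prob_greedy_ge[OF _ _ w t(1,2) \<eta>_def \<eta>2 b, of r] unfolding builder_def m_def[symmetric] by metis
  moreover have "(n * ((2 * k + 9) * m)) * real t / ((n choose 2) * real (budget k n t)) \<le> 2 * (2 * real k + 9) / slack n"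
    using budget_error_le[OF k1 n1 t(1,2)] by (simp only: m_def)
  moreover have "r * (2 * exp 1 * \<eta>) \<le> 2 * exp 1 * (16 * C * round_error k n t)"
  proof -
    have "2 * exp 1 * (r * \<eta>) \<le> 2 * exp 1 * (16 * C * round_error k n t)" using r\<eta> by (intro mult_left_mono) auto
    then show ?thesis by (simp only: mult_ac)
  qed
  ultimately show ?thesis by linarith
qed

lemma rounds_le: "real (rounds k n t) \<le> 4 * sqrt (ln (real n)) + 5"
proof (cases "n = 0")
  case False
  then have "ln (real n) \<ge> 0" by simp
  then have "4 * sqrt (ln (real n)) \<ge> 0" by simp
  then show ?thesis unfolding rounds_def by (simp del: mult_le_cancel_left_pos) linarith
qed (simp add: rounds_def)

text \<open>Before rounding up, b t^(k-1) equals n^(2k-1) times \<open>slack n ^ 2\<close>. As the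
  unrounded budget is at least 1, rounding costs at most the factor 2.\<close>

lemma ln_budget:
  assumes k: "k \<ge> 1" and n: "n \<ge> 1" and t: "1 \<le> t" "t \<le> n choose 2"
  defines "X \<equiv> real (budget k n t) * real t ^ (k - 1)"
  shows "X > 0" "(2 * real k - 1) * ln n + 2 * sqrt (ln n) \<le> ln X"
    "ln X \<le> (2 * real k - 1) * ln n + 2 * sqrt (ln n) + ln 2"
proof -
  define y where "y = real n * (real n ^ 2 / t) ^ (k - 1) * slack n ^ 2"
  note b = budget_bounds[OF k n t, folded y_def]
  have tk: "real t ^ (k - 1) > 0" using t by simp
  have yt: "y * real t ^ (k - 1) = real n ^ (2 * k - 1) * slack n ^ 2"
  proof -
    obtain j where j: "k = Suc j" using k by (cases k) auto
    have "(real n ^ 2 / t) ^ j * real t ^ j = (real n ^ 2) ^ j"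
      using t by (simp add: power_divide)
    moreover have "(real n ^ 2) ^ j = real n ^ (2 * j)" by (rule power_mult[symmetric])
    ultimately show ?thesis by (simp add: y_def j mult_ac)
  qed
  have lny: "ln (y * real t ^ (k - 1)) = (2 * real k - 1) * ln n + 2 * sqrt (ln n)"
  proof -
    have "ln (real n ^ (2 * k - 1) * slack n ^ 2) = ln (real n ^ (2 * k - 1)) + ln (slack n ^ 2)"
      using n by (simp add: ln_mult slack_def)
    also have "\<dots> = real (2 * k - 1) * ln n + 2 * sqrt (ln n)"
      using n by (simp add: ln_realpow slack_def)
    also have "real (2 * k - 1) = 2 * real k - 1" using k by (simp add: of_nat_diff)
    finally show ?thesis by (simp only: yt)
  qed
  have yX: "y * real t ^ (k - 1) \<le> X" unfolding X_def using b(2) tk by (intro mult_right_mono) auto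
  have y0: "y * real t ^ (k - 1) > 0" using b(1) tk by simp
  show X0: "X > 0" using yX y0 by linarith
  have "ln (y * real t ^ (k - 1)) \<le> ln X" using yX y0 X0 by simp
  then show "(2 * real k - 1) * ln n + 2 * sqrt (ln n) \<le> ln X" by (simp only: lny)
  have "X \<le> 2 * (y * real t ^ (k - 1))"
    unfolding X_def mult.assoc[symmetric] using b(3) tk by (intro mult_right_mono) auto
  then have "ln X \<le> ln (2 * (y * real t ^ (k - 1)))" using X0 y0 by (intro ln_le_cancel_iff[THEN iffD2]) auto
  also have "\<dots> = ln 2 + ln (y * real t ^ (k - 1))" using y0 by (intro ln_mult_pos) auto
  finally show "ln X \<le> (2 * real k - 1) * ln n + 2 * sqrt (ln n) + ln 2" by (simp only: lny)
qed

theorem theorem1p7: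
  fixes k :: nat and t :: "nat \<Rightarrow> nat"
  assumes "k \<ge> 2"
    and "\<And>n. t n \<le> n choose 2"
    and "(\<lambda>n. real (t n)) \<in> \<omega>(\<lambda>n. real n powr (2 - 1 / real k))"
  shows "\<exists>(b :: nat \<Rightarrow> nat) (\<epsilon> :: nat \<Rightarrow> real) (S :: nat \<Rightarrow> strategy).
           \<epsilon> \<in> o(\<lambda>_. 1) \<and>
           (\<forall>\<^sub>F n in sequentially.
              real (b n) = real n powr (2 * real k - 1 + \<epsilon> n) / real (t n) ^ (k - 1)) \<and>
           successful_strategy t b (contains_hamilton_cycle_power k) S"
proof -
  define b where "b n = budget k n (t n)" for n
  \<comment> \<open>\<epsilon> solves the required equation for the budget exactly, so that only its
    convergence remains; it is about 2 / sqrt (ln n).\<close>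
  define \<epsilon> where "\<epsilon> n = ln (real (b n) * real (t n) ^ (k - 1)) / ln n - (2 * real k - 1)" for n
  define S where "S n = builder k n (t n)" for n
  have k1: "k \<ge> 1" and kpos: "real k > 0" using assms(1) by auto
  have small: "(\<lambda>n. real n powr (2 - 1 / real k)) \<in> o(\<lambda>n. real (t n))"
    using assms(3) by (simp add: smallomega_iff_smallo)
  have lim: "(\<lambda>n. real n powr (2 - 1 / real k) / real (t n)) \<longlonglongrightarrow> 0"
    using smalloD_tendsto[OF small] .
  have t_ge: "\<forall>\<^sub>F n in sequentially. real n powr (2 - 1 / real k) \<le> real (t n)"
    using landau_o.smallD[OF small, of 1] by (simp add: eventually_mono)
  have n_large: "\<forall>\<^sub>F n in sequentially. real n \<ge> c" for c
    using filterlim_real_sequentially by (simp add: filterlim_at_top)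
  have t_large: "\<forall>\<^sub>F n in sequentially. 1 \<le> t n \<and> 2 * rounds k n (t n) \<le> t n"
  proof -
    \<comment> \<open>Since 2 - 1 / k \<ge> 1, eventually \<open>t n\<close> is at least
      \<open>n\<close>, far more than twice the number of rounds.\<close>
    have "\<forall>\<^sub>F n in sequentially. 2 * (4 * sqrt (ln (real n)) + 5) \<le> real n powr 1" by real_asymp
    then show ?thesis using t_ge n_large[of 1]
    proof eventually_elim
      case (elim n)
      have "1 / real k \<le> 1" using k1 by simp
      then have "real n powr 1 \<le> real n powr (2 - 1 / real k)" using elim by (intro powr_mono) auto
      then have "2 * (4 * sqrt (ln (real n)) + 5) \<le> real (t n)" using elim by linarith
      moreover have "2 * real (rounds k n (t n)) \<le> 2 * (4 * sqrt (ln (real n)) + 5)"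
        by (intro mult_left_mono rounds_le) simp
      ultimately have "2 * real (rounds k n (t n)) \<le> real (t n)" by (rule order_trans[rotated])
      moreover have "1 \<le> real (t n)" using \<open>real n powr 1 \<le> _\<close> elim by simp
      ultimately show ?case by linarith
    qed
  qed
  have round_lim: "(\<lambda>n. round_error k n (t n)) \<longlonglongrightarrow> 0"
  proof -
    have "(\<lambda>n. (4 * sqrt (ln (real n)) + 2)\<^sup>2 * exp (- sqrt (ln (real n)) / real k)) \<longlonglongrightarrow> 0"
      using kpos by real_asymp
    from tendsto_add[OF tendsto_mult_left[OF lim, of 9] this] show ?thesis
      by (simp add: round_error_def)
  qed
  have slack_lim: "(\<lambda>n. 2 * (2 * real k + 9) / slack n) \<longlonglongrightarrow> 0"
    unfolding slack_def by real_asymp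
  let ?C = "cluster_cycle.C k"
  have C_lim: "(\<lambda>n. exp 1 * (16 * ?C * round_error k n (t n))) \<longlonglongrightarrow> 0"
    using tendsto_mult_left[OF round_lim, of "exp 1 * (16 * ?C)"] by (simp add: mult.assoc)
  have "\<forall>\<^sub>F n in sequentially. exp 1 * (16 * ?C * round_error k n (t n)) < 1 / 2"
    using C_lim by (rule order_tendstoD) simp
  then have lower: "\<forall>\<^sub>F n in sequentially.
      1 - 2 * exp 1 * (16 * ?C * round_error k n (t n)) - 2 * (2 * real k + 9) / slack n \<le>
      measure_pmf.prob (builder_graph n (t n) (S n)) {B. contains_hamilton_cycle_power k n B}"
    using t_large n_large[of "(real k + 1) ^ 2"]
  proof eventually_elim
    case (elim n)
    then show ?case unfolding S_def using assms(1,2) by (intro prob_builder_ge) auto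
  qed
  have "(\<lambda>n. 1 - 2 * (exp 1 * (16 * ?C * round_error k n (t n))) - 2 * (2 * real k + 9) / slack n) \<longlonglongrightarrow> 1 - 2 * 0 - 0"
    by (intro tendsto_intros C_lim slack_lim)
  then have lower_lim: "(\<lambda>n. 1 - 2 * exp 1 * (16 * ?C * round_error k n (t n)) - 2 * (2 * real k + 9) / slack n) \<longlonglongrightarrow> 1"
    by (simp add: mult.assoc)
  have "(\<lambda>n. measure_pmf.prob (builder_graph n (t n) (S n)) {B. contains_hamilton_cycle_power k n B}) \<longlonglongrightarrow> 1"
    by (rule tendsto_sandwich[OF lower _ lower_lim tendsto_const]) simp
  moreover have "tb_strategy n (t n) (b n) (S n)" for n
    unfolding S_def b_def builder_def by (rule tb_strategy_greedy)
  ultimately have success: "successful_strategy t b (contains_hamilton_cycle_power k) S"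
    by (simp add: successful_strategy_def)
  have X: "\<forall>\<^sub>F n in sequentially. n \<ge> 2 \<and> real (b n) * real (t n) ^ (k - 1) > 0 \<and>
      2 * sqrt (ln n) / ln n \<le> \<epsilon> n \<and> \<epsilon> n \<le> (2 * sqrt (ln n) + ln 2) / ln n"
    using t_large n_large[of 2]
  proof eventually_elim
    case (elim n)
    then have n: "n \<ge> 1" "ln (real n) > 0" by auto
    note l = ln_budget[OF k1 n(1) conjunct1[OF elim(1)] assms(2), folded b_def]
    have "2 * sqrt (ln n) / ln n \<le> (ln (real (b n) * real (t n) ^ (k - 1)) - (2 * real k - 1) * ln n) / ln n"
      using l(2) n(2) by (intro divide_right_mono) auto
    moreover have "(ln (real (b n) * real (t n) ^ (k - 1)) - (2 * real k - 1) * ln n) / ln n \<le> (2 * sqrt (ln n) + ln 2) / ln n"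
      using l(3) n(2) by (intro divide_right_mono) auto
    moreover have "(ln (real (b n) * real (t n) ^ (k - 1)) - (2 * real k - 1) * ln n) / ln n = \<epsilon> n"
      using n(2) by (simp add: \<epsilon>_def diff_divide_distrib)
    ultimately show ?case using elim l(1) by simp
  qed
  have "\<epsilon> \<longlonglongrightarrow> 0"
  proof (rule tendsto_sandwich)
    show "\<forall>\<^sub>F n in sequentially. 2 * sqrt (ln (real n)) / ln (real n) \<le> \<epsilon> n"
      using X by (rule eventually_mono) simp
    show "\<forall>\<^sub>F n in sequentially. \<epsilon> n \<le> (2 * sqrt (ln (real n)) + ln 2) / ln (real n)"
      using X by (rule eventually_mono) simp
    show "(\<lambda>n. 2 * sqrt (ln (real n)) / ln (real n)) \<longlonglongrightarrow> 0" by real_asymp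
    show "(\<lambda>n. (2 * sqrt (ln (real n)) + ln 2) / ln (real n)) \<longlonglongrightarrow> 0" by real_asymp
  qed
  then have "\<epsilon> \<in> o(\<lambda>_. 1)" by (intro smalloI_tendsto) auto
  moreover have "\<forall>\<^sub>F n in sequentially.
      real (b n) = real n powr (2 * real k - 1 + \<epsilon> n) / real (t n) ^ (k - 1)"
    using X t_large
  proof eventually_elim
    case (elim n)
    let ?X = "real (b n) * real (t n) ^ (k - 1)"
    have "ln (real n) > 0" using elim by simp
    then have "(2 * real k - 1 + \<epsilon> n) * ln n = ln ?X" by (simp add: \<epsilon>_def)
    then have "real n powr (2 * real k - 1 + \<epsilon> n) = ?X" using elim by (simp add: powr_def)
    then show ?case using elim by simp
  qed
  ultimately show ?thesis using success by blast
qed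

end
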